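(* Let $\delta\in[0,1]$ and let $P_d$ be a probability distribution on $\mathbb{Z}_+=\{0,1,2,\dots\}$ with $\mathbb{P}[d\le1]<1$. Let $\mathcal{Q}$ be the associated BP operator (without survey). Then for any $\phi\in(0,\frac12)$ and any symmetric $\mu$, $$B_\phi\boxtimes\mathcal{Q}^2\mu\prec\mathcal{Q}^2(B_\phi\boxtimes\mu)\quad\text{if }\mathbb{P}[d>2]=0,$$ $$B_\phi\boxtimes\mathcal{Q}\mu\prec\mathcal{Q}(B_\phi\boxtimes\mu)\quad\text{otherwise}.$$
   Context: A probability distribution $\mu$ on $(-\infty,+\infty]$ is symmetric if $\mu[E]=\int e^{-r}\mathbf{1}\{-r\in E\}\,d\mu(r)$ for every measurable $E\subseteq(-\infty,+\infty)$ (an atom at $+\infty$ is allowed). BP operator without survey: for symmetric $\mu$, $\mathcal{Q}\mu$ is the law of $\sum_{u=1}^dZ_uF_\delta(\tilde R_u)$, where $F_\delta(x)=\ln\frac{(1-\delta)e^x+\delta}{\delta e^x+1-\delta}$ (extended continuously to $+\infty$), $d\sim P_d$, $\tilde R_u\sim\mu$ i.i.d., $Z_u$ i.i.d. with $\mathbb{P}[Z_u=-1]=\delta=1-\mathbb{P}[Z_u=1]$, all jointly independent. For $\phi\in[0,1]$, $B_\phi$ is the symmetric distribution on $\{\pm\ln\frac{1-\phi}{\phi}\}$ (mass $1-\phi$ at $\ln\frac{1-\phi}\phi$ and $\phi$ at $-\ln\frac{1-\phi}{\phi}$; $B_0=B_1$ is the unit mass at $+\infty$, $B_{1/2}$ the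 unit mass at $0$). Box convolution (denoted here $\boxtimes$): $\mu\boxtimes\nu$ is the law of $2\tanh^{-1}(\tanh\frac X2\tanh\frac Y2)$ for independent $X\sim\mu$, $Y\sim\nu$; equivalently it is the weakly continuous bilinear operation on symmetric distributions with $B_{\phi_1}\boxtimes B_{\phi_2}=B_{\phi_1+\phi_2-2\phi_1\phi_2}$. Degradation: for symmetric $\mu_Y,\mu_Z$, $\mu_Y\preceq\mu_Z$ means there is a joint distribution of $(Y,Z)$ with these marginals whose conditional law $\mu_{Y|Z}$ is invariant under $(Y,Z)\to(-Y,-Z)$; i.e. there is a Markov kernel $K$ on $[-\infty,+\infty]$ with $K(-z,-E)=K(z,E)$ and $\mu_Y=\int K(z,\cdot)\,d\mu_Z(z)$. Strict degradation: $\nu\prec\mu$ means there exists $\phi'\in(0,\frac12]$ with $\nu\preceq B_{\phi'}\boxtimes\mu$. *)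

theory Defs
  imports "HOL-Probability.Probability" "HOL-Real_Asymp.Real_Asymp"
begin

text \<open>
  Distributions on \<open>(-\<infinity>, +\<infinity>]\<close> are Borel probability measures on \<^typ>\<open>ereal\<close> that do not
  charge \<open>-\<infinity>\<close>.  The test sets \<open>E\<close> range over Borel sets of finite reals, so the atom at
  \<open>+\<infinity>\<close> is unconstrained; on the support of the integrand \<open>r\<close> is finite, hence
  \<^const>\<open>real_of_ereal\<close> is harmless there.
\<close>

definition symmetric_dist :: "ereal measure \<Rightarrow> bool" where
  "symmetric_dist \<mu> \<longleftrightarrow>
     prob_space \<mu> \<and> sets \<mu> = sets borel \<and> emeasure \<mu> {-\<infinity>} = 0 \<and>
     (\<forall>E \<in> sets (borel :: real measure).
        emeasure \<mu> (ereal ` E) =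
          (\<integral>\<^sup>+ r. ennreal (exp (- real_of_ereal r)) * indicator (ereal ` E) (- r) \<partial>\<mu>))"

text \<open>The log-likelihood ratio \<open>ln ((1 - \<phi>) / \<phi>)\<close> for \<open>\<phi> \<in> [0, 1]\<close>, with its limits at the end points.\<close>

definition llr :: "real \<Rightarrow> ereal" where
  "llr \<phi> = (if \<phi> = 0 then \<infinity> else if \<phi> = 1 then -\<infinity> else ereal (ln ((1 - \<phi>) / \<phi>)))"

text \<open>
  For \<open>\<phi> = 0\<close> and for \<open>\<phi> = 1\<close> this is the unit mass at \<open>+\<infinity>\<close>, and for \<open>\<phi> = 1/2\<close> the unit mass at \<open>0\<close>.
\<close>

definition bsc :: "real \<Rightarrow> ereal measure" where
  "bsc \<phi> = distr (measure_pmf (bernoulli_pmf \<phi>)) borel (\<lambda>flip. if flip then - llr \<phi> else llr \<phi>)"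

definition tanh_half :: "ereal \<Rightarrow> real" where
  "tanh_half x = (if x = \<infinity> then 1 else if x = -\<infinity> then -1 else tanh (real_of_ereal x / 2))"

text \<open>The map \<open>2 artanh\<close> on \<open>[-1, 1]\<close>, with values \<open>\<plusminus>\<infinity>\<close> at \<open>\<plusminus>1\<close>.\<close>

definition two_artanh :: "real \<Rightarrow> ereal" where
  "two_artanh t = (if t = 1 then \<infinity> else if t = -1 then -\<infinity> else ereal (2 * artanh t))"

definition box_conv :: "ereal measure \<Rightarrow> ereal measure \<Rightarrow> ereal measure" (infixr "\<boxtimes>" 70) where
  "\<mu> \<boxtimes> \<nu> = distr (\<mu> \<Otimes>\<^sub>M \<nu>) borel (\<lambda>(x, y). two_artanh (tanh_half x * tanh_half y))"

text \<open>
  The values at \<open>\<plusminus>\<infinity>\<close> are the continuous extensions.  The value at \<open>-\<infinity>\<close> is never used with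
  positive probability.
\<close>

definition bp_fun :: "real \<Rightarrow> ereal \<Rightarrow> ereal" where
  "bp_fun \<delta> x =
     (if x = \<infinity> then llr \<delta> else if x = -\<infinity> then - llr \<delta>
      else ereal (ln (((1 - \<delta>) * exp (real_of_ereal x) + \<delta>) / (\<delta> * exp (real_of_ereal x) + 1 - \<delta>))))"

lemma bp_fun_tendsto_PInfty:
  assumes "\<delta> \<in> {0..1}"
  shows "((\<lambda>x. bp_fun \<delta> (ereal x)) \<longlongrightarrow> bp_fun \<delta> \<infinity>) at_top"
proof -
  consider "\<delta> = 0" | "\<delta> = 1" | "0 < \<delta>" "\<delta> < 1" using assms by fastforce
  then show ?thesis
  proof cases
    case 1
    have "((\<lambda>x. ereal x) \<longlongrightarrow> \<infinity>) at_top"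
      by (simp add: tendsto_PInfty_eq_at_top filterlim_ident)
    then show ?thesis using 1 by (simp add: bp_fun_def llr_def)
  next
    case 2
    have "((\<lambda>x. - ereal x) \<longlongrightarrow> - \<infinity>) at_top"
      by (intro tendsto_uminus_ereal) (simp add: tendsto_PInfty_eq_at_top filterlim_ident)
    then show ?thesis using 2 by (simp add: bp_fun_def llr_def ln_div)
  next
    case 3
    have "((\<lambda>x::real. ln (((1 - \<delta>) * exp x + \<delta>) / (\<delta> * exp x + 1 - \<delta>))) \<longlongrightarrow> ln ((1 - \<delta>) / \<delta>)) at_top"
      using 3 by real_asymp (simp add: divide_inverse)
    then show ?thesis using 3 by (simp add: bp_fun_def llr_def)
  qed
qed

definition flip_sign_pmf :: "real \<Rightarrow> real pmf" where
  "flip_sign_pmf \<delta> = map_pmf (\<lambda>flip. if flip then -1 else 1) (bernoulli_pmf \<delta>)"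

text \<open>
  The law of \<open>Z\<^sub>1 F(R\<^sub>1) + \<dots> + Z\<^sub>d F(R\<^sub>d)\<close>; joint independence is the product measure of the law of \<open>d\<close> and
  of the laws of two i.i.d. sequences, of which only the first \<open>d\<close> terms are used.
  For \<open>\<mu>\<close> without mass at \<open>-\<infinity>\<close>, almost surely no term is \<open>-\<infinity>\<close> (infinite terms need \<open>\<delta> \<in> {0, 1}\<close>, where
  \<open>Z\<close> is a.s. constant), so \<^typ>\<open>ereal\<close>'s value for \<open>\<infinity> + (-\<infinity>)\<close> plays no role.
\<close>

definition bp :: "real \<Rightarrow> nat pmf \<Rightarrow> ereal measure \<Rightarrow> ereal measure" where
  "bp \<delta> P \<mu> =
     distr (measure_pmf P \<Otimes>\<^sub>M (\<Pi>\<^sub>M u\<in>UNIV. \<mu>) \<Otimes>\<^sub>M (\<Pi>\<^sub>M u\<in>UNIV. measure_pmf (flip_sign_pmf \<delta>))) borel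
       (\<lambda>(d, R, Z). \<Sum>u = 1..d. ereal (Z u) * bp_fun \<delta> (R u))"

definition degraded :: "ereal measure \<Rightarrow> ereal measure \<Rightarrow> bool" (infix "\<preceq>\<^sub>d" 50) where
  "\<mu>Y \<preceq>\<^sub>d \<mu>Z \<longleftrightarrow>
     (\<exists>K \<in> borel \<rightarrow>\<^sub>M prob_algebra borel.
        (\<forall>z. \<forall>E \<in> sets borel. emeasure (K (- z)) (uminus ` E) = emeasure (K z) E) \<and>
        \<mu>Y = \<mu>Z \<bind> K)"

definition strictly_degraded :: "ereal measure \<Rightarrow> ereal measure \<Rightarrow> bool" (infix "\<prec>\<^sub>d" 50) where
  "\<nu> \<prec>\<^sub>d \<mu> \<longleftrightarrow> (\<exists>\<phi> \<in> {0<..1/2}. \<nu> \<preceq>\<^sub>d bsc \<phi> \<boxtimes> \<mu>)"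

end

theory Submission
  imports Defs
begin

text \<open>
  Symmetric distributions are compared through the stop-loss functions \<open>t \<mapsto> E (\<bar>\<theta>\<bar> - t)\<^sup>+\<close> of the bias
  \<open>\<theta> = tanh (R / 2)\<close>: degradation is the increasing convex order of \<open>\<bar>\<theta>\<bar>\<close>.  Adding two independent
  log-likelihood ratios acts on these functions by an explicit kernel, from which one reads off that
  noise applied to a sum never beats independent noise applied to its summands, and that the
  inequality is strict for every \<open>t\<close> up to the essential supremum of the left-hand bias, except that a
  sum of two terms gives equality at \<open>t = 0\<close>.  A third summand, or a second iteration, removes this
  exception.  By compactness a strict inequality leaves a uniform gap \<open>\<epsilon>\<close>.  The gap pays for some extra
  noise on the right and for rounding both sides to a finite grid, where Strassen's theorem is
  elementary and the garbling kernel can be written down.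
\<close>

section \<open>Finite transport\<close>

text \<open>Two summands tie at 0 because summands of biases \<open>a\<close> and \<open>b\<close>
  give \<open>kern a b 0 = max \<bar>a\<bar> \<bar>b\<bar>\<close>, which noise merely scales. For
  \<open>t > 0\<close> the gap comes from the weights of the two outcomes: with noise factor
  \<open>c\<close>, independent noise turns the product \<open>a * b\<close> into
  \<open>c\<^sup>2 * (a * b)\<close>, while noise on the sum leaves it alone. Compactness needs
  strictness on a closed interval, hence also where the left side has just vanished. It holds there
  because noise on the sum lowers the largest bias to \<open>c * tpow m d\<close>, which for
  \<open>m > 0\<close> and \<open>d \<ge> 2\<close> is strictly below the value
  \<open>tpow (c * m) d\<close> for noisy summands. Past that point nothing is asked, since
  eventually both sides vanish. With unbounded degrees the supremum of the largest biases may not be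
  attained; then a single far larger degree provides the gap. A second iteration helps at 0 because
  the stop-loss function of a two-term sum at 0 involves that of one term at the bias
  \<open>b\<close> of the other. Unless everything is trivial, \<open>b\<close> is positive with
  positive probability, and at positive points the first iteration is already strict.\<close>

text \<open>Truncated subtraction on \<^typ>\<open>nat\<close> plays the role of the positive part \<open>(j - k)\<^sup>+\<close>.\<close>

definition call :: "nat \<Rightarrow> (nat \<Rightarrow> real) \<Rightarrow> nat \<Rightarrow> real" where
  "call n a k = (\<Sum>j\<le>n. real (j - k) * a j)"

text \<open>Column \<open>j\<close> may only receive mass whose mean index is at least
  \<open>j\<close>, so the column sums lie below \<open>b\<close> in the increasing convex order.
  Entries are pinned to 0 outside the square because plans are functions on all of
  \<open>nat \<times> nat\<close> and have to range over a compact set.\<close>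

definition transport :: "nat \<Rightarrow> (nat \<Rightarrow> real) \<Rightarrow> (nat \<times> nat \<Rightarrow> real) \<Rightarrow> bool" where
  "transport n b T \<longleftrightarrow>
     (\<forall>p. 0 \<le> T p) \<and> (\<forall>i j. n < i \<or> n < j \<longrightarrow> T (i, j) = 0) \<and>
     (\<forall>i\<le>n. (\<Sum>j\<le>n. T (i, j)) = b i) \<and>
     (\<forall>j\<le>n. 0 \<le> (\<Sum>i\<le>n. (real i - real j) * T (i, j)))"

definition target :: "nat \<Rightarrow> (nat \<times> nat \<Rightarrow> real) \<Rightarrow> nat \<Rightarrow> real" where
  "target n T j = (\<Sum>i\<le>n. T (i, j))"

text \<open>Columns are moved proportionally, so row sums survive automatically and every column
  statistic changes by an explicit amount. In use \<open>q = Suc r\<close>, and either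
  \<open>p < r\<close> or \<open>f = 0\<close> with \<open>p\<close> a dummy.\<close>

definition merge :: "(nat \<times> nat \<Rightarrow> real) \<Rightarrow> nat \<Rightarrow> nat \<Rightarrow> nat \<Rightarrow> real \<Rightarrow> real \<Rightarrow> nat \<times> nat \<Rightarrow> real" where
  "merge T p q r f g = (\<lambda>(i, j). T (i, j) + f * T (i, p) * (of_bool (j = r) - of_bool (j = p))
                                  + g * T (i, q) * (of_bool (j = r) - of_bool (j = q)))"

lemma sum_merge_row:
  assumes "p \<le> n" "q \<le> n" "r \<le> n"
  shows "(\<Sum>j\<le>n. h j * merge T p q r f g (i, j)) =
    (\<Sum>j\<le>n. h j * T (i, j)) + f * T (i, p) * (h r - h p) + g * T (i, q) * (h r - h q)"
proof -
  have *: "(\<Sum>j\<le>n. h j * of_bool (j = m)) = h m" if "m \<le> n" for m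
    using that by (simp add: of_bool_def if_distrib cong: if_cong)
  have "(\<Sum>j\<le>n. h j * merge T p q r f g (i, j)) =
    (\<Sum>j\<le>n. h j * T (i, j)) + f * T (i, p) * ((\<Sum>j\<le>n. h j * of_bool (j = r)) - (\<Sum>j\<le>n. h j * of_bool (j = p)))
     + g * T (i, q) * ((\<Sum>j\<le>n. h j * of_bool (j = r)) - (\<Sum>j\<le>n. h j * of_bool (j = q)))"
    unfolding merge_def by (simp add: algebra_simps sum.distrib sum_subtractf sum_distrib_left del: sum_mult_of_bool_eq sum_of_bool_mult_eq)
  then show ?thesis using assms by (simp only: *)
qed

lemma sum_merge_target:
  assumes "p \<le> n" "q \<le> n" "r \<le> n"
  shows "(\<Sum>j\<le>n. h j * target n (merge T p q r f g) j) =
    (\<Sum>j\<le>n. h j * target n T j) + f * target n T p * (h r - h p) + g * target n T q * (h r - h q)"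
proof -
  have sw: "(\<Sum>j\<le>n. h j * target n T j) = (\<Sum>i\<le>n. \<Sum>j\<le>n. h j * T (i, j))" for T
    unfolding target_def by (simp add: sum_distrib_left) (rule sum.swap)
  show ?thesis
    unfolding sw by (simp only: sum_merge_row[OF assms])
      (simp add: sum.distrib target_def sum_distrib_left sum_distrib_right mult_ac)
qed

text \<open>In use, mass lifted from \<open>p\<close> to \<open>r\<close> lacks barycentre and mass
  lowered from \<open>q\<close> to \<open>r\<close> has some to spare; \<open>bary\<close> says that
  the spare amount covers the lack. When \<open>f = 0\<close> the index \<open>p\<close> is inert
  and may coincide with \<open>r\<close>, hence the disjunction.\<close>

lemma transport_merge:
  assumes T: "transport n b T" and le: "p \<le> n" "q \<le> n" "r \<le> n" "q \<noteq> r"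
    and p: "f = 0 \<or> p \<noteq> q \<and> p \<noteq> r"
    and fg: "0 \<le> f" "f \<le> 1" "0 \<le> g" "g \<le> 1"
    and bary: "f * target n T p * (real r - real p) \<le> g * target n T q * (real q - real r)"
  shows "transport n b (merge T p q r f g)"
proof -
  let ?M = "merge T p q r f g"
  have T0: "0 \<le> T x" for x using T unfolding transport_def by blast
  have drift: "0 \<le> (\<Sum>i\<le>n. (real i - real j) * T (i, j))" if "j \<le> n" for j
    using T that by (simp add: transport_def)
  have Mp: "?M (i, p) = (1 - f) * T (i, p)" if "f \<noteq> 0" for i
    using le p that by (simp add: merge_def algebra_simps)
  have Mq: "?M (i, q) = (1 - g) * T (i, q)" for i using le p by (auto simp: merge_def algebra_simps)
  have Mr: "?M (i, r) = T (i, r) + f * T (i, p) + g * T (i, q)" for i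
    using le p by (auto simp: merge_def algebra_simps)
  have Mo: "?M (i, j) = T (i, j)" if "f = 0 \<or> j \<noteq> p" "j \<noteq> q" "j \<noteq> r" for i j
    using that by (auto simp: merge_def)
  have "0 \<le> ?M (i, j)" for i j
    using T0 fg Mp[of i] Mq[of i] Mr[of i] Mo[of j i]
    by (cases "f = 0"; cases "j = p"; cases "j = q"; cases "j = r") simp_all
  moreover have "?M (i, j) = 0" if "n < i \<or> n < j" for i j
    using T that le by (auto simp: merge_def transport_def)
  moreover have "(\<Sum>j\<le>n. ?M (i, j)) = b i" if "i \<le> n" for i
    using sum_merge_row[OF le(1-3), of "\<lambda>_. 1" T f g i] T that by (simp add: transport_def)
  moreover have "0 \<le> (\<Sum>i\<le>n. (real i - real j) * ?M (i, j))" if j: "j \<le> n" for j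
  proof -
    consider "j = p" "f \<noteq> 0" | "j = q" | "j = r" | "f = 0 \<or> j \<noteq> p" "j \<noteq> q" "j \<noteq> r" by blast
    then show ?thesis
    proof cases
      case 1
      have "(\<Sum>i\<le>n. (real i - real j) * ?M (i, j)) = (1 - f) * (\<Sum>i\<le>n. (real i - real j) * T (i, j))"
        by (simp only: 1 Mp[OF 1(2)] sum_distrib_left mult_ac)
      then show ?thesis using drift[OF j] fg by simp
    next
      case 2
      have "(\<Sum>i\<le>n. (real i - real j) * ?M (i, j)) = (1 - g) * (\<Sum>i\<le>n. (real i - real j) * T (i, j))"
        by (simp only: 2 Mq sum_distrib_left mult_ac)
      then show ?thesis using drift[OF j] fg by simp
    next
      case 3
      have "(\<Sum>i\<le>n. (real i - real j) * ?M (i, j)) = (\<Sum>i\<le>n. (real i - real r) * T (i, r))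
          + f * (\<Sum>i\<le>n. (real i - real p) * T (i, p)) + g * (\<Sum>i\<le>n. (real i - real q) * T (i, q))
          + (g * target n T q * (real q - real r) - f * target n T p * (real r - real p))"
        unfolding target_def 3 sum_distrib_left sum_distrib_right sum.distrib[symmetric] sum_subtractf[symmetric] Mr
        by (intro sum.cong) (simp_all add: algebra_simps)
      then show ?thesis using drift[OF le(1)] drift[OF le(2)] drift[OF le(3)] fg bary by simp
    next
      case 4
      then show ?thesis using drift[OF j] by (simp add: Mo)
    qed
  qed
  ultimately show ?thesis unfolding transport_def by auto
qed

text \<open>The discrete second difference of a hinge is a point mass, so call functions determine
  all weights except the one at 0. That one needs the total mass, which enters through
  \<open>call_first_difference\<close>.\<close>

lemma call_second_difference:
  "call n a r - 2 * call n a (Suc r) + call n a (Suc (Suc r)) = (if Suc r \<le> n then a (Suc r) else 0)"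
proof -
  have "real (j - r) - 2 * real (j - Suc r) + real (j - Suc (Suc r)) = of_bool (j = Suc r)" for j
    by (cases "j \<le> r"; cases "j = Suc r") (auto simp: of_nat_diff)
  then have "(real (j - r) - 2 * real (j - Suc r) + real (j - Suc (Suc r))) * a j = of_bool (j = Suc r) * a j" for j
    by (simp only:)
  then have "call n a r - 2 * call n a (Suc r) + call n a (Suc (Suc r)) = (\<Sum>j\<le>n. of_bool (j = Suc r) * a j)"
    unfolding call_def by (simp add: sum_distrib_left sum_subtractf[symmetric] sum.distrib[symmetric] algebra_simps)
  also have "\<dots> = (\<Sum>j\<le>n. if j = Suc r then a j else 0)" by (intro sum.cong) auto
  finally show ?thesis by simp
qed

lemma call_first_difference: "call n a 0 - call n a (Suc 0) = (\<Sum>j\<le>n. a j) - a 0"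
proof -
  have "(real (j - 0) - real (j - Suc 0)) * a j = a j - of_bool (j = 0) * a j" for j
    by (cases "j = 0") (auto simp: of_nat_diff)
  then have "call n a 0 - call n a (Suc 0) = (\<Sum>j\<le>n. a j - of_bool (j = 0) * a j)"
    unfolding call_def sum_subtractf[symmetric] left_diff_distrib[symmetric] by (simp only:)
  also have "\<dots> = (\<Sum>j\<le>n. a j) - (\<Sum>j\<le>n. if j = 0 then a j else 0)"
    by (simp only: sum_subtractf) (intro arg_cong2[of _ _ _ _ minus] sum.cong; simp)
  finally show ?thesis by simp
qed

lemma call_ge: "n \<le> k \<Longrightarrow> call n a k = 0"
  unfolding call_def by (intro sum.neutral) auto

lemma call_inject:
  assumes "\<And>k. call n a k = call n a' k" "(\<Sum>j\<le>n. a j) = (\<Sum>j\<le>n. a' j)" "j \<le> n"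
  shows "a j = a' j"
proof (cases j)
  case 0
  then show ?thesis using call_first_difference[of n a] call_first_difference[of n a'] assms by simp
next
  case (Suc i)
  then show ?thesis using call_second_difference[of n a i] call_second_difference[of n a' i] assms by simp
qed

text \<open>
  If the call function of the target lies strictly above that of \<open>a\<close> on \<open>{p<..r}\<close> and touches it at
  \<open>p\<close> and beyond \<open>r\<close>, then by convexity the target charges \<open>p\<close> and \<open>r + 1\<close>; moving a little of that
  mass to \<open>r\<close> lowers the call function on \<open>{p<..r}\<close> only.  If nothing touches below \<open>r\<close>, mass may
  simply be moved down from \<open>r + 1\<close> to \<open>r\<close>.
\<close>

lemma transport_improve:
  assumes T: "transport n b T" and a: "\<And>j. j \<le> n \<Longrightarrow> 0 \<le> a j"
    and tot: "(\<Sum>j\<le>n. a j) = (\<Sum>j\<le>n. target n T j)"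
    and ge: "\<And>k. call n a k \<le> call n (target n T) k"
    and neq: "\<exists>k. call n a k \<noteq> call n (target n T) k"
  obtains T' where "transport n b T'" "\<And>k. call n a k \<le> call n (target n T') k"
    "(\<Sum>j\<le>n. (real j)\<^sup>2 * target n T' j) < (\<Sum>j\<le>n. (real j)\<^sup>2 * target n T j)"
proof -
  let ?t = "target n T" and ?D = "\<lambda>k. call n (target n T) k - call n a k"
  define r where "r = Max {k. 0 < ?D k}"
  have sub: "{k. 0 < ?D k} \<subseteq> {..<n}" using call_ge[of n] by (fastforce simp: not_le[symmetric])
  then have fin: "finite {k. 0 < ?D k}" by (rule finite_subset) simp
  have "{k. 0 < ?D k} \<noteq> {}" using neq ge by (force simp: less_le)
  then have rD: "0 < ?D r" using Max_in[OF fin] by (simp add: r_def)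
  then have rn: "r < n" using sub by auto
  have above: "?D k = 0" if "r < k" for k
    using Max_ge[OF fin, of k] that ge[of k] by (fastforce simp: r_def)
  \<comment> \<open>\<open>?D\<close> is positive at \<open>r\<close> and zero at the next two
    points, so its second difference there is positive: the target exceeds \<open>a\<close> at
    \<open>Suc r\<close>.\<close>
  have q: "0 < ?t (Suc r)"
    using call_second_difference[of n ?t r] call_second_difference[of n a r] above[of "Suc r"]
      above[of "Suc (Suc r)"] rD rn a[of "Suc r"] by simp
  have upd: "call n (target n (merge T p (Suc r) r f g)) k = call n ?t k
      + f * ?t p * (real (r - k) - real (p - k)) + g * ?t (Suc r) * (real (r - k) - real (Suc r - k))"
    if "p \<le> n" for p f g k
    unfolding call_def using that rn by (intro sum_merge_target) auto
  have upd2: "(\<Sum>j\<le>n. (real j)\<^sup>2 * target n (merge T p (Suc r) r f g) j) = (\<Sum>j\<le>n. (real j)\<^sup>2 * ?t j)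
      + f * ?t p * ((real r)\<^sup>2 - (real p)\<^sup>2) + g * ?t (Suc r) * ((real r)\<^sup>2 - (real (Suc r))\<^sup>2)"
    if "p \<le> n" for p f g
    using that rn by (intro sum_merge_target) auto
  show thesis
  proof (cases "\<exists>p<r. ?D p = 0")
    case False
    then have slack: "0 < ?D k" if "k \<le> r" for k
      using that rD ge[of k] by (cases "k = r") (auto simp: less_le)
    \<comment> \<open>Lowering mass \<open>e\<close> by one step lowers the call function by
      \<open>e\<close> at every \<open>k \<le> r\<close>, so \<open>e\<close> may exceed neither any
      slack nor the mass available.\<close>
    define e where "e = Min (insert (?t (Suc r)) (?D ` {..r}))"
    have e0: "0 < e" using q slack by (auto simp: e_def)
    have e1: "e \<le> ?t (Suc r)" by (simp add: e_def)
    have e2: "e \<le> ?D k" if "k \<le> r" for k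
      using that unfolding e_def by (intro Min_le) auto
    define g where "g = e / ?t (Suc r)"
    have g: "0 \<le> g" "g \<le> 1" "g * ?t (Suc r) = e" using e0 e1 q by (auto simp: g_def)
    let ?M = "merge T 0 (Suc r) r 0 g"
    have k: "call n (target n ?M) k = call n ?t k - e * of_bool (k \<le> r)" for k
      using upd[of 0 0 g k] g by (auto simp: of_nat_diff algebra_simps Suc_diff_le)
    have "call n a k \<le> call n (target n ?M) k" for k
      using k[of k] e2[of k] ge[of k] by (cases "k \<le> r") auto
    moreover have "transport n b ?M"
      using rn g e0 by (intro transport_merge[OF T]) auto
    moreover have "(\<Sum>j\<le>n. (real j)\<^sup>2 * target n ?M j) < (\<Sum>j\<le>n. (real j)\<^sup>2 * ?t j)"
    proof -
      have "0 < e * ((real (Suc r))\<^sup>2 - (real r)\<^sup>2)"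
        using e0 by (intro mult_pos_pos) (auto simp: power2_eq_square algebra_simps)
      then show ?thesis using upd2[of 0 0 g] g by (simp add: algebra_simps)
    qed
    ultimately show ?thesis using that by blast
  next
    case True
    define p where "p = Max {k. k < r \<and> ?D k = 0}"
    have finp: "finite {k. k < r \<and> ?D k = 0}" by (rule finite_subset[of _ "{..<r}"]) auto
    have pr: "p < r" "?D p = 0" using Max_in[OF finp] True by (auto simp: p_def)
    have slack: "0 < ?D k" if "p < k" "k \<le> r" for k
    proof (cases "k = r")
      case False
      have "?D k \<noteq> 0"
      proof
        assume "?D k = 0"
        then have "k \<le> p" unfolding p_def using False that by (intro Max_ge[OF finp]) auto
        then show False using that by simp
      qed
      then show ?thesis using ge[of k] by (simp add: less_le)
    qed (use rD in simp)
    have tp: "0 < ?t p"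
    proof (cases p)
      case 0
      then show ?thesis
        using call_first_difference[of n ?t] call_first_difference[of n a] pr slack[of 1] tot a[of 0] by simp
    next
      case (Suc i)
      then show ?thesis
        using call_second_difference[of n ?t i] call_second_difference[of n a i] pr slack[of "Suc p"]
          ge[of i] a[of p] rn by simp
    qed
    define e where "e = Min (insert (?t (Suc r)) (insert (?t p) (?D ` {p<..r})))"
    have e0: "0 < e" using q tp slack by (auto simp: e_def)
    have e1: "e \<le> ?t (Suc r)" "e \<le> ?t p" unfolding e_def by (intro Min_le; simp)+
    have e2: "e \<le> ?D k" if "p < k" "k \<le> r" for k
      using that unfolding e_def by (intro Min_le) auto
    define g where "g = e / ?t (Suc r)"
    \<comment> \<open>Balance of moments: mass from \<open>p\<close> climbs \<open>r - p\<close>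
      steps and mass from \<open>Suc r\<close> sinks one. This \<open>f\<close> cancels the two
      effects, so the call function does not move at \<open>k \<le> p\<close>, where there may be no
      slack. \<open>f \<le> 1\<close> because the climb is at least one step.\<close>
    define f where "f = e / ?t p / (real r - real p)"
    have rp: "1 \<le> real r - real p" using pr by simp
    have g: "0 \<le> g" "g \<le> 1" "g * ?t (Suc r) = e" using e0 e1 q by (auto simp: g_def)
    have f: "0 \<le> f" "f \<le> 1" "f * ?t p * (real r - real p) = e"
    proof -
      have "e \<le> ?t p * (real r - real p)" using e1(2) tp mult_left_mono[OF rp, of "?t p"] by linarith
      then show "f \<le> 1" using tp rp by (simp add: f_def divide_le_eq mult.commute)
    qed (use e0 tp rp in \<open>auto simp: f_def\<close>)
    let ?M = "merge T p (Suc r) r f g"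
    have pn: "p \<le> n" using pr rn by simp
    have "call n a k \<le> call n (target n ?M) k" for k
    proof -
      consider "k \<le> p" | "p < k" "k \<le> r" | "r < k" by linarith
      then show ?thesis
      proof cases
        case 1
        then have "call n (target n ?M) k = call n ?t k + f * ?t p * (real r - real p) - g * ?t (Suc r)"
          using upd[OF pn, of f g k] pr by (simp add: of_nat_diff algebra_simps)
        then show ?thesis using f g ge[of k] by simp
      next
        case 2
        then have "call n (target n ?M) k = call n ?t k + f * ?t p * (real r - real k) - g * ?t (Suc r)"
          using upd[OF pn, of f g k] pr by (simp add: of_nat_diff algebra_simps)
        moreover have "0 \<le> f * ?t p * (real r - real k)" using f tp 2 by simp
        ultimately show ?thesis using g e2[OF 2] by simp
      next
        case 3
        then have "call n (target n ?M) k = call n ?t k"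
          using upd[OF pn, of f g k] pr by (simp add: of_nat_diff algebra_simps)
        then show ?thesis using ge[of k] by simp
      qed
    qed
    moreover have "transport n b ?M"
      using rn g pr f by (intro transport_merge[OF T]) auto
    moreover have "(\<Sum>j\<le>n. (real j)\<^sup>2 * target n ?M j) < (\<Sum>j\<le>n. (real j)\<^sup>2 * ?t j)"
    proof -
      have "f * ?t p * ((real r)\<^sup>2 - (real p)\<^sup>2) = e * (real r + real p)"
        unfolding f(3)[symmetric] by (simp add: power2_eq_square algebra_simps)
      moreover have "g * ?t (Suc r) * ((real r)\<^sup>2 - (real (Suc r))\<^sup>2) = - (e * (2 * real r + 1))"
        unfolding g(3) by (simp add: power2_eq_square algebra_simps)
      moreover have "0 < e * (2 * real r + 1 - (real r + real p))"
        using e0 pr by simp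
      ultimately show ?thesis using upd2[OF pn, of f g] by (simp add: algebra_simps)
    qed
    ultimately show ?thesis using that by blast
  qed
qed

text \<open>Tychonoff; the bound \<open>B\<close> will be the total mass.\<close>

lemma compact_bounded_transports:
  fixes B :: real
  shows "compact {T :: nat \<times> nat \<Rightarrow> real. (\<forall>p. 0 \<le> T p \<and> T p \<le> B)}"
proof -
  have "compactin (product_topology (\<lambda>_. euclideanreal) UNIV) (PiE (UNIV :: (nat \<times> nat) set) (\<lambda>_. {0..B}))"
    by (subst compactin_PiE) auto
  moreover have "PiE (UNIV :: (nat \<times> nat) set) (\<lambda>_. {0..B}) = {T. (\<forall>p. 0 \<le> T p \<and> T p \<le> B)}"
    by (auto simp: PiE_def Pi_def)
  ultimately show ?thesis by (simp add: euclidean_product_topology)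
qed

text \<open>The plans whose target still dominates \<open>a\<close> form a nonempty compact set, as
  it contains the identity plan, so one of them minimises the second moment of its target.
  \<open>transport_improve\<close> would lower it further unless all call functions agree, and these
  together with the total mass determine the target.\<close>

theorem finite_strassen:
  fixes a b :: "nat \<Rightarrow> real"
  assumes a: "\<And>j. j \<le> n \<Longrightarrow> 0 \<le> a j" and b: "\<And>j. j \<le> n \<Longrightarrow> 0 \<le> b j"
    and tot: "(\<Sum>j\<le>n. a j) = (\<Sum>j\<le>n. b j)"
    and le: "\<And>k. call n a k \<le> call n b k"
  obtains T where "transport n b T" "\<And>j. j \<le> n \<Longrightarrow> target n T j = a j"
proof -
  define C where "C = {T. transport n b T \<and> (\<forall>k. call n a k \<le> call n (target n T) k)}"
  define \<Phi> where "\<Phi> T = (\<Sum>j\<le>n. (real j)\<^sup>2 * target n T j)" for T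
  have cont: "continuous_on UNIV (\<lambda>T :: nat \<times> nat \<Rightarrow> real. T p)" for p
    by (rule continuous_on_product_coordinates)
  define B where "B = (\<Sum>i\<le>n. b i)"
  have bd: "T p \<le> B" if "transport n b T" for T p
  proof (cases p)
    case (Pair i j)
    show ?thesis
    proof (cases "i \<le> n \<and> j \<le> n")
      case True
      have "T (i, j) \<le> (\<Sum>j\<le>n. T (i, j))"
        using that True by (intro member_le_sum) (auto simp: transport_def)
      also have "\<dots> = b i" using that True by (simp add: transport_def)
      also have "\<dots> \<le> B" unfolding B_def using True b by (intro member_le_sum) auto
      finally show ?thesis using Pair by simp
    next
      case False
      moreover have "0 \<le> B" unfolding B_def using b by (intro sum_nonneg) auto
      ultimately show ?thesis using that Pair by (auto simp: transport_def not_le)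
    qed
  qed
  have "closed C"
    unfolding C_def transport_def target_def call_def
    by (intro closed_Collect_conj closed_Collect_all closed_Collect_imp closed_Collect_le closed_Collect_eq
        continuous_intros continuous_on_subset[OF cont] open_Collect_const) auto
  then have "compact ({T. (\<forall>p. 0 \<le> T p \<and> T p \<le> B)} \<inter> C)"
    by (intro compact_Int_closed compact_bounded_transports)
  moreover have "{T. (\<forall>p. 0 \<le> T p \<and> T p \<le> B)} \<inter> C = C"
    using bd by (auto simp: C_def transport_def)
  ultimately have "compact C" by simp
  moreover have "C \<noteq> {}"
  proof -
    define I where "I = (\<lambda>(i, j). if i = j \<and> i \<le> n then b i else 0)"
    have row: "(\<Sum>j\<le>n. I (i, j)) = b i" and col: "(\<Sum>i\<le>n. h i * I (i, j)) = h j * b j"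
      if "i \<le> n" "j \<le> n" for i j and h :: "nat \<Rightarrow> real"
      using that by (simp_all add: I_def if_distrib cong: if_cong conj_cong)
    have t: "target n I j = b j" if "j \<le> n" for j
      using col[OF that that, of "\<lambda>_. 1"] by (simp add: target_def)
    have "transport n b I"
      unfolding transport_def using b row col by (auto simp: I_def)
    moreover have "call n (target n I) k = call n b k" for k
      unfolding call_def by (intro sum.cong) (auto simp: t)
    ultimately have "I \<in> C" using le by (simp add: C_def)
    then show ?thesis by blast
  qed
  moreover have "continuous_on C \<Phi>"
    unfolding \<Phi>_def target_def by (intro continuous_intros continuous_on_subset[OF cont]) auto
  ultimately obtain T where T: "T \<in> C" and min: "\<And>T'. T' \<in> C \<Longrightarrow> \<Phi> T \<le> \<Phi> T'"
    using continuous_attains_inf[of C \<Phi>] by blast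
  have tr: "transport n b T" and ge: "\<And>k. call n a k \<le> call n (target n T) k"
    using T by (auto simp: C_def)
  have "(\<Sum>j\<le>n. target n T j) = (\<Sum>i\<le>n. \<Sum>j\<le>n. T (i, j))"
    unfolding target_def by (rule sum.swap)
  also have "\<dots> = (\<Sum>j\<le>n. a j)" using tr tot by (simp add: transport_def)
  finally have tot': "(\<Sum>j\<le>n. a j) = (\<Sum>j\<le>n. target n T j)" ..
  have "\<forall>k. call n a k = call n (target n T) k"
  proof (rule ccontr)
    assume "\<not> ?thesis"
    then obtain T' where "transport n b T'" "\<And>k. call n a k \<le> call n (target n T') k" "\<Phi> T' < \<Phi> T"
      using transport_improve[OF tr a tot' ge] unfolding \<Phi>_def by metis
    then show False using min[of T'] by (auto simp: C_def)
  qed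
  then have "target n T j = a j" if "j \<le> n" for j
    using call_inject[of n "target n T" a j] tot' that by simp
  then show thesis using tr that by blast
qed

section \<open>Symmetric distributions\<close>

lemma tanh_half_uminus [simp]: "tanh_half (- x) = - tanh_half x"
  by (cases x) (auto simp: tanh_half_def)

lemma tanh_half_PInf [simp]: "tanh_half \<infinity> = 1" and tanh_half_MInf [simp]: "tanh_half (-\<infinity>) = -1"
  by (auto simp: tanh_half_def)

lemma tanh_half_zero [simp]: "tanh_half 0 = 0"
  by (simp add: tanh_half_def)

abbreviation mag :: "ereal \<Rightarrow> real" where
  "mag x \<equiv> \<bar>tanh_half x\<bar>"

lemma abs_tanh_half_le_1 [simp]: "mag x \<le> 1"
  by (cases x) (auto simp: tanh_half_def abs_le_iff less_imp_le tanh_real_lt_1 minus_less_iff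
    intro: less_imp_le[OF tanh_real_gt_neg1] simp del: tanh_real_gt_neg1)

lemma tanh_half_bounds [simp]: "tanh_half x \<le> 1" "-1 \<le> tanh_half x" "0 \<le> 1 + tanh_half x" "0 \<le> 1 - tanh_half x"
  using abs_tanh_half_le_1[of x] by linarith+

lemma abs_tanh_half_less_1: "mag x < 1 \<longleftrightarrow> \<bar>x\<bar> \<noteq> \<infinity>"
  by (cases x) (auto simp: tanh_half_def abs_less_iff tanh_real_lt_1 minus_less_iff tanh_real_gt_neg1)

lemma tanh_half_neg_iff: "tanh_half x < 0 \<longleftrightarrow> x < 0"
  by (cases x) (auto simp: tanh_half_def)

lemma tanh_real_exp: "tanh (x / 2) = (exp x - 1) / (exp x + 1)" for x :: real
proof -
  have "exp x = exp (x/2) * exp (x/2)" by (simp flip: exp_add)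
  then show ?thesis
    by (simp add: tanh_def sinh_def cosh_def exp_minus field_simps add_nonneg_eq_0_iff) 
qed

lemma tanh_half_measurable [measurable]: "tanh_half \<in> borel_measurable borel"
proof -
  have [measurable]: "{x :: ereal. x = c} \<in> sets borel" for c
    by (simp add: Collect_conv_if2 closed_singleton borel_closed flip: singleton_conv)
  show ?thesis unfolding tanh_half_def tanh_real_exp by measurable
qed

lemma two_artanh_uminus [simp]: "\<bar>t\<bar> \<le> 1 \<Longrightarrow> two_artanh (- t) = - two_artanh t"
  by (cases "\<bar>t\<bar> = 1") (auto simp: two_artanh_def artanh_minus_real abs_if split: if_splits)

lemma tanh_half_two_artanh [simp]: "\<bar>t\<bar> \<le> 1 \<Longrightarrow> tanh_half (two_artanh t) = t"
proof (cases "\<bar>t\<bar> = 1")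
  case False
  moreover assume "\<bar>t\<bar> \<le> 1"
  ultimately have t: "-1 < t" "t < 1" by auto
  then have "exp (2 * artanh t) = (1 + t) / (1 - t)"
    by (simp add: artanh_def)
  moreover have "((1 + t) / (1 - t) - 1) / ((1 + t) / (1 - t) + 1) = t"
    using t by (simp add: field_simps)
  ultimately show ?thesis
    using t tanh_real_exp[of "2 * artanh t"] by (simp add: two_artanh_def tanh_half_def)
qed (auto simp: two_artanh_def abs_if split: if_splits)

lemma two_artanh_measurable [measurable]: "two_artanh \<in> borel_measurable borel"
  unfolding two_artanh_def artanh_def by measurable

lemma tanh_half_llr [simp]: "\<phi> \<in> {0..1} \<Longrightarrow> tanh_half (llr \<phi>) = 1 - 2 * \<phi>"
proof (cases "\<phi> = 0 \<or> \<phi> = 1")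
  case False
  moreover assume "\<phi> \<in> {0..1}"
  ultimately have p: "0 < \<phi>" "\<phi> < 1" by auto
  have "tanh (ln ((1 - \<phi>) / \<phi>) / 2) = ((1 - \<phi>) / \<phi> - 1) / ((1 - \<phi>) / \<phi> + 1)"
    using p by (subst tanh_altdef) (simp add: exp_minus field_simps exp_add[symmetric] flip: exp_double)
  also have "\<dots> = 1 - 2 * \<phi>" using p by (simp add: field_simps)
  finally show ?thesis using p by (simp add: llr_def tanh_half_def)
qed (auto simp: llr_def)

lemma two_artanh_tanh_half [simp]: "two_artanh (tanh_half x) = x"
proof (cases x)
  case (real r)
  then show ?thesis
    using abs_tanh_half_less_1[of x] by (auto simp: two_artanh_def tanh_half_def artanh_tanh_real)
qed (auto simp: two_artanh_def)

text \<open>The hypothesis fails exactly for opposite infinities, where the convention for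
  \<open>\<infinity> + (-\<infinity>)\<close> has no meaning for biases. In the averages over signs
  below, such a pattern carries weight zero.\<close>

lemma tanh_half_add:
  assumes "1 + tanh_half x * tanh_half y \<noteq> 0"
  shows "tanh_half (x + y) = (tanh_half x + tanh_half y) / (1 + tanh_half x * tanh_half y)"
proof (cases "\<bar>x\<bar> \<noteq> \<infinity> \<and> \<bar>y\<bar> \<noteq> \<infinity>")
  case True
  then obtain a b where "x = ereal a" "y = ereal b" by auto
  then show ?thesis by (simp add: tanh_half_def add_divide_distrib tanh_add)
next
  case False
  show ?thesis using assms False by (cases x; cases y) (auto simp: field_simps)
qed

text \<open>
  For a symmetric distribution, given \<open>\<bar>x\<bar>\<close> the sign of \<open>x\<close> has bias \<open>tanh (\<bar>x\<bar> / 2)\<close>.  Equivalently, the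
  measure with density \<open>(1 - tanh (x / 2)) / 2\<close> is invariant under reflection.
\<close>

definition refl_avg :: "(ereal \<Rightarrow> real) \<Rightarrow> ereal \<Rightarrow> real" where
  "refl_avg f x = (1 + tanh_half x) / 2 * f x + (1 - tanh_half x) / 2 * f (- x)"

definition bounded_borel :: "(ereal \<Rightarrow> real) \<Rightarrow> bool" where
  "bounded_borel f \<longleftrightarrow> f \<in> borel_measurable borel \<and> (\<exists>B. \<forall>x. \<bar>f x\<bar> \<le> B)"

text \<open>Testing with bounded functions avoids densities and covers the infinite atoms at once:
  the indicator of \<open>-\<infinity>\<close> has zero \<open>refl_avg\<close>, so there is no mass
  at \<open>-\<infinity>\<close>. Since \<open>refl_avg\<close> is idempotent, closure under the
  convolutions becomes a computation on test functions.\<close>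

definition symm :: "ereal measure \<Rightarrow> bool" where
  "symm M \<longleftrightarrow> prob_space M \<and> sets M = sets borel \<and>
     (\<forall>f. bounded_borel f \<longrightarrow> (LINT x|M. f x) = (LINT x|M. refl_avg f x))"

lemma bounded_borelI:
  "f \<in> borel_measurable borel \<Longrightarrow> (\<And>x. \<bar>f x\<bar> \<le> B) \<Longrightarrow> bounded_borel f"
  by (auto simp: bounded_borel_def)

lemma bounded_borel_measurable: "bounded_borel f \<Longrightarrow> f \<in> borel_measurable borel"
  by (auto simp: bounded_borel_def)

lemma bounded_borel_integrable:
  assumes "prob_space M" "sets M = sets borel" "bounded_borel f"
  shows "integrable M f"
proof -
  interpret prob_space M by fact
  have "f \<in> borel_measurable M"
    using assms by (simp add: bounded_borel_def cong: measurable_cong_sets)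
  moreover obtain B where "\<And>x. \<bar>f x\<bar> \<le> B" using assms(3) by (auto simp: bounded_borel_def)
  ultimately show ?thesis by (intro integrable_const_bound[of _ B]) auto
qed

lemma bounded_borel_refl_avg:
  assumes "bounded_borel f"
  shows "bounded_borel (refl_avg f)"
proof -
  have [measurable]: "f \<in> borel_measurable borel" using assms by (simp add: bounded_borel_def)
  obtain B where B: "\<And>x. \<bar>f x\<bar> \<le> B" using assms by (auto simp: bounded_borel_def)
  have "refl_avg f \<in> borel_measurable borel" unfolding refl_avg_def by measurable
  moreover have "\<bar>refl_avg f x\<bar> \<le> B" for x
  proof -
    have "\<bar>refl_avg f x\<bar> \<le> (1 + tanh_half x) / 2 * \<bar>f x\<bar> + (1 - tanh_half x) / 2 * \<bar>f (- x)\<bar>"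
      unfolding refl_avg_def by (rule order_trans[OF abs_triangle_ineq]) (simp add: abs_mult)
    also have "\<dots> \<le> (1 + tanh_half x) / 2 * B + (1 - tanh_half x) / 2 * B"
      using B by (intro add_mono mult_left_mono) auto
    finally show ?thesis by (simp add: field_simps)
  qed
  ultimately show ?thesis by (rule bounded_borelI)
qed

lemma symmD:
  assumes "symm M"
  shows "prob_space M" "sets M = sets borel" "space M = UNIV"
    and symm_integral: "bounded_borel f \<Longrightarrow> (LINT x|M. f x) = (LINT x|M. refl_avg f x)"
  using assms sets_eq_imp_space_eq[of M borel] by (auto simp: symm_def)

text \<open>The assumption says that on finite reals, reflecting the measure with density
  \<open>exp (- x)\<close> gives \<open>M\<close> back. As
  \<open>exp (- x) * (1 + tanh_half x) = 1 - tanh_half x\<close>, this becomes invariance under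
  reflection of the measure with density \<open>(1 - tanh_half x) / 2\<close>, which ignores an atom
  at \<open>\<infinity>\<close>.\<close>

lemma symmetric_dist_symm:
  assumes "symmetric_dist M"
  shows "symm M"
proof -
  have ps: "prob_space M" and st[measurable_cong]: "sets M = sets borel" and m: "emeasure M {-\<infinity>} = 0"
    and E: "\<And>E. E \<in> sets (borel :: real measure) \<Longrightarrow> emeasure M (ereal ` E) =
          (\<integral>\<^sup>+ r. ennreal (exp (- real_of_ereal r)) * indicator (ereal ` E) (- r) \<partial>M)"
    using assms by (auto simp: symmetric_dist_def)
  interpret prob_space M by fact
  define R where "R = range ereal"
  have R[measurable]: "R \<in> sets borel" unfolding R_def by simp
  have spc: "space M = UNIV" using sets_eq_imp_space_eq[OF st] by simp
  let ?A = "density M (indicator R)"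
  let ?B = "distr (density M (\<lambda>x. ennreal (exp (- real_of_ereal x)) * indicator R x)) borel uminus"
  have AB: "?A = ?B"
  proof (rule measure_eqI)
    fix S assume "S \<in> sets ?A"
    then have S[measurable]: "S \<in> sets borel" using st by simp
    define F where "F = {r. ereal r \<in> S}"
    have F: "F \<in> sets borel" unfolding F_def by measurable
    have FS: "ereal ` F = R \<inter> S" unfolding F_def R_def by (auto simp del: range_ereal)
    have "emeasure ?A S = emeasure M (ereal ` F)"
      by (subst emeasure_density) (auto simp: FS indicator_inter_arith[symmetric] nn_integral_indicator)
    also have "\<dots> = (\<integral>\<^sup>+ r. ennreal (exp (- real_of_ereal r)) * indicator (R \<inter> S) (- r) \<partial>M)"
      using E[OF F] by (simp only: FS)
    also have "\<dots> = (\<integral>\<^sup>+ r. (ennreal (exp (- real_of_ereal r)) * indicator R r) * indicator (uminus -` S) r \<partial>M)"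
    proof (intro nn_integral_cong)
      fix r :: ereal
      have "- r \<in> R \<longleftrightarrow> r \<in> R" unfolding R_def by (cases r) auto
      then show "ennreal (exp (- real_of_ereal r)) * indicator (R \<inter> S) (- r) =
        ennreal (exp (- real_of_ereal r)) * indicator R r * indicator (uminus -` S) r"
        by (auto simp: indicator_def)
    qed
    also have "\<dots> = emeasure ?B S"
    proof -
      have [measurable]: "uminus -` S \<in> sets (borel :: ereal measure)"
      proof -
        have "{x :: ereal. - x \<in> S} \<in> sets borel" by measurable
        then show ?thesis by (simp add: vimage_def)
      qed
      show ?thesis
        by (subst emeasure_distr) (auto simp: emeasure_density spc)
    qed
    finally show "emeasure ?A S = emeasure ?B S" .
  qed (use st in simp)
  have AEm: "AE x in M. x \<noteq> -\<infinity>"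
    using m by (subst AE_iff_measurable[of "{-\<infinity>}"]) (auto simp: spc)
  let ?w = "\<lambda>x. (1 - tanh_half x) / 2"
  have refl: "(LINT x|M. ?w x * f x) = (LINT x|M. ?w x * f (- x))" if "bounded_borel f" for f
  proof -
    have [measurable]: "f \<in> borel_measurable borel" using that by (rule bounded_borel_measurable)
    have w: "exp (- r) * ((1 + tanh_half (ereal r)) / 2) = (1 - tanh_half (ereal r)) / 2" for r
      by (simp add: tanh_half_def tanh_real_exp exp_minus field_simps add_pos_pos less_imp_neq[symmetric])
    have "(LINT x|M. ?w x * f x) = (LINT x|M. indicator R x * (?w x * f x))"
    proof (rule integral_cong_AE, measurable)
      show "AE x in M. ?w x * f x = indicator R x * (?w x * f x)"
        using AEm
      proof eventually_elim
        case (elim x)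
        then show ?case by (cases x) (auto simp: R_def)
      qed
    qed
    also have "\<dots> = (LINT x|?A. ?w x * f x)"
      using integral_density[of "\<lambda>x. ?w x * f x" M "indicat_real R"] by (simp add: ennreal_indicator)
    also have "\<dots> = (LINT x|(density M (\<lambda>x. ennreal (exp (- real_of_ereal x)) * indicator R x)). ?w (- x) * f (- x))"
      unfolding AB by (subst integral_distr) auto
    also have "\<dots> = (LINT x|(density M (\<lambda>x. ennreal (exp (- real_of_ereal x) * indicator R x))). ?w (- x) * f (- x))"
      by (simp add: ennreal_mult' ennreal_indicator)
    also have "\<dots> = (LINT x|M. (exp (- real_of_ereal x) * indicator R x) * (?w (- x) * f (- x)))"
      by (subst integral_density) auto
    also have "\<dots> = (LINT x|M. ?w x * f (- x))"
    proof (rule integral_cong_AE, measurable)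
      show "AE x in M. exp (- real_of_ereal x) * indicator R x * (?w (- x) * f (- x)) = ?w x * f (- x)"
        using AEm
      proof eventually_elim
        case (elim x)
        show ?case
        proof (cases x)
          case (real r)
          moreover have "tanh_half (ereal (- r)) = - tanh_half (ereal r)"
            using tanh_half_uminus[of "ereal r"] by simp
          ultimately show ?thesis using w[of r] by (simp add: R_def)
        qed (use elim in \<open>auto simp: R_def\<close>)
      qed
    qed
    finally show ?thesis .
  qed
  have "(LINT x|M. f x) = (LINT x|M. refl_avg f x)" if f: "bounded_borel f" for f
  proof -
    have [measurable]: "f \<in> borel_measurable borel" using that by (rule bounded_borel_measurable)
    obtain B where B: "\<And>x. \<bar>f x\<bar> \<le> B" using f by (auto simp: bounded_borel_def)
    have le: "\<bar>w * v\<bar> \<le> 1 * B" if "\<bar>w\<bar> \<le> 1" "\<bar>v\<bar> \<le> B" for w v :: real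
      using that unfolding abs_mult by (intro mult_mono) auto
    have half: "\<bar>(1 + tanh_half x) / 2\<bar> \<le> 1" "\<bar>(1 - tanh_half x) / 2\<bar> \<le> 1" for x
      using abs_tanh_half_le_1[of x] by (auto simp: abs_le_iff field_simps)
    have i: "integrable M g" if "bounded_borel g" for g
      using bounded_borel_integrable[OF ps _ that] by (simp add: assms[unfolded symmetric_dist_def])
    have bb: "bounded_borel (\<lambda>x. (1 + tanh_half x) / 2 * f x)" "bounded_borel (\<lambda>x. (1 - tanh_half x) / 2 * f x)"
      "bounded_borel (\<lambda>x. (1 - tanh_half x) / 2 * f (- x))"
      by (rule bounded_borelI[where B="1 * B"], measurable, rule le, (rule half B)+)+
    have "(LINT x|M. f x) = (LINT x|M. (1 + tanh_half x) / 2 * f x + ?w x * f x)"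
      by (intro Bochner_Integration.integral_cong) (auto simp: field_simps)
    also have "\<dots> = (LINT x|M. (1 + tanh_half x) / 2 * f x) + (LINT x|M. ?w x * f x)"
      by (intro Bochner_Integration.integral_add i bb)
    also have "\<dots> = (LINT x|M. refl_avg f x)"
      unfolding refl[OF f] refl_avg_def by (intro Bochner_Integration.integral_add[symmetric] i bb)
    finally show ?thesis .
  qed
  then show ?thesis using assms by (auto simp: symm_def symmetric_dist_def)
qed

section \<open>Convolutions of symmetric distributions\<close>

lemma prob_space_bsc: "prob_space (bsc \<phi>)"
  unfolding bsc_def by (intro measure_pmf.prob_space_distr) simp

lemma sets_bsc [simp, measurable_cong]: "sets (bsc \<phi>) = sets borel" and space_bsc [simp]: "space (bsc \<phi>) = UNIV"
  by (simp_all add: bsc_def)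

lemma integral_bsc:
  assumes "\<phi> \<in> {0..1}" "f \<in> borel_measurable borel"
  shows "(LINT x|(bsc \<phi>). f x) = (1 - \<phi>) * f (llr \<phi>) + \<phi> * (f (- llr \<phi>) :: real)"
  unfolding bsc_def using assms by (subst integral_distr) (auto simp: algebra_simps)

lemma sets_box_conv [simp, measurable_cong]: "sets (M \<boxtimes> N) = sets borel"
  and space_box_conv [simp]: "space (M \<boxtimes> N) = UNIV"
  by (simp_all add: box_conv_def)

lemma prob_space_box_conv:
  assumes "prob_space M" "prob_space N" and [measurable_cong]: "sets M = sets borel" "sets N = sets borel"
  shows "prob_space (M \<boxtimes> N)"
proof -
  interpret pair_prob_space M N using assms by (simp add: pair_prob_space_def pair_sigma_finite_def prob_space_imp_sigma_finite)
  show ?thesis unfolding box_conv_def by (rule prob_space_distr) measurable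
qed

lemma integral_bsc_box:
  assumes \<phi>: "\<phi> \<in> {0..1}" and ps: "prob_space M" and [measurable_cong]: "sets M = sets borel"
    and f: "bounded_borel f"
  shows "(LINT x|(bsc \<phi> \<boxtimes> M). f x) = (LINT x|M. (1 - \<phi>) * f (two_artanh ((1 - 2 * \<phi>) * tanh_half x))
    + \<phi> * f (- two_artanh ((1 - 2 * \<phi>) * tanh_half x)))"
proof -
  interpret pair_prob_space "bsc \<phi>" M
    using ps prob_space_bsc by (simp add: pair_prob_space_def pair_sigma_finite_def prob_space_imp_sigma_finite)
  have [measurable]: "f \<in> borel_measurable borel" using f by (rule bounded_borel_measurable)
  obtain B where B: "\<And>x. \<bar>f x\<bar> \<le> B" using f by (auto simp: bounded_borel_def)
  have le: "\<bar>(1 - 2 * \<phi>) * tanh_half x\<bar> \<le> 1" for x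
    unfolding abs_mult using \<phi> by (intro mult_le_one) auto
  have "(LINT x|(bsc \<phi> \<boxtimes> M). f x) = (LINT (x, y)|(bsc \<phi> \<Otimes>\<^sub>M M). f (two_artanh (tanh_half x * tanh_half y)))"
    unfolding box_conv_def by (subst integral_distr) (auto simp: split_beta')
  also have "\<dots> = (LINT y|M. (LINT x|(bsc \<phi>). f (two_artanh (tanh_half x * tanh_half y))))"
    by (intro integral_snd[symmetric] P.integrable_const_bound[of _ B]) (auto simp: split_beta' B)
  also have "\<dots> = (LINT x|M. (1 - \<phi>) * f (two_artanh ((1 - 2 * \<phi>) * tanh_half x))
    + \<phi> * f (- two_artanh ((1 - 2 * \<phi>) * tanh_half x)))"
  proof (intro Bochner_Integration.integral_cong refl)
    fix y
    have "tanh_half (- llr \<phi>) * tanh_half y = - ((1 - 2 * \<phi>) * tanh_half y)"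
      "tanh_half (llr \<phi>) * tanh_half y = (1 - 2 * \<phi>) * tanh_half y"
      using \<phi> by (simp_all add: algebra_simps)
    moreover have "(LINT x|(bsc \<phi>). f (two_artanh (tanh_half x * tanh_half y))) =
      (1 - \<phi>) * f (two_artanh (tanh_half (llr \<phi>) * tanh_half y)) + \<phi> * f (two_artanh (tanh_half (- llr \<phi>) * tanh_half y))"
      using integral_bsc[OF \<phi>, of "\<lambda>x. f (two_artanh (tanh_half x * tanh_half y))"] by simp
    ultimately show "(LINT x|(bsc \<phi>). f (two_artanh (tanh_half x * tanh_half y))) =
      (1 - \<phi>) * f (two_artanh ((1 - 2 * \<phi>) * tanh_half y)) + \<phi> * f (- two_artanh ((1 - 2 * \<phi>) * tanh_half y))"
      by (simp only: two_artanh_uminus[OF le])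
  qed
  finally show ?thesis .
qed

text \<open>Symmetrising the integrand merges the noise flip with the random sign of
  \<open>x\<close>: all that noise does is multiply the bias by
  \<open>1 - 2 * \<phi>\<close>.\<close>

lemma integral_bsc_box_symm:
  assumes \<phi>: "\<phi> \<in> {0..1}" and M: "symm M" and f: "bounded_borel f"
  shows "(LINT x|(bsc \<phi> \<boxtimes> M). f x) = (LINT x|M. refl_avg f (two_artanh ((1 - 2 * \<phi>) * tanh_half x)))"
proof -
  let ?y = "\<lambda>x. two_artanh ((1 - 2 * \<phi>) * tanh_half x)"
  let ?k = "\<lambda>x. (1 - \<phi>) * f (?y x) + \<phi> * f (- ?y x)"
  have [measurable]: "f \<in> borel_measurable borel" using f by (rule bounded_borel_measurable)
  obtain B where B: "\<And>x. \<bar>f x\<bar> \<le> B" using f by (auto simp: bounded_borel_def)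
  have le: "\<bar>(1 - 2 * \<phi>) * tanh_half x\<bar> \<le> 1" for x
    unfolding abs_mult using \<phi> by (intro mult_le_one) auto
  have k: "bounded_borel ?k"
  proof (rule bounded_borelI[where B="(1 - \<phi>) * B + \<phi> * B"])
    fix x
    have "\<bar>?k x\<bar> \<le> (1 - \<phi>) * \<bar>f (?y x)\<bar> + \<phi> * \<bar>f (- ?y x)\<bar>"
      using \<phi> by (intro order_trans[OF abs_triangle_ineq]) (simp add: abs_mult)
    also have "\<dots> \<le> (1 - \<phi>) * B + \<phi> * B"
      using \<phi> B by (intro add_mono mult_left_mono) auto
    finally show "\<bar>?k x\<bar> \<le> (1 - \<phi>) * B + \<phi> * B" .
  qed measurable
  have "(LINT x|(bsc \<phi> \<boxtimes> M). f x) = (LINT x|M. ?k x)"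
    by (rule integral_bsc_box[OF \<phi> symmD(1)[OF M] symmD(2)[OF M] f])
  also have "\<dots> = (LINT x|M. refl_avg ?k x)" by (rule symm_integral[OF M k])
  also have "\<dots> = (LINT x|M. refl_avg f (?y x))"
  proof (intro Bochner_Integration.integral_cong refl)
    fix x
    have "?y (- x) = - ?y x" using two_artanh_uminus[OF le[of x]] by simp
    then show "refl_avg ?k x = refl_avg f (?y x)"
      using le by (simp add: refl_avg_def field_simps)
  qed
  finally show ?thesis .
qed

lemma symm_bsc_box:
  assumes \<phi>: "\<phi> \<in> {0..1}" and M: "symm M"
  shows "symm (bsc \<phi> \<boxtimes> M)"
proof -
  have idem: "refl_avg (refl_avg f) = refl_avg f" for f
    by (rule ext) (simp add: refl_avg_def field_simps)
  show ?thesis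
    unfolding symm_def
    using M by (auto simp: symmD integral_bsc_box_symm[OF \<phi> M] bounded_borel_refl_avg idem
        intro!: prob_space_box_conv prob_space_bsc)
qed

section \<open>Sums of independent log-likelihood ratios\<close>

definition add_conv :: "ereal measure \<Rightarrow> ereal measure \<Rightarrow> ereal measure" where
  "add_conv M N = distr (M \<Otimes>\<^sub>M N) borel (\<lambda>(x, y). x + y)"

lemma sets_add_conv [simp, measurable_cong]: "sets (add_conv M N) = sets borel"
  and space_add_conv [simp]: "space (add_conv M N) = UNIV"
  by (simp_all add: add_conv_def)

lemma prob_space_add_conv:
  assumes "prob_space M" "prob_space N" and [measurable_cong]: "sets M = sets borel" "sets N = sets borel"
  shows "prob_space (add_conv M N)"
proof -
  interpret pair_prob_space M N using assms by (simp add: pair_prob_space_def pair_sigma_finite_def prob_space_imp_sigma_finite)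
  show ?thesis unfolding add_conv_def by (rule prob_space_distr) measurable
qed

text \<open>Given both magnitudes the two signs are independent, so each of the four sign patterns
  gets a product weight.\<close>

definition refl_avg2 :: "(ereal \<Rightarrow> real) \<Rightarrow> ereal \<Rightarrow> ereal \<Rightarrow> real" where
  "refl_avg2 f x y = ((1 + tanh_half x) * (1 + tanh_half y) * f (x + y)
      + (1 - tanh_half x) * (1 + tanh_half y) * f (- x + y)
      + (1 + tanh_half x) * (1 - tanh_half y) * f (x + - y)
      + (1 - tanh_half x) * (1 - tanh_half y) * f (- x + - y)) / 4"

lemma integral_add_conv:
  assumes M: "symm M" and N: "symm N" and f: "bounded_borel f"
  shows "(LINT x|(add_conv M N). f x) = (LINT y|N. (LINT x|M. refl_avg2 f x y))"
proof -
  note [measurable_cong] = symmD(2)[OF M] symmD(2)[OF N]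
  interpret pair_prob_space M N
    using symmD(1)[OF M] symmD(1)[OF N]
    by (simp add: pair_prob_space_def pair_sigma_finite_def prob_space_imp_sigma_finite)
  have [measurable]: "f \<in> borel_measurable borel" using f by (rule bounded_borel_measurable)
  obtain B where B: "\<And>x. \<bar>f x\<bar> \<le> B" using f by (auto simp: bounded_borel_def)
  have B0: "0 \<le> B" using B[of 0] by linarith
  have fy: "bounded_borel (\<lambda>x. f (x + y))" for y
    by (rule bounded_borelI[of _ B]) (auto simp: B)
  let ?g = "\<lambda>y. \<integral>x. f (x + y) \<partial>M"
  have g: "bounded_borel ?g"
  proof (rule bounded_borelI[of _ B])
    have "?g \<in> borel_measurable N" by measurable
    then show "?g \<in> borel_measurable borel" by (simp cong: measurable_cong_sets)
    show "\<bar>?g y\<bar> \<le> B" for y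
    proof -
      have "\<bar>?g y\<bar> \<le> (LINT x|M. \<bar>f (x + y)\<bar>)" by (rule integral_abs_bound)
      also have "\<dots> \<le> (LINT x|M. B)"
        by (intro integral_mono bounded_borel_integrable M1.prob_space_axioms symmD(2)[OF M]
            bounded_borelI[of _ B]) (auto simp: B B0)
      finally show ?thesis by (simp add: M1.prob_space)
    qed
  qed
  have "(LINT x|(add_conv M N). f x) = (LINT (x, y)|(M \<Otimes>\<^sub>M N). f (x + y))"
    unfolding add_conv_def by (subst integral_distr) (auto simp: split_beta')
  also have "\<dots> = (LINT y|N. ?g y)"
    by (intro integral_snd[symmetric] P.integrable_const_bound[of _ B]) (auto simp: split_beta' B)
  also have "\<dots> = (LINT y|N. refl_avg ?g y)" by (rule symm_integral[OF N g])
  also have "\<dots> = (LINT y|N. (LINT x|M. refl_avg2 f x y))"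
  proof (intro Bochner_Integration.integral_cong refl)
    fix y
    have i: "integrable M (refl_avg (\<lambda>x. f (x + y)))" for y
      by (intro bounded_borel_integrable M1.prob_space_axioms symmD(2)[OF M] bounded_borel_refl_avg fy)
    have "refl_avg ?g y = (1 + tanh_half y) / 2 * (LINT x|M. refl_avg (\<lambda>x. f (x + y)) x)
        + (1 - tanh_half y) / 2 * (LINT x|M. refl_avg (\<lambda>x. f (x + - y)) x)"
      unfolding refl_avg_def[of ?g] symm_integral[OF M fy, symmetric] ..
    also have "\<dots> = (LINT x|M. (1 + tanh_half y) / 2 * refl_avg (\<lambda>x. f (x + y)) x
        + (1 - tanh_half y) / 2 * refl_avg (\<lambda>x. f (x + - y)) x)"
      using i[of y] i[of "- y"] by simp
    also have "\<dots> = (LINT x|M. refl_avg2 f x y)"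
      by (intro Bochner_Integration.integral_cong refl) (simp add: refl_avg_def refl_avg2_def field_simps)
    finally show "refl_avg ?g y = (LINT x|M. refl_avg2 f x y)" .
  qed
  finally show ?thesis .
qed

text \<open>Opposite patterns \<open>(x, y)\<close> and \<open>(- x, - y)\<close> have weights in
  the ratio \<open>1 + s\<close> to \<open>1 - s\<close>, where \<open>s\<close> is the bias of
  \<open>x + y\<close>, so each such pair is already averaged as \<open>refl_avg\<close> would do.
  For opposite infinities both weights are 0. This is why sums of symmetric variables are
  symmetric.\<close>

lemma refl_avg2_refl_avg: "refl_avg2 (refl_avg f) x y = refl_avg2 f x y"
proof -
  have m: "- (x + y) = - x + - y" if "1 + tanh_half x * tanh_half y \<noteq> 0" for x y
    using that by (cases x; cases y) auto
  have e: "(1 + a) * (1 + b) * ((1 + s) / 2 * p + (1 - s) / 2 * q) + (1 - a) * (1 - b) * ((1 - s) / 2 * q + (1 + s) / 2 * p)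
      = (1 + a) * (1 + b) * p + (1 - a) * (1 - b) * q"
    if "s * (1 + a * b) = a + b" for a b s p q :: real
  proof -
    have "(1 + a) * (1 + b) * (1 - s) = (1 - a) * (1 - b) * (1 + s)" using that by (simp add: algebra_simps)
    then have "(1 + a) * (1 + b) * (1 - s) * (q - p) = (1 - a) * (1 - b) * (1 + s) * (q - p)" by simp
    then show ?thesis by (simp add: field_simps)
  qed
  have pair: "(1 + tanh_half x) * (1 + tanh_half y) * refl_avg f (x + y) + (1 - tanh_half x) * (1 - tanh_half y) * refl_avg f (- x + - y)
    = (1 + tanh_half x) * (1 + tanh_half y) * f (x + y) + (1 - tanh_half x) * (1 - tanh_half y) * f (- x + - y)" for x y
  proof (cases "1 + tanh_half x * tanh_half y = 0")
    case True
    have "mag x = 1"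
    proof (rule ccontr)
      assume "mag x \<noteq> 1"
      then have "mag x < 1" using abs_tanh_half_le_1[of x] by linarith
      then have "mag x * mag y < 1"
        using mult_left_le[of "mag y" "mag x"] by simp
      then show False using True unfolding abs_mult[symmetric] by linarith
    qed
    then have "tanh_half x = 1 \<and> tanh_half y = -1 \<or> tanh_half x = -1 \<and> tanh_half y = 1"
      using True by (auto simp: abs_if split: if_splits)
    then show ?thesis by auto
  next
    case False
    have s: "tanh_half (x + y) * (1 + tanh_half x * tanh_half y) = tanh_half x + tanh_half y"
      using False by (simp add: tanh_half_add)
    have m': "- x + - y = - (x + y)" using m[OF False] by simp
    have m'': "- (- (x + y)) = x + y" by simp
    show ?thesis
      unfolding m' using e[OF s, of "f (x + y)" "f (- (x + y))"]
      by (simp add: refl_avg_def)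
  qed
  show ?thesis
    unfolding refl_avg2_def using pair[of x y] pair[of "- x" y] by simp
qed

lemma symm_add_conv:
  assumes M: "symm M" and N: "symm N"
  shows "symm (add_conv M N)"
  unfolding symm_def
  using assms by (auto simp: symmD integral_add_conv[OF M N] bounded_borel_refl_avg refl_avg2_refl_avg
      intro!: prob_space_add_conv)

lemma symm_return_zero: "symm (return borel 0)"
  unfolding symm_def
  by (auto simp: prob_space_return integral_return bounded_borel_measurable
      bounded_borel_measurable[OF bounded_borel_refl_avg]) (simp add: refl_avg_def)

section \<open>Two-point kernels\<close>

text \<open>
  \<open>kern a b t\<close> is the expectation of \<open>(\<bar>\<theta>\<bar> - t)\<^sup>+\<close> for the sum of two independent binary symmetric
  log-likelihood ratios with biases \<open>a\<close> and \<open>b\<close>, where \<open>\<theta>\<close> is the bias of the sum: it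
  equals \<open>\<bar>a + b\<bar> / (1 + a b)\<close> with probability \<open>(1 + a b) / 2\<close> and \<open>\<bar>a - b\<bar> / (1 - a b)\<close> otherwise.
\<close>

definition kern :: "real \<Rightarrow> real \<Rightarrow> real \<Rightarrow> real" where
  "kern a b t = (max 0 (\<bar>a + b\<bar> - t * (1 + a * b)) + max 0 (\<bar>a - b\<bar> - t * (1 - a * b))) / 2"

lemma kern_abs: "kern \<bar>a\<bar> \<bar>b\<bar> t = kern a b t"
  by (cases "0 \<le> a"; cases "0 \<le> b") (auto simp: kern_def abs_minus_commute add.commute)

lemma kern_nonneg: "0 \<le> kern a b t"
  by (simp add: kern_def)

lemma max_mult_diff:
  fixes w v a :: real
  assumes "0 \<le> w" "0 \<le> v"
  shows "max 0 (a * w - v) = w * max 0 (a - v / w)"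
proof (cases "w = 0")
  case False
  then have "a * w - v = w * (a - v / w)" by (simp add: field_simps)
  then show ?thesis using assms by (simp add: max_def zero_le_mult_iff)
qed (use assms in simp)

text \<open>This is why convolution is monotone in the stop-loss order.\<close>

lemma kern_decomp:
  assumes "a \<in> {0..1}" "b \<in> {0..1}" "t \<in> {0..1}"
  shows "kern a b t = max 0 (b - t) + (1 - b * t) / 2 * max 0 (a - \<bar>b - t\<bar> / (1 - b * t))
    + (1 + b * t) / 2 * max 0 (a - (b + t) / (1 + b * t))"
proof -
  have ab: "a * b \<le> 1" "0 \<le> a * b" and bt: "b * t \<le> 1" "0 \<le> b * t" and at: "a * t \<le> 1"
    using assms by (auto intro!: mult_le_one)
  have abt: "a * b * t \<le> t" "a * b * t \<le> a" "a * b * t \<le> b"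
    using assms ab bt at mult_right_mono[OF ab(1), of t] mult_right_mono[OF bt(1), of a] mult_right_mono[OF at, of b]
    by (auto simp: mult_ac)
  have "kern a b t = max 0 (b - t) + max 0 (a * (1 - b * t) - \<bar>b - t\<bar>) / 2 + max 0 (a * (1 + b * t) - (b + t)) / 2"
  proof (cases "a \<ge> b"; cases "b \<ge> t")
  qed (use assms ab bt at abt in \<open>auto simp: kern_def max_def field_simps\<close>)
  then show ?thesis
    using bt assms by (subst (asm) (1 2) max_mult_diff) auto
qed

text \<open>The difference is the less biased outcome: for \<open>b \<le> a\<close>, the bound
  \<open>(a - b) * (1 + w) \<le> (1 - w) * (a + b)\<close> amounts to \<open>w * a \<le> b\<close>,
  which follows from \<open>w \<le> a * b\<close>. A threshold above the larger bias is thus above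
  the smaller one.\<close>

lemma diff_le_of_add_le:
  fixes a b t w :: real
  assumes "a \<in> {0..1}" "b \<in> {0..1}" "0 \<le> t" "w \<le> a * b" "0 \<le> w" "0 \<le> c" "c * (a + b) \<le> t * (1 + w)"
  shows "c * \<bar>a - b\<bar> \<le> t * (1 - w)"
proof -
  have *: "c * (a - b) \<le> t * (1 - w)"
    if ab: "a \<in> {0..1}" "b \<in> {0..1}" "b \<le> a" and w: "w \<le> a * b" and le: "c * (a + b) \<le> t * (1 + w)" for a b
  proof (cases "a + b = 0")
    case False
    then have p: "0 < a + b" using ab by auto
    have "a * b * a \<le> b" using ab mult_le_one[of a a] mult_left_le[of "a * a" b] by (simp add: mult_ac)
    then have "w * a \<le> b" using w ab mult_right_mono[OF w, of a] by auto
    then have "(a - b) * (1 + w) \<le> (1 - w) * (a + b)" by (simp add: algebra_simps)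
    then have "t * ((a - b) * (1 + w)) \<le> t * ((1 - w) * (a + b))" using assms by (intro mult_left_mono) auto
    moreover have "(a - b) * (c * (a + b)) \<le> (a - b) * (t * (1 + w))" using ab le by (intro mult_left_mono) auto
    ultimately have "(c * (a - b)) * (a + b) \<le> (t * (1 - w)) * (a + b)" by (simp add: mult_ac)
    then show ?thesis using p by (rule mult_right_le_imp_le)
  next
    case True
    then have "a = 0" "b = 0" using ab by auto
    then show ?thesis using w assms by simp
  qed
  show ?thesis
  proof (cases "b \<le> a")
    case True
    then show ?thesis using *[of a b] assms by simp
  next
    case False
    then show ?thesis using *[of b a] assms by (simp add: mult.commute add.commute)
  qed
qed

text \<open>The first hinge falls as its threshold rises, and the second gains as its threshold
  falls by the same amount. The second can gain only if \<open>B > t - w\<close>, and then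
  \<open>A > t + w\<close>, so the first loses in full.\<close>

lemma add_max_mono:
  fixes A B t v w :: real
  assumes "v \<le> w" "A \<le> t + w \<Longrightarrow> B \<le> t - w"
  shows "max 0 (A - (t + w)) + max 0 (B - (t - w)) \<le> max 0 (A - (t + v)) + max 0 (B - (t - v))"
  using assms by (auto simp: max_def)

lemma add_max_strict_mono:
  fixes A B t v w :: real
  assumes "v < w" "A \<le> t + w \<Longrightarrow> B \<le> t - w" "B < t - v" "t + v < A"
  shows "max 0 (A - (t + w)) + max 0 (B - (t - w)) < max 0 (A - (t + v)) + max 0 (B - (t - v))"
  using assms by (auto simp: max_def)

section \<open>The two-point gap\<close>

context
  fixes a b c t :: real
  assumes ab: "a \<in> {0..1}" "b \<in> {0..1}" and c: "0 < c" "c < 1" and t: "0 \<le> t"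
begin

text \<open>
  \<open>c * kern a b (t / c)\<close> describes noise applied to the sum, and \<open>kern (c * a) (c * b) t\<close> independent
  noise on both summands.
\<close>

lemma kern_scale: "c * kern a b (t / c) = (max 0 (c * (a + b) - t * (1 + a * b)) + max 0 (c * \<bar>a - b\<bar> - t * (1 - a * b))) / 2"
proof -
  have m: "c * max 0 x = max 0 (c * x)" for x using c by (simp add: max_def zero_le_mult_iff)
  have e: "c * (\<bar>a + b\<bar> - t / c * (1 + a * b)) = c * (a + b) - t * (1 + a * b)"
    "c * (\<bar>a - b\<bar> - t / c * (1 - a * b)) = c * \<bar>a - b\<bar> - t * (1 - a * b)"
    using ab c by (auto simp: algebra_simps)
  have "c * kern a b (t / c) = (c * max 0 (\<bar>a + b\<bar> - t / c * (1 + a * b)) + c * max 0 (\<bar>a - b\<bar> - t / c * (1 - a * b))) / 2"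
    unfolding kern_def by (simp add: algebra_simps)
  then show ?thesis unfolding m e .
qed

lemma kern_scaled: "kern (c * a) (c * b) t =
  (max 0 (c * (a + b) - t * (1 + c\<^sup>2 * (a * b))) + max 0 (c * \<bar>a - b\<bar> - t * (1 - c\<^sup>2 * (a * b)))) / 2"
proof -
  have "\<bar>c * a + c * b\<bar> = c * (a + b)" "\<bar>c * a - c * b\<bar> = c * \<bar>a - b\<bar>"
    using ab c by (simp_all add: abs_mult flip: right_diff_distrib distrib_left)
  then show ?thesis unfolding kern_def by (simp add: power2_eq_square mult_ac)
qed

lemma scaled_product_le: "c\<^sup>2 * (a * b) \<le> a * b" "0 \<le> c\<^sup>2 * (a * b)"
  using ab c by (auto intro!: mult_left_le_one_le simp: power_le_one_iff abs_square_le_1)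

text \<open>Both sides are sums of two hinges with the same heights; only the product
  \<open>a * b\<close> in the thresholds becomes \<open>c\<^sup>2 * (a * b)\<close>, so
  \<open>add_max_mono\<close> decides.\<close>

lemma kern_gap: "c * kern a b (t / c) \<le> kern (c * a) (c * b) t"
proof -
  let ?w = "a * b" and ?v = "c\<^sup>2 * (a * b)" and ?A = "c * (a + b)" and ?B = "c * \<bar>a - b\<bar>"
  have tw: "t * ?v \<le> t * ?w" using scaled_product_le t by (intro mult_left_mono) auto
  have e: "t * (1 + x) = t + t * x" "t * (1 - x) = t - t * x" for x by (simp_all add: algebra_simps)
  have 1: "?A \<le> t * (1 + ?w) \<Longrightarrow> ?B \<le> t * (1 - ?w)"
    using ab c t scaled_product_le by (intro diff_le_of_add_le[of a b]) auto
  show ?thesis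
    unfolding kern_scale kern_scaled using tw 1 unfolding e by (intro divide_right_mono add_max_mono) auto
qed

text \<open>Hypotheses \<open>B\<close> and \<open>A\<close> place \<open>t\<close> strictly between
  the two possible biases of the noisy sum. One hinge is then active and the other inactive, so the
  loss of the first is not fully compensated by the second.\<close>

lemma kern_gap_strict:
  assumes "0 < t" "0 < a" "0 < b" and B: "c * \<bar>a - b\<bar> < t * (1 - c\<^sup>2 * (a * b))" and A: "t * (1 + c\<^sup>2 * (a * b)) < c * (a + b)"
  shows "c * kern a b (t / c) < kern (c * a) (c * b) t"
proof -
  let ?w = "a * b" and ?v = "c\<^sup>2 * (a * b)" and ?A = "c * (a + b)" and ?B = "c * \<bar>a - b\<bar>"
  have "c\<^sup>2 < 1" using c by (simp add: power_less_one_iff abs_square_less_1)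
  then have "?v < ?w" using assms by simp
  then have tw: "t * ?v < t * ?w" using assms by simp
  have e: "t * (1 + x) = t + t * x" "t * (1 - x) = t - t * x" for x by (simp_all add: algebra_simps)
  have 1: "?A \<le> t * (1 + ?w) \<Longrightarrow> ?B \<le> t * (1 - ?w)"
    using ab c t scaled_product_le by (intro diff_le_of_add_le[of a b]) auto
  show ?thesis
    unfolding kern_scale kern_scaled using tw 1 A B unfolding e
    by (intro divide_strict_right_mono add_max_strict_mono) auto
qed

end

text \<open>The addition law of tanh, which here combines the largest biases of two
  summands.\<close>

definition tadd :: "real \<Rightarrow> real \<Rightarrow> real" where
  "tadd a b = (a + b) / (1 + a * b)"

lemma tadd_less_iff: "a \<in> {0..1} \<Longrightarrow> b \<in> {0..1} \<Longrightarrow> t < tadd a b \<longleftrightarrow> t * (1 + a * b) < a + b"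
  unfolding tadd_def by (subst pos_less_divide_eq) (auto intro: add_pos_nonneg)

lemma tadd_le_iff: "a \<in> {0..1} \<Longrightarrow> b \<in> {0..1} \<Longrightarrow> tadd a b \<le> t \<longleftrightarrow> a + b \<le> t * (1 + a * b)"
  using tadd_less_iff[of a b t] by linarith

lemma tadd_bounds: 
  assumes "a \<in> {0..1}" "b \<in> {0..1}"
  shows "tadd a b \<in> {0..1}" "b \<le> tadd a b" "a \<le> tadd a b"
proof -
  have "0 \<le> (1 - a) * (1 - b)" using assms by simp
  then have "tadd a b \<le> 1" by (subst tadd_le_iff) (use assms in \<open>auto simp: algebra_simps\<close>)
  moreover have "0 \<le> tadd a b" using assms by (simp add: tadd_def)
  ultimately show "tadd a b \<in> {0..1}" by simp
  have "b * (a * b) \<le> a" "a * (a * b) \<le> b"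
    using assms mult_left_le[of "b * b" a] mult_left_le[of "a * a" b] mult_le_one[of a a] mult_le_one[of b b]
    by (auto simp: mult_ac)
  then have "b \<le> tadd a b \<and> a \<le> tadd a b"
    unfolding not_less[symmetric] tadd_def using assms
    by (subst (1 2) pos_divide_less_eq) (auto simp: algebra_simps intro: add_pos_nonneg)
  then show "b \<le> tadd a b" "a \<le> tadd a b" by auto
qed

lemma tadd_mono:
  assumes "a \<in> {0..1}" "b \<in> {0..1}" "a' \<in> {0..1}" "a \<le> a'"
  shows "tadd a b \<le> tadd a' b"
proof -
  have "0 \<le> (a' - a) * (1 - b * b)" using assms by (intro mult_nonneg_nonneg) (auto intro: mult_le_one)
  then have "(a + b) * (1 + a' * b) \<le> (a' + b) * (1 + a * b)" by (simp add: algebra_simps)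
  then show ?thesis
    unfolding tadd_def using assms by (subst frac_le_eq) (auto simp: divide_le_0_iff add_pos_nonneg add_nonneg_eq_0_iff)
qed

lemma tadd_commute: "tadd a b = tadd b a"
  by (simp add: tadd_def add.commute mult.commute)

fun tpow :: "real \<Rightarrow> nat \<Rightarrow> real" where
  "tpow m 0 = 0"
| "tpow m (Suc d) = tadd (tpow m d) m"

lemma tpow_bounds: "m \<in> {0..1} \<Longrightarrow> tpow m d \<in> {0..1}"
  by (induction d) (auto simp del: atLeastAtMost_iff intro!: tadd_bounds(1), auto)

lemma tpow_mono: "m \<in> {0..1} \<Longrightarrow> d \<le> e \<Longrightarrow> tpow m d \<le> tpow m e"
  by (rule lift_Suc_mono_le[of "tpow m"]) (use tadd_bounds(3)[OF tpow_bounds] in auto)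

lemma tpow_1 [simp]: "tpow m (Suc 0) = m"
  by (simp add: tadd_def)

text \<open>Each step has \<open>1 - tadd a m = (1 - a) * (1 - m) / (1 + a * m)\<close>. The bound
  shows that \<open>tpow m d\<close> tends to 1 for \<open>m > 0\<close>, which is what unbounded
  degrees require.\<close>

lemma one_minus_tpow_le:
  assumes "m \<in> {0..1}"
  shows "1 - tpow m d \<le> (1 - m) ^ d"
proof (induction d)
  case (Suc d)
  let ?a = "tpow m d"
  have a: "?a \<in> {0..1}" using assms by (rule tpow_bounds)
  have "1 - tadd ?a m = (1 - ?a) * (1 - m) / (1 + ?a * m)"
  proof -
    have "1 + ?a * m \<noteq> 0" using a assms by (auto simp: add_nonneg_eq_0_iff)
    then show ?thesis unfolding tadd_def by (simp add: field_simps)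
  qed
  also have "\<dots> \<le> (1 - ?a) * (1 - m)"
    using a assms divide_left_mono[of 1 "1 + ?a * m" "(1 - ?a) * (1 - m)"] by (simp add: add_pos_nonneg)
  also have "\<dots> \<le> (1 - m) * (1 - m) ^ d"
    using Suc assms by (subst mult.commute) (intro mult_left_mono, auto)
  finally show ?case by simp
qed simp

section \<open>Stop-loss functions\<close>

definition stoploss :: "ereal measure \<Rightarrow> real \<Rightarrow> real" where
  "stoploss M t = (LINT x|M. max 0 (mag x - t))"

lemma bounded_borel_stoploss: "bounded_borel (\<lambda>x. max 0 (\<bar>c * tanh_half x\<bar> - t))"
proof (rule bounded_borelI[where B="\<bar>c\<bar> + \<bar>t\<bar>"])
  fix x
  have "\<bar>c * tanh_half x\<bar> \<le> \<bar>c\<bar>" unfolding abs_mult by (intro mult_left_le) auto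
  then show "\<bar>max 0 (\<bar>c * tanh_half x\<bar> - t)\<bar> \<le> \<bar>c\<bar> + \<bar>t\<bar>"
    by (cases "t \<le> \<bar>c * tanh_half x\<bar>"; simp add: max_def; linarith)
qed measurable

lemma mult_max_zero: "0 \<le> w \<Longrightarrow> w * max 0 x = max 0 (w * x)" for w x :: real
  by (cases "w = 0") (auto simp: max_def zero_le_mult_iff)

lemma integrable_stoploss:
  assumes "symm M"
  shows "integrable M (\<lambda>x. max 0 (\<bar>c * tanh_half x\<bar> - t))"
  by (intro bounded_borel_integrable symmD[OF assms] bounded_borel_stoploss)

lemma integrable_stoploss1:
  assumes "symm M"
  shows "integrable M (\<lambda>x. max 0 (mag x - t))"
  using integrable_stoploss[OF assms, of 1] by simp

lemma stoploss_nonneg: "0 \<le> stoploss M t"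
  unfolding stoploss_def by (rule Bochner_Integration.integral_nonneg) simp

lemma stoploss_antimono: "symm M \<Longrightarrow> s \<le> t \<Longrightarrow> stoploss M t \<le> stoploss M s"
  unfolding stoploss_def by (intro integral_mono integrable_stoploss1) auto

lemma stoploss_lipschitz:
  assumes M: "symm M" "s \<le> t"
  shows "stoploss M s \<le> stoploss M t + (t - s)"
proof -
  interpret prob_space M by (rule symmD(1)[OF M(1)])
  have "stoploss M s \<le> (LINT x|M. max 0 (mag x - t) + (t - s))"
    unfolding stoploss_def using M integrable_stoploss1[OF M(1)] by (intro integral_mono) auto
  also have "\<dots> = stoploss M t + (t - s)"
    unfolding stoploss_def using integrable_stoploss1[OF M(1)] by (simp add: prob_space)
  finally show ?thesis .
qed

lemma stoploss_ge_1: "1 \<le> t \<Longrightarrow> stoploss M t = 0"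
proof -
  assume "1 \<le> t"
  then have "max 0 (mag x - t) = 0" for x
    using abs_tanh_half_le_1[of x] by linarith
  then show ?thesis by (simp add: stoploss_def)
qed

lemma stoploss_bsc_box:
  assumes "\<phi> \<in> {0..1}" "symm M"
  shows "stoploss (bsc \<phi> \<boxtimes> M) t = (LINT x|M. max 0 (\<bar>(1 - 2 * \<phi>) * tanh_half x\<bar> - t))"
proof -
  have le: "\<bar>(1 - 2 * \<phi>) * tanh_half x\<bar> \<le> 1" for x
    unfolding abs_mult using assms by (intro mult_le_one) auto
  have "stoploss (bsc \<phi> \<boxtimes> M) t = (LINT x|M. refl_avg (\<lambda>x. max 0 (mag x - t)) (two_artanh ((1 - 2 * \<phi>) * tanh_half x)))"
    unfolding stoploss_def
    using integral_bsc_box_symm[OF assms bounded_borel_stoploss[of 1 t]] by simp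
  also have "\<dots> = (LINT x|M. max 0 (\<bar>(1 - 2 * \<phi>) * tanh_half x\<bar> - t))"
    by (intro Bochner_Integration.integral_cong refl)
      (simp only: refl_avg_def tanh_half_uminus tanh_half_two_artanh[OF le] abs_minus_cancel, simp add: field_simps)
  finally show ?thesis .
qed

lemma stoploss_bsc_box_scale:
  assumes "\<phi> \<in> {0..1}" "\<phi> \<noteq> 1 / 2" "symm M"
  shows "stoploss (bsc \<phi> \<boxtimes> M) t = \<bar>1 - 2 * \<phi>\<bar> * stoploss M (t / \<bar>1 - 2 * \<phi>\<bar>)"
proof -
  let ?c = "\<bar>1 - 2 * \<phi>\<bar>"
  have c: "0 < ?c" using assms by simp
  have "max 0 (\<bar>(1 - 2 * \<phi>) * tanh_half x\<bar> - t) = ?c * max 0 (mag x - t / ?c)" for x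
  proof -
    have "?c * (mag x - t / ?c) = ?c * mag x - t"
      using c by (simp only: right_diff_distrib) simp
    then show ?thesis using mult_max_zero[of ?c "mag x - t / ?c"] by (simp only: abs_mult abs_ge_zero)
  qed
  then show ?thesis unfolding stoploss_bsc_box[OF assms(1,3)] by (simp add: stoploss_def)
qed

lemma kern_measurable [measurable]:
  assumes [measurable]: "f \<in> borel_measurable M" "g \<in> borel_measurable M" "h \<in> borel_measurable M"
  shows "(\<lambda>x. kern (f x) (g x) (h x)) \<in> borel_measurable M"
  unfolding kern_def by measurable

lemma bounded_borel_integral:
  fixes f :: "ereal \<Rightarrow> ereal \<Rightarrow> real"
  assumes M: "prob_space M" and s: "sets M = sets borel"
    and f: "(\<lambda>(x, y). f x y) \<in> borel_measurable (borel \<Otimes>\<^sub>M borel)" and B: "\<And>x y. \<bar>f x y\<bar> \<le> B"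
  shows "bounded_borel (\<lambda>y. \<integral>x. f x y \<partial>M)"
proof (rule bounded_borelI[of _ B])
  interpret prob_space M by fact
  note [measurable_cong] = s
  have "(\<lambda>(y, x). f x y) \<in> borel_measurable (borel \<Otimes>\<^sub>M M)"
  proof -
    have "borel_measurable (borel \<Otimes>\<^sub>M M) = borel_measurable (borel \<Otimes>\<^sub>M (borel :: ereal measure))"
      by (intro measurable_cong_sets sets_pair_measure_cong refl s)
    then show ?thesis using measurable_compose[OF measurable_pair_swap' f] by (simp add: split_beta')
  qed
  then show "(\<lambda>y. \<integral>x. f x y \<partial>M) \<in> borel_measurable borel" by measurable
  have B0: "0 \<le> B" using B[of undefined undefined] by linarith
  have fy: "(\<lambda>x. f x y) \<in> borel_measurable borel" for y using f by measurable
  have i: "integrable M (\<lambda>x. f x y)" for y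
    by (intro bounded_borel_integrable M s bounded_borelI[of _ B] fy B)
  fix y
  have "\<bar>\<integral>x. f x y \<partial>M\<bar> \<le> (LINT x|M. \<bar>f x y\<bar>)" by (rule integral_abs_bound)
  also have "\<dots> \<le> (LINT x|M. B)" using i B by (intro integral_mono) auto
  finally show "\<bar>\<integral>x. f x y \<partial>M\<bar> \<le> B" by (simp add: prob_space)
qed

text \<open>Opposite patterns share the magnitude of the bias, and their joint weight, proportional
  to \<open>1 + a * b\<close> for biases \<open>a\<close> and \<open>b\<close>, clears the
  denominator of the addition law.\<close>

lemma refl_avg2_stoploss:
  "refl_avg2 (\<lambda>x. max 0 (mag x - t)) x y = kern (tanh_half x) (tanh_half y) t"
proof -
  let ?h = "\<lambda>x. max 0 (mag x - t)"
  have *: "(1 + tanh_half x * tanh_half y) * ?h (x + y) = max 0 (\<bar>tanh_half x + tanh_half y\<bar> - t * (1 + tanh_half x * tanh_half y))" for x y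
  proof -
    have w: "0 \<le> 1 + tanh_half x * tanh_half y"
      using mult_le_one[of "mag x" "mag y"] by (simp add: abs_mult[symmetric] abs_le_iff)
    show ?thesis
    proof (cases "1 + tanh_half x * tanh_half y = 0")
      case True
      \<comment> \<open>A product of -1 means opposite infinities; then the sum of the biases
        vanishes as well, and both sides are 0.\<close>
      then have "(tanh_half x + tanh_half y)\<^sup>2 = (tanh_half x)\<^sup>2 + (tanh_half y)\<^sup>2 - 2"
        by (simp add: power2_eq_square algebra_simps)
      also have "\<dots> \<le> 0" using abs_square_le_1[of "tanh_half x"] abs_square_le_1[of "tanh_half y"] by simp
      finally show ?thesis using True by simp
    next
      case False
      then have "0 < 1 + tanh_half x * tanh_half y" using w by simp
      moreover from this have "(1 + tanh_half x * tanh_half y) * (\<bar>tanh_half (x + y)\<bar> - t) =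
        \<bar>tanh_half x + tanh_half y\<bar> - t * (1 + tanh_half x * tanh_half y)"
        using False by (simp add: tanh_half_add abs_divide right_diff_distrib mult.commute)
      ultimately show ?thesis by (simp add: mult_max_zero)
    qed
  qed
  have m: "?h (- x + - y) = ?h (x + y)" if "1 + tanh_half x * tanh_half y \<noteq> 0" for x y
  proof -
    have "(- a - b) / w = - ((a + b) / w)" for a b w :: real by (simp add: minus_divide_left)
    then show ?thesis using tanh_half_add[OF that] tanh_half_add[of "- x" "- y"] that by simp
  qed
  have m2: "(1 - tanh_half x) * (1 - tanh_half y) * ?h (- x + - y) + (1 + tanh_half x) * (1 + tanh_half y) * ?h (x + y)
      = 2 * ((1 + tanh_half x * tanh_half y) * ?h (x + y))" for x y
  proof (cases "1 + tanh_half x * tanh_half y = 0")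
    case False
    show ?thesis unfolding m[OF False] by (simp add: algebra_simps)
  next
    case True
    then have "(tanh_half x + tanh_half y)\<^sup>2 = (tanh_half x)\<^sup>2 + (tanh_half y)\<^sup>2 - 2"
      by (simp add: power2_eq_square algebra_simps)
    also have "\<dots> \<le> 0" using abs_square_le_1[of "tanh_half x"] abs_square_le_1[of "tanh_half y"] by simp
    finally have "tanh_half y = - tanh_half x" by simp
    then have p: "(1 - tanh_half x) * (1 - tanh_half y) = 0" "(1 + tanh_half x) * (1 + tanh_half y) = 0"
      using True by (auto simp: algebra_simps)
    show ?thesis by (simp only: p True mult_zero_left mult_zero_right add_0)
  qed
  have "(1 - tanh_half x) * (1 - tanh_half y) * ?h (- x + - y) + (1 + tanh_half x) * (1 + tanh_half y) * ?h (x + y)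
      = 2 * max 0 (\<bar>tanh_half x + tanh_half y\<bar> - t * (1 + tanh_half x * tanh_half y))"
    unfolding m2 * ..
  moreover have "(1 + tanh_half x) * (1 - tanh_half y) * ?h (x + - y) + (1 - tanh_half x) * (1 + tanh_half y) * ?h (- x + y)
      = 2 * max 0 (\<bar>tanh_half x - tanh_half y\<bar> - t * (1 - tanh_half x * tanh_half y))"
  proof -
    have e: "tanh_half (- x) = - tanh_half x" "- (- x) = x" "1 - - a = 1 + a" "1 + - a = 1 - a" "1 + - a * b = 1 - a * b"
      "\<bar>- a + b\<bar> = \<bar>a - b\<bar>" for a b :: real by (auto simp: abs_if)
    show ?thesis using m2[of "- x" y] unfolding * unfolding e .
  qed
  moreover have "s + p = 2 * k \<Longrightarrow> r + q = 2 * l \<Longrightarrow> (p + q + r + s) / 4 = (k + l) / 2" for p q r s k l :: real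
    by simp
  ultimately show ?thesis
    unfolding refl_avg2_def kern_def by blast
qed

lemma stoploss_add_conv:
  assumes "symm M" "symm N"
  shows "stoploss (add_conv M N) t = (LINT y|N. (LINT x|M. kern (tanh_half x) (tanh_half y) t))"
  unfolding stoploss_def using bounded_borel_stoploss[of 1 t]
  by (subst integral_add_conv[OF assms]) (simp_all add: refl_avg2_stoploss)

lemma kern_bounded:
  assumes "\<bar>c\<bar> \<le> 1"
  shows "\<bar>kern (c * tanh_half x) (c * tanh_half y) t\<bar> \<le> 2 + 2 * \<bar>t\<bar>"
proof -
  let ?a = "c * tanh_half x" and ?b = "c * tanh_half y"
  have ab: "\<bar>?a\<bar> \<le> 1" "\<bar>?b\<bar> \<le> 1" using assms by (auto simp: abs_mult intro!: mult_le_one)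
  then have "\<bar>?a * ?b\<bar> \<le> 1" unfolding abs_mult[of ?a ?b] by (intro mult_le_one abs_ge_zero)
  then have "\<bar>1 + ?a * ?b\<bar> \<le> 2" "\<bar>1 - ?a * ?b\<bar> \<le> 2" by auto
  then have "\<bar>t\<bar> * \<bar>1 + ?a * ?b\<bar> \<le> \<bar>t\<bar> * 2" "\<bar>t\<bar> * \<bar>1 - ?a * ?b\<bar> \<le> \<bar>t\<bar> * 2" by (auto intro!: mult_left_mono)
  then have "\<bar>t * (1 + ?a * ?b)\<bar> \<le> \<bar>t\<bar> * 2" "\<bar>t * (1 - ?a * ?b)\<bar> \<le> \<bar>t\<bar> * 2" by (simp_all add: abs_mult)
  moreover have "\<bar>?a + ?b\<bar> \<le> 2" "\<bar>?a - ?b\<bar> \<le> 2" using ab by linarith+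
  moreover have "\<bar>(max 0 (\<bar>u\<bar> - p) + max 0 (\<bar>v\<bar> - q)) / 2\<bar> \<le> 2 + T"
    if "\<bar>p\<bar> \<le> T" "\<bar>q\<bar> \<le> T" "\<bar>u\<bar> \<le> 2" "\<bar>v\<bar> \<le> 2" for u v p q T :: real
  proof -
    have avg: "\<bar>(m + n) / 2\<bar> \<le> K" if "0 \<le> m" "0 \<le> n" "m \<le> K" "n \<le> K" for m n K :: real
      using that by (subst abs_of_nonneg) auto
    show ?thesis by (rule avg) (use that in \<open>auto simp: max_def\<close>)
  qed
  ultimately show ?thesis unfolding kern_def by (simp only: mult.commute[of 2 "\<bar>t\<bar>"])
qed

lemma bounded_borel_integral_kern: 
  "\<bar>c\<bar> \<le> 1 \<Longrightarrow> symm M \<Longrightarrow> bounded_borel (\<lambda>y. \<integral>x. kern (c * tanh_half x) (c * tanh_half y) t \<partial>M)"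
  by (rule bounded_borel_integral[OF symmD(1,2) _ kern_bounded]) measurable

text \<open>\<open>max_bias M m\<close> says that \<open>m\<close> is the essential supremum of \<open>mag\<close> under \<open>M\<close>.\<close>

definition max_bias :: "ereal measure \<Rightarrow> real \<Rightarrow> bool" where
  "max_bias M m \<longleftrightarrow> m \<in> {0..1} \<and> stoploss M m = 0 \<and> (\<forall>s\<in>{0..<m}. 0 < stoploss M s)"

lemma max_bias_exists:
  assumes "symm M"
  obtains m where "max_bias M m"
proof
  define S where "S = {s. 0 \<le> s \<and> stoploss M s = 0}"
  define m where "m = Inf S"
  have S1: "1 \<in> S" by (simp add: S_def stoploss_ge_1)
  have bdd: "bdd_below S" by (auto simp: S_def intro!: bdd_belowI[of _ 0])
  have m: "m \<in> {0..1}"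
  proof -
    have "m \<le> 1" unfolding m_def by (intro cInf_lower S1 bdd)
    moreover have "0 \<le> m" unfolding m_def using S1 by (intro cInf_greatest) (blast, auto simp: S_def)
    ultimately show ?thesis by simp
  qed
  have "stoploss M m \<le> e" if "0 < e" for e
  proof -
    have "\<exists>s\<in>S. s < m + e" using S1 that unfolding m_def by (intro cInf_lessD) auto
    then obtain s where s: "s \<in> S" "s < m + e" by blast
    then have "m \<le> s" unfolding m_def by (intro cInf_lower bdd)
    then show ?thesis using stoploss_lipschitz[OF assms, of m s] s by (simp add: S_def)
  qed
  then have "stoploss M m \<le> 0" using field_le_epsilon[of "stoploss M m" 0] by simp
  moreover have "0 < stoploss M s" if "s \<in> {0..<m}" for s
  proof (rule ccontr)
    assume "\<not> 0 < stoploss M s"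
    then have "s \<in> S" using that stoploss_nonneg[of M s] by (simp add: S_def)
    then have "m \<le> s" unfolding m_def by (intro cInf_lower bdd)
    then show False using that by simp
  qed
  ultimately show "max_bias M m"
    using m stoploss_nonneg[of M m] by (auto simp: max_bias_def)
qed

lemma max_bias_stoploss_eq_0: "symm M \<Longrightarrow> max_bias M m \<Longrightarrow> m \<le> t \<Longrightarrow> stoploss M t = 0"
  using stoploss_antimono[of M m t] stoploss_nonneg[of M t] by (auto simp: max_bias_def)

lemma max_bias_AE:
  assumes M: "symm M" and m: "max_bias M m"
  shows "AE x in M. mag x \<le> m"
proof -
  have "AE x in M. max 0 (mag x - m) = 0"
    using m integral_nonneg_eq_0_iff_AE[OF integrable_stoploss1[OF M, of m]]
    by (simp add: max_bias_def stoploss_def)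
  then show ?thesis by eventually_elim (auto simp: max_def split: if_splits)
qed

text \<open>Magnitudes just below the essential supremum \<open>m\<close> have positive mass, so
  strictness above \<open>s\<close> suffices: equal integrals would force
  \<open>stoploss M s = 0\<close>.\<close>

lemma integral_strict_mono_max_bias:
  assumes M: "symm M" and m: "max_bias M m" and f: "bounded_borel f" and g: "bounded_borel g"
    and le: "\<And>x. mag x \<le> m \<Longrightarrow> f x \<le> g x" and s: "0 \<le> s" "s < m"
    and less: "\<And>x. s < mag x \<Longrightarrow> mag x \<le> m \<Longrightarrow> f x < g x"
  shows "(LINT x|M. f x) < (LINT x|M. g x)"
proof -
  note int = bounded_borel_integrable[OF symmD(1,2)[OF M]]
  have 1: "(LINT x|M. f x) \<le> (LINT x|M. g x)"
    using max_bias_AE[OF M m] le by (intro integral_mono_AE int f g) (auto elim!: eventually_mono)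
  have "(LINT x|M. f x) \<noteq> (LINT x|M. g x)"
  proof
    assume eq: "(LINT x|M. f x) = (LINT x|M. g x)"
    have "AE x in M. g x - f x = 0"
    proof (subst integral_nonneg_eq_0_iff_AE[symmetric])
      show "(LINT x|M. g x - f x) = 0" using eq int[OF f] int[OF g] by simp
    qed (use int[OF f] int[OF g] max_bias_AE[OF M m] le in \<open>auto elim!: eventually_mono\<close>)
    then have "AE x in M. max 0 (mag x - s) = 0"
      using max_bias_AE[OF M m]
    proof eventually_elim
      case (elim x)
      then show ?case using less[of x] by (cases "s < mag x") auto
    qed
    then have "stoploss M s = 0" unfolding stoploss_def by (rule integral_eq_zero_AE)
    moreover have "0 < stoploss M s" using m s by (simp add: max_bias_def)
    ultimately show False by simp
  qed
  then show ?thesis using 1 by simp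
qed

section \<open>Powers and noise\<close>

lemma add_conv_commute:
  assumes "symm M" "symm N"
  shows "add_conv M N = add_conv N M"
proof -
  note [measurable_cong] = symmD(2)[OF assms(1)] symmD(2)[OF assms(2)]
  interpret pair_sigma_finite M N
    using symmD(1)[OF assms(1)] symmD(1)[OF assms(2)] by (simp add: pair_sigma_finite_def prob_space_imp_sigma_finite)
  show ?thesis
    unfolding add_conv_def by (subst distr_pair_swap, subst distr_distr) (auto simp: comp_def split_beta' add.commute)
qed

lemma add_conv_return_zero:
  assumes "symm N"
  shows "add_conv (return borel 0) N = N"
proof -
  note [measurable_cong] = symmD(2)[OF assms]
  interpret sigma_finite_measure N
    using symmD(1)[OF assms] by (simp add: prob_space_imp_sigma_finite)
  have [measurable]: "(\<lambda>(x, y). x + y) \<in> borel_measurable (return borel (0 :: ereal) \<Otimes>\<^sub>M N)"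
  proof -
    have "borel_measurable (return borel (0 :: ereal) \<Otimes>\<^sub>M N) = borel_measurable (borel \<Otimes>\<^sub>M (borel :: ereal measure))"
      by (intro measurable_cong_sets sets_pair_measure_cong refl symmD(2)[OF assms] sets_return)
    then show ?thesis by (rule ssubst) measurable
  qed
  have "emeasure (add_conv (return borel 0) N) A = emeasure N A" if [measurable]: "A \<in> sets borel" for A
  proof -
    let ?Q = "(\<lambda>(x, y). x + y) -` A \<inter> space (return borel (0 :: ereal) \<Otimes>\<^sub>M N)"
    have Q: "?Q \<in> sets (return borel 0 \<Otimes>\<^sub>M N)" by (rule measurable_sets[of _ _ borel]) auto
    have "emeasure (add_conv (return borel 0) N) A = emeasure (return borel 0 \<Otimes>\<^sub>M N) ?Q"
      unfolding add_conv_def by (subst emeasure_distr) auto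
    also have "\<dots> = (\<integral>\<^sup>+x. emeasure N (Pair x -` ?Q) \<partial>return borel (0 :: ereal))"
      by (rule emeasure_pair_measure_alt[OF Q])
    also have "\<dots> = emeasure N (Pair 0 -` ?Q)"
      using measurable_emeasure_Pair[OF Q] by (intro nn_integral_return) simp_all
    also have "\<dots> = emeasure N A"
      by (rule arg_cong[of _ _ "emeasure N"]) (auto simp: space_pair_measure symmD(3)[OF assms])
    finally show ?thesis .
  qed
  then show ?thesis by (intro measure_eqI) (auto simp: symmD(2)[OF assms])
qed

primrec conv_pow :: "ereal measure \<Rightarrow> nat \<Rightarrow> ereal measure" where
  "conv_pow N 0 = return borel 0"
| "conv_pow N (Suc d) = add_conv (conv_pow N d) N"

lemma symm_conv_pow: "symm N \<Longrightarrow> symm (conv_pow N d)"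
  by (induction d) (auto intro: symm_return_zero symm_add_conv)

lemma conv_pow_1: "symm N \<Longrightarrow> conv_pow N (Suc 0) = N"
  by (simp add: add_conv_return_zero)

lemma stoploss_return_zero: "0 \<le> t \<Longrightarrow> stoploss (return borel 0) t = 0"
  unfolding stoploss_def by (subst integral_return) auto

text \<open>The average of \<open>kern_decomp\<close> over one summand with stop-loss function
  \<open>U\<close>, the other having bias \<open>b\<close>. At \<open>b = t = 1\<close> the first
  quotient is 0 by convention, and its weight vanishes.\<close>

definition kern_avg :: "(real \<Rightarrow> real) \<Rightarrow> real \<Rightarrow> real \<Rightarrow> real" where
  "kern_avg U b t = max 0 (b - t) + (1 - b * t) / 2 * U (\<bar>b - t\<bar> / (1 - b * t)) + (1 + b * t) / 2 * U ((b + t) / (1 + b * t))"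

lemma integral_kern:
  assumes M: "symm M" and b: "\<bar>b\<bar> \<le> 1" and t: "t \<in> {0..1}"
  shows "(LINT x|M. kern (tanh_half x) b t) = kern_avg (stoploss M) \<bar>b\<bar> t"
proof -
  interpret prob_space M by (rule symmD(1)[OF M])
  note i = integrable_stoploss1[OF M]
  have "(LINT x|M. kern (tanh_half x) b t) =
    (LINT x|M. max 0 (\<bar>b\<bar> - t) + (1 - \<bar>b\<bar> * t) / 2 * max 0 (mag x - \<bar>\<bar>b\<bar> - t\<bar> / (1 - \<bar>b\<bar> * t))
      + (1 + \<bar>b\<bar> * t) / 2 * max 0 (mag x - (\<bar>b\<bar> + t) / (1 + \<bar>b\<bar> * t)))"
    by (intro Bochner_Integration.integral_cong refl)
      (subst kern_abs[symmetric], rule kern_decomp, use b t in auto)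
  also have "\<dots> = kern_avg (stoploss M) \<bar>b\<bar> t"
    unfolding kern_avg_def stoploss_def using i by (simp add: prob_space)
  finally show ?thesis .
qed

lemma bounded_borel_integral_kern1:
  "symm M \<Longrightarrow> bounded_borel (\<lambda>y. \<integral>x. kern (tanh_half x) (tanh_half y) t \<partial>M)"
  using bounded_borel_integral_kern[of 1] by simp

definition stoploss_le :: "ereal measure \<Rightarrow> ereal measure \<Rightarrow> bool" where
  "stoploss_le M M' \<longleftrightarrow> (\<forall>t\<ge>0. stoploss M t \<le> stoploss M' t)"

lemma stoploss_leD: "stoploss_le M M' \<Longrightarrow> 0 \<le> t \<Longrightarrow> stoploss M t \<le> stoploss M' t"
  by (simp add: stoploss_le_def)

lemma stoploss_le_refl: "stoploss_le M M"
  by (simp add: stoploss_le_def)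

lemma stoploss_le_trans: "stoploss_le M M' \<Longrightarrow> stoploss_le M' M'' \<Longrightarrow> stoploss_le M M''"
  unfolding stoploss_le_def by (meson order_trans)

lemma kern_avg_mono:
  assumes "stoploss_le M M'" "b \<in> {0..1}" "t \<in> {0..1}"
  shows "kern_avg (stoploss M) b t \<le> kern_avg (stoploss M') b t"
proof -
  have "b * t \<le> 1" "0 \<le> b * t" using assms by (auto intro: mult_le_one)
  then show ?thesis
    using assms unfolding kern_avg_def by (intro add_mono mult_left_mono stoploss_leD order_refl) auto
qed

lemma kern_avg_strict_mono:
  assumes "stoploss_le M M'" "b \<in> {0..1}" "t \<in> {0..1}" "b * t < 1"
    and "stoploss M (\<bar>b - t\<bar> / (1 - b * t)) < stoploss M' (\<bar>b - t\<bar> / (1 - b * t))"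
  shows "kern_avg (stoploss M) b t < kern_avg (stoploss M') b t"
proof -
  have "0 \<le> b * t" using assms by auto
  then show ?thesis
    using assms unfolding kern_avg_def
    by (intro add_less_le_mono add_le_less_mono mult_strict_left_mono mult_left_mono stoploss_leD order_refl) auto
qed

lemma stoploss_add_conv_mono:
  assumes M: "symm M" "symm M'" and N: "symm N" and le: "stoploss_le M M'"
  shows "stoploss_le (add_conv M N) (add_conv M' N)"
  unfolding stoploss_le_def
proof (intro allI impI)
  fix t :: real assume t: "0 \<le> t"
  show "stoploss (add_conv M N) t \<le> stoploss (add_conv M' N) t"
  proof (cases "t \<le> 1")
    case True
    note int = bounded_borel_integrable[OF symmD(1,2)[OF N] bounded_borel_integral_kern1]
    show ?thesis
      unfolding stoploss_add_conv[OF M(1) N] stoploss_add_conv[OF M(2) N]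
      using t True by (intro integral_mono int M) (simp add: integral_kern[OF M(1)] integral_kern[OF M(2)] kern_avg_mono[OF le])
  next
    case False
    then show ?thesis by (simp add: stoploss_ge_1)
  qed
qed

lemma stoploss_add_conv_mono2:
  assumes "symm M" "symm M'" "symm N" "symm N'" "stoploss_le M M'" "stoploss_le N N'"
  shows "stoploss_le (add_conv M N) (add_conv M' N')"
proof (rule stoploss_le_trans)
  show "stoploss_le (add_conv M N) (add_conv M' N)" by (intro stoploss_add_conv_mono assms)
  have "stoploss_le (add_conv N M') (add_conv N' M')" by (intro stoploss_add_conv_mono assms)
  then show "stoploss_le (add_conv M' N) (add_conv M' N')"
    using add_conv_commute[of N M'] add_conv_commute[of N' M'] assms by simp
qed

lemma conv_pow_mono:
  assumes "symm N" "symm N'" "stoploss_le N N'"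
  shows "stoploss_le (conv_pow N d) (conv_pow N' d)"
  by (induction d) (auto intro: stoploss_le_refl stoploss_add_conv_mono2 symm_conv_pow assms)

text \<open>Strictness is needed only at the first argument of \<open>U\<close> in
  \<open>kern_avg\<close>, whose weight is positive when \<open>b * t < 1\<close>, and only for
  biases \<open>b\<close> of the other summand near its maximum.\<close>

lemma stoploss_add_conv_strict_mono:
  assumes M: "symm M" "symm M'" and N: "symm N" and le: "stoploss_le M M'"
    and t: "t \<in> {0..1}" and m: "max_bias N m" and s: "0 \<le> s" "s < m"
    and less: "\<And>b. s < b \<Longrightarrow> b \<le> m \<Longrightarrow> b * t < 1 \<and>
      stoploss M (\<bar>b - t\<bar> / (1 - b * t)) < stoploss M' (\<bar>b - t\<bar> / (1 - b * t))"
  shows "stoploss (add_conv M N) t < stoploss (add_conv M' N) t"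
  unfolding stoploss_add_conv[OF M(1) N] stoploss_add_conv[OF M(2) N]
proof (rule integral_strict_mono_max_bias[OF N m _ _ _ s])
  fix y
  show "(LINT x|M. kern (tanh_half x) (tanh_half y) t) \<le> (LINT x|M'. kern (tanh_half x) (tanh_half y) t)"
    using t by (simp add: integral_kern[OF M(1)] integral_kern[OF M(2)] kern_avg_mono[OF le])
  assume "s < mag y" "mag y \<le> m"
  then show "(LINT x|M. kern (tanh_half x) (tanh_half y) t) < (LINT x|M'. kern (tanh_half x) (tanh_half y) t)"
    using t less[of "mag y"]
    by (simp add: integral_kern[OF M(1)] integral_kern[OF M(2)] kern_avg_strict_mono[OF le])
qed (intro bounded_borel_integral_kern1 M)+

lemma shrink_below:
  fixes m1 m2 :: real
  assumes "0 < m1" "0 < m2" "0 < e"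
  obtains s1 s2 where "0 \<le> s1" "s1 < m1" "0 \<le> s2" "s2 < m2" "m1 - e \<le> s1" "m2 - e \<le> s2"
  using assms that[of "max 0 (m1 - e)" "max 0 (m2 - e)"] by auto

lemma max_bias_add_conv:
  assumes M: "symm M" "symm N" and m: "max_bias M m1" "max_bias N m2" "0 < m1" "0 < m2"
  shows "max_bias (add_conv M N) (tadd m1 m2)"
  unfolding max_bias_def
proof (intro conjI ballI)
  have m01: "m1 \<in> {0..1}" "m2 \<in> {0..1}" using m by (auto simp: max_bias_def)
  let ?T = "tadd m1 m2"
  show T: "?T \<in> {0..1}" by (rule tadd_bounds(1)[OF m01])
  have z: "kern a b ?T = 0" if "\<bar>a\<bar> \<le> m1" "\<bar>b\<bar> \<le> m2" for a b
  proof -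
    have ab: "\<bar>a\<bar> \<in> {0..1}" "\<bar>b\<bar> \<in> {0..1}" using that m01 by auto
    have "tadd \<bar>a\<bar> \<bar>b\<bar> \<le> tadd m1 \<bar>b\<bar>" using ab m01 that by (intro tadd_mono) auto
    also have "\<dots> \<le> ?T" unfolding tadd_commute[of m1] using ab m01 that by (intro tadd_mono) auto
    finally have 1: "\<bar>a\<bar> + \<bar>b\<bar> \<le> ?T * (1 + \<bar>a\<bar> * \<bar>b\<bar>)" using tadd_le_iff[OF ab] by simp
    have 2: "1 * \<bar>\<bar>a\<bar> - \<bar>b\<bar>\<bar> \<le> ?T * (1 - \<bar>a\<bar> * \<bar>b\<bar>)"
      using 1 T ab by (intro diff_le_of_add_le[OF ab]) auto
    have "kern \<bar>a\<bar> \<bar>b\<bar> ?T = 0" unfolding kern_def using 1 2 by simp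
    then show ?thesis by (simp only: kern_abs)
  qed
  have "AE y in N. (LINT x|M. kern (tanh_half x) (tanh_half y) ?T) = 0"
    using max_bias_AE[OF M(2) m(2)]
  proof eventually_elim
    case (elim y)
    show ?case
      using max_bias_AE[OF M(1) m(1)] elim by (intro integral_eq_zero_AE) (auto elim!: eventually_mono simp: z)
  qed
  then show "stoploss (add_conv M N) ?T = 0"
    unfolding stoploss_add_conv[OF M] by (rule integral_eq_zero_AE)
next
  fix t assume t: "t \<in> {0..<tadd m1 m2}"
  have m01: "m1 \<in> {0..1}" "m2 \<in> {0..1}" using m by (auto simp: max_bias_def)
  \<comment> \<open>Half the slack in \<open>t < tadd m1 m2\<close>, so that either magnitude may
    fall short of its maximum by \<open>e\<close>.\<close>
  define e where "e = (m1 + m2 - t * (1 + m1 * m2)) / 2"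
  have e: "0 < e" using t tadd_less_iff[OF m01, of t] by (simp add: e_def)
  have e2: "2 * e = m1 + m2 - t * (1 + m1 * m2)" by (simp add: e_def)
  obtain s1 s2 where s: "0 \<le> s1" "s1 < m1" "0 \<le> s2" "s2 < m2" "m1 - e \<le> s1" "m2 - e \<le> s2"
    using shrink_below[OF m(3,4) e] .
  have pos: "0 < kern a b t" if ab: "s1 < \<bar>a\<bar>" "\<bar>a\<bar> \<le> m1" "s2 < \<bar>b\<bar>" "\<bar>b\<bar> \<le> m2" for a b
  proof -
    have "t * (1 + \<bar>a\<bar> * \<bar>b\<bar>) \<le> t * (1 + m1 * m2)"
      using t ab by (intro mult_left_mono add_left_mono mult_mono) auto
    also have "\<dots> = m1 + m2 - 2 * e" using e2 by simp
    also have "\<dots> < \<bar>\<bar>a\<bar> + \<bar>b\<bar>\<bar>" using ab s by auto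
    finally have "0 < kern \<bar>a\<bar> \<bar>b\<bar> t"
      unfolding kern_def by (intro divide_pos_pos add_pos_nonneg) auto
    then show ?thesis by (simp only: kern_abs)
  qed
  have "(LINT y|N. 0) < (LINT y|N. (LINT x|M. kern (tanh_half x) (tanh_half y) t))"
  proof (rule integral_strict_mono_max_bias[OF M(2) m(2) _ _ _ s(3,4)])
    fix y
    show "0 \<le> (LINT x|M. kern (tanh_half x) (tanh_half y) t)"
      by (rule Bochner_Integration.integral_nonneg) (simp add: kern_nonneg)
    assume y: "s2 < mag y" "mag y \<le> m2"
    have "(LINT x|M. 0) < (LINT x|M. kern (tanh_half x) (tanh_half y) t)"
    proof (rule integral_strict_mono_max_bias[OF M(1) m(1) _ _ _ s(1,2)])
      show "bounded_borel (\<lambda>x. kern (tanh_half x) (tanh_half y) t)"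
        using kern_bounded[of 1 _ y t] by (intro bounded_borelI[of _ "2 + 2 * \<bar>t\<bar>"]) auto
    qed (use y pos kern_nonneg in \<open>auto intro: bounded_borelI[of _ 0]\<close>)
    then show "0 < (LINT x|M. kern (tanh_half x) (tanh_half y) t)" by simp
  qed (auto intro: bounded_borelI[of _ 0] bounded_borel_integral_kern1 M)
  then show "0 < stoploss (add_conv M N) t" by (simp add: stoploss_add_conv[OF M])
qed

lemma max_bias_conv_pow:
  assumes N: "symm N" "max_bias N m" "0 < m"
  shows "max_bias (conv_pow N (Suc d)) (tpow m (Suc d))"
proof (induction d)
  case 0
  show ?case using conv_pow_1[OF N(1)] N(2) by (simp add: tadd_def)
next
  case (Suc d)
  have m: "m \<in> {0..1}" using N by (simp add: max_bias_def)
  have "m \<le> tpow m (Suc d)" using tpow_mono[OF m, of "Suc 0" "Suc d", unfolded tpow_1] by blast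
  then have "max_bias (add_conv (conv_pow N (Suc d)) N) (tadd (tpow m (Suc d)) m)"
    using N Suc by (intro max_bias_add_conv symm_conv_pow) linarith+
  then show ?case by simp
qed

section \<open>Noise on a sum against noise on its summands\<close>

context
  fixes \<phi> c :: real
  assumes \<phi>: "\<phi> \<in> {0<..<1/2}" and c: "c = 1 - 2 * \<phi>"
begin

lemma noise_c_bounds: "0 < c" "c < 1" and \<phi>01: "\<phi> \<in> {0..1}" and abs_c: "\<bar>1 - 2 * \<phi>\<bar> = c" and \<phi>_ne: "\<phi> \<noteq> 1 / 2"
  using \<phi> c by auto

lemma stoploss_bsc: "symm M \<Longrightarrow> stoploss (bsc \<phi> \<boxtimes> M) t = c * stoploss M (t / c)"
  using stoploss_bsc_box_scale[OF \<phi>01 \<phi>_ne, of M t] by (simp add: abs_c)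

lemma symm_bsc: "symm M \<Longrightarrow> symm (bsc \<phi> \<boxtimes> M)"
  by (rule symm_bsc_box[OF \<phi>01])

lemma max_bias_bsc:
  assumes "symm M" "max_bias M m"
  shows "max_bias (bsc \<phi> \<boxtimes> M) (c * m)"
proof -
  have "c * m \<in> {0..1}" using assms noise_c_bounds by (auto simp: max_bias_def intro: mult_le_one)
  moreover have "0 < stoploss M (s / c)" if "s \<in> {0..<c * m}" for s
    using that assms noise_c_bounds by (auto simp: max_bias_def field_simps)
  ultimately show ?thesis
    using assms noise_c_bounds by (auto simp: max_bias_def stoploss_bsc)
qed

lemma integral_bsc_even:
  fixes h :: "real \<Rightarrow> real"
  assumes M: "symm M" and h: "h \<in> borel_measurable borel" "\<And>x. \<bar>h (tanh_half x)\<bar> \<le> B" "\<And>b. h (- b) = h b"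
  shows "(LINT x|(bsc \<phi> \<boxtimes> M). h (tanh_half x)) = (LINT x|M. h (c * tanh_half x))"
proof -
  have le: "\<bar>c * tanh_half x\<bar> \<le> 1" for x
    unfolding abs_mult using noise_c_bounds by (intro mult_le_one) auto
  note h(1)[measurable]
  have "bounded_borel (\<lambda>x. h (tanh_half x))"
    by (intro bounded_borelI[of _ B] h(2)) measurable
  then have "(LINT x|(bsc \<phi> \<boxtimes> M). h (tanh_half x)) = (LINT x|M. refl_avg (\<lambda>x. h (tanh_half x)) (two_artanh (c * tanh_half x)))"
    by (subst integral_bsc_box_symm[OF \<phi>01 M]) (auto simp: c)
  also have "\<dots> = (LINT x|M. h (c * tanh_half x))"
    by (intro Bochner_Integration.integral_cong refl)
      (simp only: refl_avg_def tanh_half_uminus h(3) tanh_half_two_artanh[OF le], simp add: field_simps)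
  finally show ?thesis .
qed

lemma kern_minus: "kern (- a) b t = kern a b t" "kern a (- b) t = kern a b t"
  using kern_abs[of "- a" b t] kern_abs[of a "- b" t] kern_abs[of a b t] by simp_all

lemma stoploss_add_conv_bsc:
  assumes M: "symm M" "symm N"
  shows "stoploss (add_conv (bsc \<phi> \<boxtimes> M) (bsc \<phi> \<boxtimes> N)) t =
    (LINT y|N. (LINT x|M. kern (c * tanh_half x) (c * tanh_half y) t))"
proof -
  note [measurable_cong] = symmD(2)[OF M(1)]
  interpret M: prob_space "bsc \<phi> \<boxtimes> M" by (rule symmD(1)[OF symm_bsc[OF M(1)]])
  let ?h = "\<lambda>b. \<integral>x. kern (tanh_half x) b t \<partial>(bsc \<phi> \<boxtimes> M)"
  have kb: "\<bar>kern (tanh_half x) b t\<bar> \<le> 2 + 2 * \<bar>t\<bar>" if "\<bar>b\<bar> \<le> 1" for x b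
    using kern_bounded[of 1 x "two_artanh b" t] that by simp
  have "stoploss (add_conv (bsc \<phi> \<boxtimes> M) (bsc \<phi> \<boxtimes> N)) t = (LINT y|(bsc \<phi> \<boxtimes> N). ?h (tanh_half y))"
    by (rule stoploss_add_conv[OF symm_bsc[OF M(1)] symm_bsc[OF M(2)]])
  also have "\<dots> = (LINT y|N. ?h (c * tanh_half y))"
  proof (rule integral_bsc_even[OF M(2), where B = "2 + 2 * \<bar>t\<bar>" and h = ?h])
    show "?h \<in> borel_measurable borel" by measurable
    show "?h (- b) = ?h b" for b by (simp only: kern_minus)
    fix y
    have i: "integrable (bsc \<phi> \<boxtimes> M) (\<lambda>x. kern (tanh_half x) (tanh_half y) t)"
      using kb[of "tanh_half y"] by (intro M.integrable_const_bound[of _ "2 + 2 * \<bar>t\<bar>"]) auto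
    have "\<bar>?h (tanh_half y)\<bar> \<le> (LINT x|(bsc \<phi> \<boxtimes> M). \<bar>kern (tanh_half x) (tanh_half y) t\<bar>)" by (rule integral_abs_bound)
    also have "\<dots> \<le> (LINT x|(bsc \<phi> \<boxtimes> M). 2 + 2 * \<bar>t\<bar>)" using i kb[of "tanh_half y"] by (intro integral_mono) auto
    finally show "\<bar>?h (tanh_half y)\<bar> \<le> 2 + 2 * \<bar>t\<bar>" using M.prob_space by simp
  qed
  also have "\<dots> = (LINT y|N. (LINT x|M. kern (c * tanh_half x) (c * tanh_half y) t))"
  proof (rule Bochner_Integration.integral_cong[OF refl])
    fix y
    have "\<bar>c * tanh_half y\<bar> \<le> 1" unfolding abs_mult using noise_c_bounds by (intro mult_le_one) auto
    then show "?h (c * tanh_half y) = (LINT x|M. kern (c * tanh_half x) (c * tanh_half y) t)"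
      by (intro integral_bsc_even[OF M(1), where B = "2 + 2 * \<bar>t\<bar>" and h = "\<lambda>a. kern a (c * tanh_half y) t"] kb kern_minus) measurable
  qed
  finally show ?thesis .
qed

lemma stoploss_bsc_add_conv:
  assumes "symm M" "symm N"
  shows "stoploss (bsc \<phi> \<boxtimes> add_conv M N) t =
    (LINT y|N. (LINT x|M. c * kern (tanh_half x) (tanh_half y) (t / c)))"
  unfolding stoploss_bsc[OF symm_add_conv[OF assms]] stoploss_add_conv[OF assms] by simp

lemma bounded_borel_gap:
  assumes "symm M"
  shows "bounded_borel (\<lambda>x. c * kern (tanh_half x) (tanh_half y) (t / c))"
    "bounded_borel (\<lambda>x. kern (c * tanh_half x) (c * tanh_half y) t)"
    "bounded_borel (\<lambda>y. \<integral>x. c * kern (tanh_half x) (tanh_half y) (t / c) \<partial>M)"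
    "bounded_borel (\<lambda>y. \<integral>x. kern (c * tanh_half x) (c * tanh_half y) t \<partial>M)"
proof -
  have b1: "\<bar>c * kern (tanh_half x) (tanh_half y) (t / c)\<bar> \<le> c * (2 + 2 * \<bar>t / c\<bar>)" for x y
    unfolding abs_mult using noise_c_bounds kern_bounded[of 1 x y "t / c"] by (intro mult_mono) auto
  have b2: "\<bar>kern (c * tanh_half x) (c * tanh_half y) t\<bar> \<le> 2 + 2 * \<bar>t\<bar>" for x y
    using noise_c_bounds by (intro kern_bounded) auto
  show "bounded_borel (\<lambda>x. c * kern (tanh_half x) (tanh_half y) (t / c))"
    by (rule bounded_borelI[OF _ b1]) measurable
  show "bounded_borel (\<lambda>x. kern (c * tanh_half x) (c * tanh_half y) t)"
    by (rule bounded_borelI[OF _ b2]) measurable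
  show "bounded_borel (\<lambda>y. \<integral>x. c * kern (tanh_half x) (tanh_half y) (t / c) \<partial>M)"
    by (rule bounded_borel_integral[OF symmD(1,2)[OF assms] _ b1]) measurable
  show "bounded_borel (\<lambda>y. \<integral>x. kern (c * tanh_half x) (c * tanh_half y) t \<partial>M)"
    by (rule bounded_borel_integral[OF symmD(1,2)[OF assms] _ b2]) measurable
qed

lemma kern_gap_abs:
  assumes "0 \<le> t" "\<bar>a\<bar> \<le> 1" "\<bar>b\<bar> \<le> 1"
  shows "c * kern a b (t / c) \<le> kern (c * a) (c * b) t"
  using kern_gap[of "\<bar>a\<bar>" "\<bar>b\<bar>" c t] kern_abs[of a b "t / c"] kern_abs[of "c * a" "c * b" t] assms noise_c_bounds
  by (simp add: abs_mult)

lemma stoploss_gap: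
  assumes M: "symm M" "symm N"
  shows "stoploss_le (bsc \<phi> \<boxtimes> add_conv M N) (add_conv (bsc \<phi> \<boxtimes> M) (bsc \<phi> \<boxtimes> N))"
  unfolding stoploss_le_def stoploss_bsc_add_conv[OF M] stoploss_add_conv_bsc[OF M]
  by (intro allI impI integral_mono bounded_borel_integrable[OF symmD(1,2)[OF M(1)]]
      bounded_borel_integrable[OF symmD(1,2)[OF M(2)]] bounded_borel_gap[OF M(1)] kern_gap_abs) auto

text \<open>The kernel gap is strict at the extreme pair \<open>(m1, m2)\<close> by
  \<open>kern_gap_strict\<close>, whose hypotheses are open conditions. They persist on a rectangle
  of pairs just below, which has positive mass.\<close>

lemma stoploss_gap_strict:
  assumes M: "symm M" "symm N" and m: "max_bias M m1" "max_bias N m2" and pos: "0 < m1" "0 < m2" "0 < t"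
    and B: "c * \<bar>m1 - m2\<bar> < t * (1 - c\<^sup>2 * (m1 * m2))" and A: "t * (1 + c\<^sup>2 * (m1 * m2)) < c * (m1 + m2)"
  shows "stoploss (bsc \<phi> \<boxtimes> add_conv M N) t < stoploss (add_conv (bsc \<phi> \<boxtimes> M) (bsc \<phi> \<boxtimes> N)) t"
proof -
  have m01: "m1 \<in> {0..1}" "m2 \<in> {0..1}" using m by (auto simp: max_bias_def)
  \<comment> \<open>Half of the smaller slack. Magnitudes within \<open>e\<close> of
    \<open>m1\<close> and \<open>m2\<close> change the difference by at most \<open>e\<close> and
    the sum by at most \<open>2 * e\<close>, and the factor \<open>c\<close> only shrinks
    this.\<close>
  define e where "e = min (t * (1 - c\<^sup>2 * (m1 * m2)) - c * \<bar>m1 - m2\<bar>) (c * (m1 + m2) - t * (1 + c\<^sup>2 * (m1 * m2))) / 2"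
  have e: "0 < e" using A B by (simp add: e_def)
  have "2 * e = min (t * (1 - c\<^sup>2 * (m1 * m2)) - c * \<bar>m1 - m2\<bar>) (c * (m1 + m2) - t * (1 + c\<^sup>2 * (m1 * m2)))"
    by (simp add: e_def)
  then have e2: "2 * e \<le> t * (1 - c\<^sup>2 * (m1 * m2)) - c * \<bar>m1 - m2\<bar>" "2 * e \<le> c * (m1 + m2) - t * (1 + c\<^sup>2 * (m1 * m2))"
    by (simp_all only: min.cobounded1 min.cobounded2)
  obtain s1 s2 where s: "0 \<le> s1" "s1 < m1" "0 \<le> s2" "s2 < m2" "m1 - e \<le> s1" "m2 - e \<le> s2"
    using shrink_below[OF pos(1,2) e] .
  have strict: "c * kern a b (t / c) < kern (c * a) (c * b) t"
    if ab: "s1 < \<bar>a\<bar>" "\<bar>a\<bar> \<le> m1" "s2 < \<bar>b\<bar>" "\<bar>b\<bar> \<le> m2" for a b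
  proof -
    have w: "t * (c\<^sup>2 * (\<bar>a\<bar> * \<bar>b\<bar>)) \<le> t * (c\<^sup>2 * (m1 * m2))"
      using pos ab by (intro mult_left_mono mult_mono) auto
    have ce: "c * e \<le> e" using noise_c_bounds e by simp
    have "\<bar>\<bar>a\<bar> - \<bar>b\<bar>\<bar> < \<bar>m1 - m2\<bar> + e" using ab s by auto
    then have "c * \<bar>\<bar>a\<bar> - \<bar>b\<bar>\<bar> < c * (\<bar>m1 - m2\<bar> + e)" using noise_c_bounds by (intro mult_strict_left_mono) auto
    also have "\<dots> \<le> c * \<bar>m1 - m2\<bar> + 2 * e" using ce e by (simp add: distrib_left)
    also have "\<dots> \<le> t * (1 - c\<^sup>2 * (m1 * m2))" using e2(1) by linarith
    also have "\<dots> \<le> t * (1 - c\<^sup>2 * (\<bar>a\<bar> * \<bar>b\<bar>))" using w by (simp add: right_diff_distrib)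
    finally have 1: "c * \<bar>\<bar>a\<bar> - \<bar>b\<bar>\<bar> < t * (1 - c\<^sup>2 * (\<bar>a\<bar> * \<bar>b\<bar>))" .
    have "t * (1 + c\<^sup>2 * (\<bar>a\<bar> * \<bar>b\<bar>)) \<le> t * (1 + c\<^sup>2 * (m1 * m2))" using w by (simp add: distrib_left)
    also have "\<dots> \<le> c * (m1 + m2) - 2 * e" using e2(2) by linarith
    also have "\<dots> \<le> c * (m1 - e + (m2 - e))" using ce by (simp add: algebra_simps)
    also have "\<dots> < c * (\<bar>a\<bar> + \<bar>b\<bar>)" using noise_c_bounds ab s by (intro mult_strict_left_mono) auto
    finally have 2: "t * (1 + c\<^sup>2 * (\<bar>a\<bar> * \<bar>b\<bar>)) < c * (\<bar>a\<bar> + \<bar>b\<bar>)" .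
    have "c * kern \<bar>a\<bar> \<bar>b\<bar> (t / c) < kern (c * \<bar>a\<bar>) (c * \<bar>b\<bar>) t"
    proof (rule kern_gap_strict[OF _ _ noise_c_bounds _ pos(3) _ _ 1 2])
      show "\<bar>a\<bar> \<in> {0..1}" "\<bar>b\<bar> \<in> {0..1}" using ab m01 by auto
      show "0 \<le> t" "0 < \<bar>a\<bar>" "0 < \<bar>b\<bar>" using pos ab s by linarith+
    qed
    moreover have "c * \<bar>u\<bar> = \<bar>c * u\<bar>" for u using noise_c_bounds by (simp add: abs_mult)
    ultimately show ?thesis by (simp only: kern_abs)
  qed
  show ?thesis
    unfolding stoploss_bsc_add_conv[OF M] stoploss_add_conv_bsc[OF M]
  proof (rule integral_strict_mono_max_bias[OF M(2) m(2) _ _ _ s(3,4)])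
    fix y
    show "(LINT x|M. c * kern (tanh_half x) (tanh_half y) (t / c)) \<le> (LINT x|M. kern (c * tanh_half x) (c * tanh_half y) t)"
      using pos by (intro integral_mono bounded_borel_integrable[OF symmD(1,2)[OF M(1)]]
          bounded_borel_gap[OF M(1)] kern_gap_abs) auto
    assume y: "s2 < mag y" "mag y \<le> m2"
    show "(LINT x|M. c * kern (tanh_half x) (tanh_half y) (t / c)) < (LINT x|M. kern (c * tanh_half x) (c * tanh_half y) t)"
      using y strict pos
      by (intro integral_strict_mono_max_bias[OF M(1) m(1) _ _ _ s(1,2)] bounded_borel_gap[OF M(1)] kern_gap_abs) auto
  qed (intro bounded_borel_gap M)+
qed

lemma stoploss_conv_pow_gap:
  assumes N: "symm N"
  shows "stoploss_le (bsc \<phi> \<boxtimes> conv_pow N d) (conv_pow (bsc \<phi> \<boxtimes> N) d)"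
proof (induction d)
  case 0
  show ?case using noise_c_bounds by (simp add: stoploss_le_def stoploss_bsc symm_return_zero stoploss_return_zero)
next
  case (Suc d)
  have "stoploss_le (add_conv (bsc \<phi> \<boxtimes> conv_pow N d) (bsc \<phi> \<boxtimes> N)) (add_conv (conv_pow (bsc \<phi> \<boxtimes> N) d) (bsc \<phi> \<boxtimes> N))"
    by (intro stoploss_add_conv_mono Suc symm_conv_pow symm_bsc N)
  then show ?case
    using stoploss_le_trans[OF stoploss_gap[OF symm_conv_pow[OF N, of d] N]] by simp
qed

text \<open>With equal largest biases, the lower condition of \<open>stoploss_gap_strict\<close> is
  just \<open>0 < t\<close>. The upper one holds even at \<open>t = c * tpow m 2\<close>, because
  the noisy summands reach \<open>2 * c * m / (1 + c\<^sup>2 * m\<^sup>2)\<close>, which is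
  larger.\<close>

lemma stoploss_conv_pow_strict_2:
  assumes N: "symm N" and m: "max_bias N m" "0 < m" and t: "0 < t" "t \<le> c * tpow m 2"
  shows "stoploss (bsc \<phi> \<boxtimes> conv_pow N 2) t < stoploss (conv_pow (bsc \<phi> \<boxtimes> N) 2) t"
proof -
  have m01: "m \<in> {0..1}" using m by (simp add: max_bias_def)
  have c2: "c\<^sup>2 < 1" using noise_c_bounds by (simp add: power_less_one_iff)
  have mm: "0 < m * m" "m * m \<le> 1" using m m01 by (auto intro: mult_le_one)
  have "c\<^sup>2 * (m * m) < m * m" using mult_strict_right_mono[OF c2 mm(1)] by simp
  then have v: "c\<^sup>2 * (m * m) < m * m" "c\<^sup>2 * (m * m) < 1" using mm by auto
  have "tpow m 2 = tadd m m" by (simp add: numeral_2_eq_2 tadd_def)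
  then have t': "t \<le> c * ((m + m) / (1 + m * m))" using t by (simp add: tadd_def)
  have "t * (1 + c\<^sup>2 * (m * m)) < t * (1 + m * m)" using t v by simp
  also have "\<dots> \<le> c * (m + m)"
    using t' mm by (simp add: pos_le_divide_eq add_pos_pos)
  finally have "t * (1 + c\<^sup>2 * (m * m)) < c * (m + m)" .
  then have "stoploss (bsc \<phi> \<boxtimes> add_conv N N) t < stoploss (add_conv (bsc \<phi> \<boxtimes> N) (bsc \<phi> \<boxtimes> N)) t"
    using t v m by (intro stoploss_gap_strict[OF N N m(1) m(1)]) auto
  then show ?thesis
    using conv_pow_1[OF N] conv_pow_1[OF symm_bsc[OF N]] by (simp add: numeral_2_eq_2)
qed

text \<open>The gap survives a further summand of bias \<open>b\<close> if
  \<open>\<bar>b - t\<bar> / (1 - b * t)\<close> lies where the induction hypothesis is strict, for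
  all \<open>b\<close> near the maximum \<open>c * m\<close>. For two summands that range omits 0,
  so \<open>b = t\<close> is the critical case.\<close>

lemma stoploss_conv_pow_strict:
  assumes N: "symm N" and m: "max_bias N m" "0 < m"
    and t: "0 \<le> t" "t \<le> c * tpow m (Suc (Suc d))" "0 < t \<or> 0 < d"
  shows "stoploss (bsc \<phi> \<boxtimes> conv_pow N (Suc (Suc d))) t < stoploss (conv_pow (bsc \<phi> \<boxtimes> N) (Suc (Suc d))) t"
  using t
proof (induction d arbitrary: t)
  case 0
  then show ?case using stoploss_conv_pow_strict_2[OF N m, of t] by (simp add: numeral_2_eq_2)
next
  case (Suc d)
  let ?D = "Suc (Suc d)" and ?N' = "bsc \<phi> \<boxtimes> N"
  define A where "A = tpow m ?D"
  have m01: "m \<in> {0..1}" using m by (simp add: max_bias_def)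
  have A: "A \<in> {0..1}" "m \<le> A"
    using tpow_bounds[OF m01, of ?D] tpow_mono[OF m01, of "Suc 0" ?D, unfolded tpow_1] unfolding A_def by auto
  have N': "symm ?N'" by (rule symm_bsc[OF N])
  have m': "max_bias ?N' (c * m)" by (rule max_bias_bsc[OF N m(1)])
  have cc: "c * m \<le> c" "c * A \<le> c" using noise_c_bounds m01 A by (auto intro!: mult_left_le)
  have "0 < c * m" "c * m \<le> c * A" using noise_c_bounds m(2) mult_left_mono[OF A(2), of c] by auto
  moreover have "c * m < 1" "c * A < 1" using cc noise_c_bounds by linarith+
  ultimately have cm: "0 < c * m" "c * m \<le> c * A" "c * m < 1" "c * A < 1" by blast+
  have T: "t * (1 + A * m) \<le> c * (A + m)"
  proof -
    have "t \<le> c * ((A + m) / (1 + A * m))"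
      using Suc.prems(2) unfolding A_def by (simp only: tpow.simps(2)[of m ?D] tadd_def)
    moreover have "0 < 1 + A * m" using A m by (simp add: add_pos_nonneg)
    ultimately show ?thesis by (simp add: pos_le_divide_eq)
  qed
  have t1: "t \<le> 1"
  proof -
    have "c * tpow m (Suc ?D) \<le> 1" using noise_c_bounds tpow_bounds[OF m01, of "Suc ?D"] by (intro mult_le_one) auto
    then show ?thesis using Suc.prems(2) by linarith
  qed
  have step1: "stoploss (bsc \<phi> \<boxtimes> conv_pow N (Suc ?D)) t \<le> stoploss (add_conv (bsc \<phi> \<boxtimes> conv_pow N ?D) ?N') t"
    using stoploss_leD[OF stoploss_gap[OF symm_conv_pow[OF N, of ?D] N] Suc.prems(1)] by simp
  have le: "stoploss_le (bsc \<phi> \<boxtimes> conv_pow N ?D) (conv_pow ?N' ?D)" by (rule stoploss_conv_pow_gap[OF N])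
  have sy: "symm (bsc \<phi> \<boxtimes> conv_pow N ?D)" "symm (conv_pow ?N' ?D)"
    by (intro symm_bsc symm_conv_pow N)+
  have step2: "stoploss (add_conv (bsc \<phi> \<boxtimes> conv_pow N ?D) ?N') t \<le> stoploss (conv_pow ?N' (Suc ?D)) t"
    using stoploss_leD[OF stoploss_add_conv_mono[OF sy N' le] Suc.prems(1)] by simp
  have via_IH: ?case if s: "0 \<le> s" "s < c * m"
    and near: "\<And>b. s < b \<Longrightarrow> b \<le> c * m \<Longrightarrow> \<bar>b - t\<bar> \<le> c * A * (1 - b * t) \<and> (b \<noteq> t \<or> 0 < d)" for s
  proof -
    have "stoploss (add_conv (bsc \<phi> \<boxtimes> conv_pow N ?D) ?N') t < stoploss (add_conv (conv_pow ?N' ?D) ?N') t"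
    proof (rule stoploss_add_conv_strict_mono[OF sy N' le _ m' s])
      show "t \<in> {0..1}" using t1 Suc.prems(1) by simp
      fix b assume b: "s < b" "b \<le> c * m"
      have "b * t \<le> b" using b s t1 by (intro mult_left_le) auto
      then have bt: "b * t < 1" using b cm by linarith
      have "stoploss (bsc \<phi> \<boxtimes> conv_pow N ?D) (\<bar>b - t\<bar> / (1 - b * t)) < stoploss (conv_pow ?N' ?D) (\<bar>b - t\<bar> / (1 - b * t))"
        using near[OF b] bt by (intro Suc.IH) (auto simp: A_def[symmetric] pos_divide_le_eq simp del: tpow.simps(2))
      then show "b * t < 1 \<and> stoploss (bsc \<phi> \<boxtimes> conv_pow N ?D) (\<bar>b - t\<bar> / (1 - b * t)) < stoploss (conv_pow ?N' ?D) (\<bar>b - t\<bar> / (1 - b * t))"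
        using bt by blast
    qed
    then show ?case using step1 by simp
  qed
  have small: "b - u \<le> c * A * (1 - b * u)" if "0 \<le> u" "u \<le> b" "b \<le> c * m" for b u
  proof -
    have "b \<le> 1" using that cm by linarith
    then have "b * b \<le> 1" using that by (intro mult_le_one) auto
    then have "b * b * u \<le> u" using that by (intro mult_left_le_one_le) auto
    then have "b - u \<le> b * (1 - b * u)" by (simp add: algebra_simps)
    also have "\<dots> \<le> c * A * (1 - b * u)"
    proof (rule mult_right_mono)
      have "b * u \<le> 1" using \<open>b \<le> 1\<close> that by (intro mult_le_one) auto
      then show "0 \<le> 1 - b * u" by simp
    qed (use that cm in linarith)
    finally show ?thesis .
  qed
  consider "t < c * m" | "t = c * m" "0 < d" | "t = c * m" "d = 0" | "c * m < t" by linarith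
  then show ?case
  proof cases
    case 1
    \<comment> \<open>Taking \<open>s = t\<close> keeps \<open>b\<close> strictly above
      \<open>t\<close>.\<close>
    show ?thesis using 1 Suc.prems(1) by (intro via_IH[of t]) (auto simp: small)
  next
    case 2
    \<comment> \<open>Now \<open>b = t\<close> may occur and leads to the point 0, which the
      induction hypothesis covers because \<open>0 < d\<close>.\<close>
    show ?thesis using 2 cm by (intro via_IH[of 0]) (auto simp: small abs_minus_commute mult.commute[of _ "c * m"])
  next
    case 3
    \<comment> \<open>All the mass may sit at \<open>b = t\<close>, where strictness for two
      summands would be needed at 0. The gap comes instead from separating the third summand:
      \<open>t = c * m\<close> lies strictly between the two biases obtained by combining the noisy
      biases \<open>c * A\<close> and \<open>c * m\<close>.\<close>
    have "stoploss (bsc \<phi> \<boxtimes> add_conv (conv_pow N ?D) N) t < stoploss (add_conv (bsc \<phi> \<boxtimes> conv_pow N ?D) ?N') t"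
    proof (rule stoploss_gap_strict[OF symm_conv_pow[OF N] N max_bias_conv_pow[OF N m, of "Suc d"] m(1)])
      have A2: "A * (1 + m * m) = 2 * m" 
        using 3 m by (simp add: A_def tadd_def add_pos_pos[THEN less_imp_neq, symmetric])
      have c2: "c\<^sup>2 < 1" using noise_c_bounds by (simp add: power_less_one_iff)
      have Amm: "0 < A * (m * m)" using A m by simp
      have v: "c\<^sup>2 * (A * (m * m)) < A * (m * m)" using mult_strict_right_mono[OF c2 Amm] by simp
      have "A - m < m * (1 - c\<^sup>2 * (A * m))" using A2 v by (simp add: algebra_simps)
      then have "c * (A - m) < c * (m * (1 - c\<^sup>2 * (A * m)))" using noise_c_bounds by (intro mult_strict_left_mono)
      then show "c * \<bar>tpow m ?D - m\<bar> < t * (1 - c\<^sup>2 * (tpow m ?D * m))"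
        unfolding A_def[symmetric] using A 3(1) by (simp add: mult_ac)
      have "A * (m * m) \<le> A" using A m01 by (intro mult_left_le mult_le_one) auto
      then have "m * (1 + c\<^sup>2 * (A * m)) < A + m" using v by (simp add: algebra_simps)
      then have "c * (m * (1 + c\<^sup>2 * (A * m))) < c * (A + m)" using noise_c_bounds by (intro mult_strict_left_mono)
      then show "t * (1 + c\<^sup>2 * (tpow m ?D * m)) < c * (tpow m ?D + m)"
        unfolding A_def[symmetric] using 3(1) by (simp add: mult_ac)
      show "0 < tpow m ?D" unfolding A_def[symmetric] using A m by simp
    qed (use 3 cm m in auto)
    then show ?thesis using step2 by simp
  next
    case 4
    \<comment> \<open>Slack at \<open>b = c * m\<close> in the requirement
      \<open>t - b \<le> c * A * (1 - b * t)\<close>. It is positive even for the largest admissible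
      \<open>t\<close>, because \<open>c\<^sup>2 < 1\<close>.\<close>
    define e where "e = c * (A + m) - t * (1 + c\<^sup>2 * (A * m))"
    have t0: "0 < t" using 4 cm by linarith
    have c2: "c\<^sup>2 < 1" using noise_c_bounds by (simp add: power_less_one_iff)
    have "c\<^sup>2 * (A * m) < A * m" using mult_strict_right_mono[OF c2, of "A * m"] A m by simp
    then have "t * (1 + c\<^sup>2 * (A * m)) < t * (1 + A * m)" using t0 by simp
    then have e: "0 < e" using T by (simp add: e_def)
    obtain s where s: "0 \<le> s" "s < c * m" "c * m - e \<le> s"
      using shrink_below[OF cm(1) cm(1) e] by metis
    show ?thesis
    proof (rule via_IH[OF s(1,2)])
      fix b assume b: "s < b" "b \<le> c * m"
      have "t * (c * A * b) \<le> t * (c * A * (c * m))"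
        using b t0 noise_c_bounds A by (intro mult_left_mono) auto
      then have "t - b \<le> c * A * (1 - b * t)"
        using b s by (simp add: e_def algebra_simps power2_eq_square)
      then show "\<bar>b - t\<bar> \<le> c * A * (1 - b * t) \<and> (b \<noteq> t \<or> 0 < d)" using b 4 by auto
    qed
  qed
qed

end

section \<open>The belief propagation operator\<close>

abbreviation bp_sum :: "nat set \<Rightarrow> real \<Rightarrow> (nat \<Rightarrow> ereal) \<Rightarrow> (nat \<Rightarrow> real) \<Rightarrow> ereal" where
  "bp_sum A \<delta> R Z \<equiv> \<Sum>u\<in>A. ereal (Z u) * bp_fun \<delta> (R u)"

text \<open>In the bias coordinate \<open>bp_fun \<delta>\<close> is multiplication by
  \<open>1 - 2 * \<delta>\<close>; together with the random sign it is box convolution with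
  \<open>bsc \<delta>\<close>.\<close>

lemma bp_fun_eq:
  assumes "\<delta> \<in> {0..1}"
  shows "bp_fun \<delta> x = two_artanh ((1 - 2 * \<delta>) * tanh_half x)"
proof -
  have llr: "two_artanh (1 - 2 * \<delta>) = llr \<delta>"
    using two_artanh_tanh_half[of "llr \<delta>", unfolded tanh_half_llr[OF assms]] .
  show ?thesis
  proof (cases x)
    case (real r)
    define e where "e = exp r"
    have e: "0 < e" by (simp add: e_def)
    define q where "q = ((1 - \<delta>) * e + \<delta>) / (\<delta> * e + 1 - \<delta>)"
    have pos: "0 < d * e + (1 - d)" if "0 \<le> d" "d \<le> 1" for d
    proof (cases "d = 0")
      case False
      then show ?thesis using that e by (intro add_pos_nonneg) auto
    qed simp
    have p: "0 < (1 - \<delta>) * e + \<delta>" "0 < \<delta> * e + 1 - \<delta>"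
      using pos[of "1 - \<delta>"] pos[of \<delta>] assms by simp_all
    have q: "0 < q" using p by (simp add: q_def)
    have "tanh_half (bp_fun \<delta> x) = tanh (ln q / 2)"
      using real by (simp add: bp_fun_def tanh_half_def q_def e_def)
    also have "\<dots> = (q - 1) / (q + 1)" using q by (simp add: tanh_real_exp)
    also have "\<dots> = (1 - 2 * \<delta>) * ((e - 1) / (e + 1))"
    proof -
      have "q - 1 = (1 - 2 * \<delta>) * (e - 1) / (\<delta> * e + 1 - \<delta>)" "q + 1 = (e + 1) / (\<delta> * e + 1 - \<delta>)"
        using p by (simp_all add: q_def field_simps)
      then show ?thesis using p e by simp
    qed
    also have "\<dots> = (1 - 2 * \<delta>) * tanh_half x"
      using real by (simp add: tanh_half_def tanh_real_exp e_def)
    finally show ?thesis using two_artanh_tanh_half[of "bp_fun \<delta> x"] by simp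
  next
    case PInf
    then show ?thesis by (simp add: bp_fun_def llr)
  next
    case MInf
    have "\<bar>1 - 2 * \<delta>\<bar> \<le> 1" using assms by auto
    then show ?thesis using MInf two_artanh_uminus[of "1 - 2 * \<delta>"] by (simp add: bp_fun_def llr)
  qed
qed

lemma bp_fun_measurable [measurable]: "\<delta> \<in> {0..1} \<Longrightarrow> bp_fun \<delta> \<in> borel_measurable borel"
proof -
  assume "\<delta> \<in> {0..1}"
  then have "bp_fun \<delta> = (\<lambda>x. two_artanh ((1 - 2 * \<delta>) * tanh_half x))" by (intro ext bp_fun_eq)
  then show ?thesis by (rule ssubst) measurable
qed

lemma nn_integral_bsc_box_bp:
  assumes \<delta>: "\<delta> \<in> {0..1}" and M: "symm M" and f[measurable]: "f \<in> borel_measurable borel"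
  shows "(\<integral>\<^sup>+y. f y \<partial>(bsc \<delta> \<boxtimes> M)) = (\<integral>\<^sup>+z. \<integral>\<^sup>+x. f (ereal z * bp_fun \<delta> x) \<partial>M \<partial>measure_pmf (flip_sign_pmf \<delta>))"
proof -
  note [measurable_cong] = symmD(2)[OF M]
  interpret sigma_finite_measure M using symmD(1)[OF M] by (rule prob_space_imp_sigma_finite)
  have le: "\<bar>(1 - 2 * \<delta>) * tanh_half x\<bar> \<le> 1" for x
    unfolding abs_mult using \<delta> by (intro mult_le_one) auto
  have "(\<integral>\<^sup>+y. f y \<partial>(bsc \<delta> \<boxtimes> M)) = (\<integral>\<^sup>+w. \<integral>\<^sup>+x. f (two_artanh (tanh_half w * tanh_half x)) \<partial>M \<partial>bsc \<delta>)"
    unfolding box_conv_def by (subst nn_integral_distr) (auto simp: nn_integral_fst[symmetric] split_beta')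
  also have "\<dots> = (\<integral>\<^sup>+b. \<integral>\<^sup>+x. f (two_artanh (tanh_half (if b then - llr \<delta> else llr \<delta>) * tanh_half x)) \<partial>M \<partial>measure_pmf (bernoulli_pmf \<delta>))"
    unfolding bsc_def by (subst nn_integral_distr) auto
  also have "\<dots> = (\<integral>\<^sup>+b. \<integral>\<^sup>+x. f (ereal (if b then - 1 else 1) * bp_fun \<delta> x) \<partial>M \<partial>measure_pmf (bernoulli_pmf \<delta>))"
  proof (intro nn_integral_cong arg_cong[of _ _ f])
    fix b x
    have "tanh_half (if b then - llr \<delta> else llr \<delta>) * tanh_half x = (if b then - ((1 - 2 * \<delta>) * tanh_half x) else (1 - 2 * \<delta>) * tanh_half x)"
      using \<delta> by (simp add: algebra_simps)
    moreover have "ereal (- 1) * y = - y" for y by (cases y) auto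
    ultimately show "two_artanh (tanh_half (if b then - llr \<delta> else llr \<delta>) * tanh_half x) = ereal (if b then - 1 else 1) * bp_fun \<delta> x"
      by (cases b) (simp_all only: if_True if_False bp_fun_eq[OF \<delta>] two_artanh_uminus[OF le], simp)
  qed
  also have "\<dots> = (\<integral>\<^sup>+z. \<integral>\<^sup>+x. f (ereal z * bp_fun \<delta> x) \<partial>M \<partial>measure_pmf (flip_sign_pmf \<delta>))"
    unfolding flip_sign_pmf_def by simp
  finally show ?thesis .
qed

text \<open>For induction on the number of terms: the head of an i.i.d. sequence is independent of
  its tail, which has the law of the whole sequence.\<close>

lemma nn_integral_PiM_case_nat:
  assumes M: "prob_space M" and g[measurable]: "g \<in> borel_measurable (\<Pi>\<^sub>M i\<in>(UNIV :: nat set). M)"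
  shows "(\<integral>\<^sup>+\<omega>. g \<omega> \<partial>(\<Pi>\<^sub>M i\<in>UNIV. M)) = (\<integral>\<^sup>+x. \<integral>\<^sup>+\<omega>. g (case_nat x \<omega>) \<partial>(\<Pi>\<^sub>M i\<in>UNIV. M) \<partial>M)"
proof -
  interpret M: prob_space M by fact
  interpret sequence_space M ..
  have cn: "(\<lambda>(s, \<omega>). case_nat s \<omega>) \<in> M \<Otimes>\<^sub>M S \<rightarrow>\<^sub>M S"
    by measurable
  have "(\<integral>\<^sup>+\<omega>. g \<omega> \<partial>S) = (\<integral>\<^sup>+\<omega>. g \<omega> \<partial>distr (M \<Otimes>\<^sub>M S) S (\<lambda>(s, \<omega>). case_nat s \<omega>))"
    by (simp only: PiM_iter)
  also have "\<dots> = (\<integral>\<^sup>+p. g ((\<lambda>(s, \<omega>). case_nat s \<omega>) p) \<partial>(M \<Otimes>\<^sub>M S))"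
    by (rule nn_integral_distr) (use cn g in simp_all)
  also have "\<dots> = (\<integral>\<^sup>+x. \<integral>\<^sup>+\<omega>. g (case_nat x \<omega>) \<partial>S \<partial>M)"
    using P.nn_integral_fst[of "\<lambda>p. g ((\<lambda>(s, \<omega>). case_nat s \<omega>) p)" M] measurable_compose[OF cn g] by simp
  finally show ?thesis .
qed

context
  fixes \<delta> :: real and M :: "ereal measure"
  assumes \<delta>: "\<delta> \<in> {0..1}" and M: "symm M"
begin

abbreviation "R_seq \<equiv> \<Pi>\<^sub>M u\<in>(UNIV :: nat set). M"
abbreviation "Z_seq \<equiv> \<Pi>\<^sub>M u\<in>(UNIV :: nat set). measure_pmf (flip_sign_pmf \<delta>)"

lemma bp_term_measurable:
  "(\<lambda>(R, Z). ereal (Z u) * bp_fun \<delta> (R u)) \<in> borel_measurable (R_seq \<Otimes>\<^sub>M Z_seq)"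
proof -
  note bp_fun_measurable[OF \<delta>, measurable] and [measurable_cong] = symmD(2)[OF M]
  have [measurable]: "(\<lambda>Z. ereal (Z u)) \<in> borel_measurable Z_seq"
    by (rule measurable_compose[OF measurable_component_singleton]) auto
  have [measurable]: "(\<lambda>R. R u) \<in> borel_measurable R_seq"
    using measurable_component_singleton[of u UNIV "\<lambda>_. M"] symmD(2)[OF M] by (simp cong: measurable_cong_sets)
  show ?thesis by measurable
qed

lemma bp_sum_measurable:
  "(\<lambda>(R, Z). bp_sum A \<delta> R Z) \<in> borel_measurable (R_seq \<Otimes>\<^sub>M Z_seq)"
  unfolding split_beta' by (rule borel_measurable_ereal_sum) (rule bp_term_measurable[unfolded split_beta'])

text \<open>Peeling the heads of both sequences leaves a sum with one term fewer under a translated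
  \<open>f\<close>, so \<open>f\<close> is arbitrary in the induction. Terms are counted from 0 to
  fit \<open>case_nat\<close>; commutativity reconciles the new term in front with
  \<open>conv_pow\<close>, which appends.\<close>

lemma nn_integral_bp_sum:
  assumes f: "f \<in> borel_measurable borel"
  shows "(\<integral>\<^sup>+R. \<integral>\<^sup>+Z. f (bp_sum {..<d} \<delta> R Z) \<partial>Z_seq \<partial>R_seq) = (\<integral>\<^sup>+s. f s \<partial>conv_pow (bsc \<delta> \<boxtimes> M) d)"
  using f
proof (induction d arbitrary: f)
  case 0
  interpret R: prob_space R_seq using symmD(1)[OF M] by (intro prob_space_PiM)
  interpret Z: prob_space Z_seq by (intro prob_space_PiM measure_pmf.prob_space_axioms)
  show ?case using 0 by (simp add: nn_integral_return R.emeasure_space_1 Z.emeasure_space_1)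
next
  case (Suc d)
  let ?N = "bsc \<delta> \<boxtimes> M" and ?Z = "measure_pmf (flip_sign_pmf \<delta>)"
  note [measurable] = Suc.prems and bp_fun_measurable[OF \<delta>, measurable] and [measurable_cong] = symmD(2)[OF M]
  interpret M: prob_space M by (rule symmD(1)[OF M])
  interpret R: prob_space R_seq using symmD(1)[OF M] by (intro prob_space_PiM)
  interpret Z: prob_space Z_seq by (intro prob_space_PiM measure_pmf.prob_space_axioms)
  interpret RZ: pair_sigma_finite R_seq ?Z by unfold_locales
  interpret MZ: pair_sigma_finite M ?Z by unfold_locales
  have N: "symm ?N" by (rule symm_bsc_box[OF \<delta> M])
  have C: "symm (conv_pow ?N d)" by (rule symm_conv_pow[OF N])
  interpret N: prob_space ?N by (rule symmD(1)[OF N])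
  interpret C: prob_space "conv_pow ?N d" by (rule symmD(1)[OF C])
  interpret CN: pair_sigma_finite "conv_pow ?N d" ?N by unfold_locales
  note [measurable_cong] = symmD(2)[OF C]
  note S[measurable] = bp_sum_measurable[of "{..<d}"] bp_sum_measurable[of "{..<Suc d}"]
  have S2: "(\<lambda>Z. bp_sum A \<delta> R Z) \<in> borel_measurable Z_seq" if "R \<in> space R_seq" for A R
    using measurable_compose[OF measurable_Pair1'[OF that] bp_sum_measurable[of A]] by simp
  have S3: "(\<lambda>R. \<integral>\<^sup>+Z. f (bp_sum {..<Suc d} \<delta> R Z) \<partial>Z_seq) \<in> borel_measurable R_seq"
    by measurable
  have spR: "space R_seq = UNIV" by (simp add: space_PiM symmD(3)[OF M])
  have "(\<integral>\<^sup>+R. \<integral>\<^sup>+Z. f (bp_sum {..<Suc d} \<delta> R Z) \<partial>Z_seq \<partial>R_seq)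
    = (\<integral>\<^sup>+x. \<integral>\<^sup>+R. \<integral>\<^sup>+Z. f (bp_sum {..<Suc d} \<delta> (case_nat x R) Z) \<partial>Z_seq \<partial>R_seq \<partial>M)"
    by (rule nn_integral_PiM_case_nat[OF symmD(1)[OF M] S3])
  also have "\<dots> = (\<integral>\<^sup>+x. \<integral>\<^sup>+R. \<integral>\<^sup>+z. \<integral>\<^sup>+Z. f (bp_sum {..<Suc d} \<delta> (case_nat x R) (case_nat z Z)) \<partial>Z_seq \<partial>?Z \<partial>R_seq \<partial>M)"
    by (intro nn_integral_cong nn_integral_PiM_case_nat measure_pmf.prob_space_axioms measurable_compose[OF S2 Suc.prems])
      (simp only: spR UNIV_I)
  also have "\<dots> = (\<integral>\<^sup>+x. \<integral>\<^sup>+R. \<integral>\<^sup>+z. \<integral>\<^sup>+Z. f (ereal z * bp_fun \<delta> x + (bp_sum {..<d} \<delta> R Z)) \<partial>Z_seq \<partial>?Z \<partial>R_seq \<partial>M)"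
    by (simp only: sum.lessThan_Suc_shift nat.case)
  also have "\<dots> = (\<integral>\<^sup>+x. \<integral>\<^sup>+z. \<integral>\<^sup>+R. \<integral>\<^sup>+Z. f (ereal z * bp_fun \<delta> x + (bp_sum {..<d} \<delta> R Z)) \<partial>Z_seq \<partial>R_seq \<partial>?Z \<partial>M)"
  proof (rule nn_integral_cong, rule RZ.Fubini'[symmetric])
    fix x
    have [measurable]: "(\<lambda>p. \<Sum>u<d. ereal (snd p u) * bp_fun \<delta> (fst (fst p) u)) \<in> borel_measurable ((R_seq \<Otimes>\<^sub>M ?Z) \<Otimes>\<^sub>M Z_seq)"
      using measurable_compose[of "\<lambda>p. (fst (fst p), snd p)" "(R_seq \<Otimes>\<^sub>M ?Z) \<Otimes>\<^sub>M Z_seq" "R_seq \<Otimes>\<^sub>M Z_seq", OF _ S(1)] by simp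
    have [measurable]: "(\<lambda>p. ereal (snd (fst p))) \<in> borel_measurable ((R_seq \<Otimes>\<^sub>M ?Z) \<Otimes>\<^sub>M Z_seq)"
      by (rule measurable_compose[of _ _ ?Z]) auto
    show "(\<lambda>(R, z). \<integral>\<^sup>+Z. f (ereal z * bp_fun \<delta> x + (bp_sum {..<d} \<delta> R Z)) \<partial>Z_seq) \<in> borel_measurable (R_seq \<Otimes>\<^sub>M ?Z)"
      unfolding split_beta' by (rule Z.borel_measurable_nn_integral) (simp add: split_beta')
  qed
  also have "\<dots> = (\<integral>\<^sup>+x. \<integral>\<^sup>+z. \<integral>\<^sup>+s. f (ereal z * bp_fun \<delta> x + s) \<partial>conv_pow ?N d \<partial>?Z \<partial>M)"
    by (intro nn_integral_cong Suc.IH) measurable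
  also have "\<dots> = (\<integral>\<^sup>+z. \<integral>\<^sup>+x. \<integral>\<^sup>+s. f (ereal z * bp_fun \<delta> x + s) \<partial>conv_pow ?N d \<partial>M \<partial>?Z)"
  proof (rule MZ.Fubini'[symmetric])
    have [measurable]: "(\<lambda>p. ereal (snd p)) \<in> borel_measurable (M \<Otimes>\<^sub>M ?Z)"
      by (rule measurable_compose[of _ _ ?Z]) auto
    have "(\<lambda>y. \<integral>\<^sup>+s. f (y + s) \<partial>conv_pow ?N d) \<in> borel_measurable borel" by measurable
    from measurable_compose[OF _ this, of "\<lambda>p. ereal (snd p) * bp_fun \<delta> (fst p)" "M \<Otimes>\<^sub>M ?Z"]
    show "(\<lambda>(x, z). \<integral>\<^sup>+s. f (ereal z * bp_fun \<delta> x + s) \<partial>conv_pow ?N d) \<in> borel_measurable (M \<Otimes>\<^sub>M ?Z)"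
      by (simp add: split_beta')
  qed
  also have "\<dots> = (\<integral>\<^sup>+y. \<integral>\<^sup>+s. f (y + s) \<partial>conv_pow ?N d \<partial>?N)"
    by (rule nn_integral_bsc_box_bp[OF \<delta> M, symmetric]) measurable
  also have "\<dots> = (\<integral>\<^sup>+s. \<integral>\<^sup>+y. f (s + y) \<partial>?N \<partial>conv_pow ?N d)"
    by (subst CN.Fubini') (auto simp: add.commute)
  also have "\<dots> = (\<integral>\<^sup>+s. f s \<partial>conv_pow ?N (Suc d))"
    by (simp add: add_conv_def nn_integral_distr N.nn_integral_fst[symmetric] split_beta')
  finally show ?case .
qed

lemma nn_integral_bp:
  assumes f[measurable]: "f \<in> borel_measurable borel"
  shows "(\<integral>\<^sup>+x. f x \<partial>bp \<delta> P M) = (\<integral>\<^sup>+d. \<integral>\<^sup>+x. f x \<partial>conv_pow (bsc \<delta> \<boxtimes> M) d \<partial>measure_pmf P)"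
proof -
  interpret R: prob_space R_seq using symmD(1)[OF M] by (intro prob_space_PiM)
  interpret Z: prob_space Z_seq by (intro prob_space_PiM measure_pmf.prob_space_axioms)
  interpret RZ: pair_prob_space R_seq Z_seq by unfold_locales
  have spR: "space R_seq = UNIV" by (simp add: space_PiM symmD(3)[OF M])
  have bs[measurable]: "(\<lambda>(R, Z). bp_sum A \<delta> R Z) \<in> borel_measurable (R_seq \<Otimes>\<^sub>M Z_seq)" for A
    by (rule bp_sum_measurable)
  have m: "(\<lambda>(d, R, Z). bp_sum {1..d} \<delta> R Z) \<in> borel_measurable (measure_pmf P \<Otimes>\<^sub>M R_seq \<Otimes>\<^sub>M Z_seq)"
  proof -
    have "(\<lambda>p. (\<lambda>(R, Z). \<Sum>u = 1..fst p. ereal (Z u) * bp_fun \<delta> (R u)) (snd p)) \<in> borel_measurable (count_space UNIV \<Otimes>\<^sub>M (R_seq \<Otimes>\<^sub>M Z_seq))"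
      by (rule measurable_compose_countable[of "\<lambda>d p. (\<lambda>(R, Z). bp_sum {1..d} \<delta> R Z) (snd p)" _ _ fst])
        (auto intro: measurable_compose[OF measurable_snd bs])
    then show ?thesis
      by (simp add: split_beta' cong: measurable_cong_sets sets_pair_measure_cong)
  qed
  \<comment> \<open>\<open>bp\<close> numbers its terms from 1, so coordinate 0 of both sequences is
    integrated out.\<close>
  have shift: "(\<integral>\<^sup>+R. \<integral>\<^sup>+Z. f (bp_sum {1..d} \<delta> R Z) \<partial>Z_seq \<partial>R_seq)
      = (\<integral>\<^sup>+R. \<integral>\<^sup>+Z. f (bp_sum {..<d} \<delta> R Z) \<partial>Z_seq \<partial>R_seq)" for d
  proof -
    have S2: "(\<lambda>Z. bp_sum A \<delta> R Z) \<in> borel_measurable Z_seq" if "R \<in> space R_seq" for A R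
      using measurable_compose[OF measurable_Pair1'[OF that] bp_sum_measurable[of A]] by simp
    have S3: "(\<lambda>R. \<integral>\<^sup>+Z. f (bp_sum A \<delta> R Z) \<partial>Z_seq) \<in> borel_measurable R_seq" for A
      by measurable
    have "(\<integral>\<^sup>+R. \<integral>\<^sup>+Z. f (bp_sum {1..d} \<delta> R Z) \<partial>Z_seq \<partial>R_seq)
      = (\<integral>\<^sup>+x. \<integral>\<^sup>+R. \<integral>\<^sup>+Z. f (bp_sum {1..d} \<delta> (case_nat x R) Z) \<partial>Z_seq \<partial>R_seq \<partial>M)"
      by (rule nn_integral_PiM_case_nat[OF symmD(1)[OF M] S3])
    also have "\<dots> = (\<integral>\<^sup>+x. \<integral>\<^sup>+R. \<integral>\<^sup>+z. \<integral>\<^sup>+Z. f (bp_sum {1..d} \<delta> (case_nat x R) (case_nat z Z))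
        \<partial>Z_seq \<partial>measure_pmf (flip_sign_pmf \<delta>) \<partial>R_seq \<partial>M)"
      by (intro nn_integral_cong nn_integral_PiM_case_nat measure_pmf.prob_space_axioms measurable_compose[OF S2 f])
        (simp only: spR UNIV_I)
    also have "\<dots> = (\<integral>\<^sup>+R. \<integral>\<^sup>+Z. f (bp_sum {..<d} \<delta> R Z) \<partial>Z_seq \<partial>R_seq)"
      using prob_space.emeasure_space_1[OF symmD(1)[OF M]]
      by (simp add: sum.atLeast1_atMost_eq measure_pmf.emeasure_space_1)
    finally show ?thesis .
  qed
  have "(\<integral>\<^sup>+x. f x \<partial>bp \<delta> P M) = (\<integral>\<^sup>+p. f ((\<lambda>(d, R, Z). bp_sum {1..d} \<delta> R Z) p) \<partial>(measure_pmf P \<Otimes>\<^sub>M R_seq \<Otimes>\<^sub>M Z_seq))"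
    unfolding bp_def by (rule nn_integral_distr[OF m]) (simp add: f)
  also have "\<dots> = (\<integral>\<^sup>+d. \<integral>\<^sup>+q. f ((\<lambda>(R, Z). bp_sum {1..d} \<delta> R Z) q) \<partial>(R_seq \<Otimes>\<^sub>M Z_seq) \<partial>measure_pmf P)"
    using measurable_compose[OF m f] by (subst RZ.nn_integral_fst[symmetric]) (simp_all add: split_beta')
  also have "\<dots> = (\<integral>\<^sup>+d. \<integral>\<^sup>+R. \<integral>\<^sup>+Z. f (bp_sum {1..d} \<delta> R Z) \<partial>Z_seq \<partial>R_seq \<partial>measure_pmf P)"
    using measurable_compose[OF bs f] by (intro nn_integral_cong) (subst Z.nn_integral_fst[symmetric], simp_all add: split_beta')
  also have "\<dots> = (\<integral>\<^sup>+d. \<integral>\<^sup>+x. f x \<partial>conv_pow (bsc \<delta> \<boxtimes> M) d \<partial>measure_pmf P)"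
    by (simp only: shift nn_integral_bp_sum[OF f])
  finally show ?thesis .
qed

lemma sets_bp [simp]: "sets (bp \<delta> P M) = sets borel" and space_bp [simp]: "space (bp \<delta> P M) = UNIV"
  by (simp_all add: bp_def)

lemma symm_conv_pow_bsc: "symm (conv_pow (bsc \<delta> \<boxtimes> M) d)"
  by (intro symm_conv_pow symm_bsc_box \<delta> M)

lemma prob_space_bp: "prob_space (bp \<delta> P M)"
proof
  have "emeasure (bp \<delta> P M) UNIV = (\<integral>\<^sup>+x. 1 \<partial>bp \<delta> P M)" by simp
  also have "\<dots> = (\<integral>\<^sup>+d. \<integral>\<^sup>+x. 1 \<partial>conv_pow (bsc \<delta> \<boxtimes> M) d \<partial>measure_pmf P)" by (rule nn_integral_bp) simp
  also have "\<dots> = 1"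
    using prob_space.emeasure_space_1[OF symmD(1)[OF symm_conv_pow_bsc]]
    by (simp add: measure_pmf.emeasure_space_1)
  finally show "emeasure (bp \<delta> P M) (space (bp \<delta> P M)) = 1" by simp
qed

lemma integral_bp:
  assumes f: "bounded_borel f"
  shows "(LINT x|(bp \<delta> P M). f x) = (LINT d|(measure_pmf P). (LINT x|(conv_pow (bsc \<delta> \<boxtimes> M) d). f x))"
proof -
  let ?C = "conv_pow (bsc \<delta> \<boxtimes> M)"
  interpret B: prob_space "bp \<delta> P M" by (rule prob_space_bp)
  have C: "prob_space (?C d)" "sets (?C d) = sets borel" for d by (rule symmD[OF symm_conv_pow_bsc])+
  obtain B where B: "\<And>x. \<bar>f x\<bar> \<le> B" using f by (auto simp: bounded_borel_def)
  \<comment> \<open>Adding the bound makes the function nonnegative, as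
    \<open>nn_integral_bp\<close> requires.\<close>
  define g where "g x = f x + B" for x
  have g: "0 \<le> g x" "\<bar>g x\<bar> \<le> 2 * B" for x using B[of x] by (auto simp: g_def)
  have [measurable]: "f \<in> borel_measurable borel" using f by (rule bounded_borel_measurable)
  have gm: "g \<in> borel_measurable borel" unfolding g_def by measurable
  have gb: "bounded_borel g" by (rule bounded_borelI[OF gm g(2)])
  have iC: "integrable (?C d) f" "integrable (?C d) g" for d
    by (intro bounded_borel_integrable C f gb)+
  have iB: "integrable (bp \<delta> P M) f" "integrable (bp \<delta> P M) g"
    by (intro bounded_borel_integrable prob_space_bp sets_bp f gb)+
  have CB: "(LINT x|(?C d). g x) = (LINT x|(?C d). f x) + B" for d
  proof -
    interpret prob_space "?C d" by (rule C)
    show ?thesis unfolding g_def using iC(1)[of d] prob_space by simp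
  qed
  have bd: "\<bar>\<integral>x. f x \<partial>?C d\<bar> \<le> B" for d
  proof -
    interpret prob_space "?C d" by (rule C)
    have "\<bar>\<integral>x. f x \<partial>?C d\<bar> \<le> (LINT x|(?C d). \<bar>f x\<bar>)" by (rule integral_abs_bound)
    also have "\<dots> \<le> (LINT x|(?C d). B)" using iC(1)[of d] B by (intro integral_mono) auto
    finally show ?thesis using prob_space by simp
  qed
  have iP: "integrable (measure_pmf P) (\<lambda>d. \<integral>x. f x \<partial>?C d)"
    using bd by (intro measure_pmf.integrable_const_bound[of _ B]) auto
  have "ennreal (LINT x|(bp \<delta> P M). g x) = (\<integral>\<^sup>+x. g x \<partial>bp \<delta> P M)"
    using iB g by (intro nn_integral_eq_integral[symmetric]) auto
  also have "\<dots> = (\<integral>\<^sup>+d. \<integral>\<^sup>+x. g x \<partial>?C d \<partial>measure_pmf P)"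
    using gm by (intro nn_integral_bp) auto
  also have "\<dots> = (\<integral>\<^sup>+d. ennreal (LINT x|(?C d). g x) \<partial>measure_pmf P)"
    using iC g by (intro nn_integral_cong nn_integral_eq_integral) auto
  also have "\<dots> = ennreal (LINT d|(measure_pmf P). (LINT x|(?C d). g x))"
  proof (rule nn_integral_eq_integral)
    show "integrable (measure_pmf P) (\<lambda>d. \<integral>x. g x \<partial>?C d)" unfolding CB using iP by simp
  qed (use g in \<open>auto intro: Bochner_Integration.integral_nonneg\<close>)
  finally have "(LINT x|(bp \<delta> P M). g x) = (LINT d|(measure_pmf P). (LINT x|(?C d). g x))"
    using g by (subst (asm) ennreal_inj) (auto intro!: Bochner_Integration.integral_nonneg)
  moreover have "(LINT x|(bp \<delta> P M). g x) = (LINT x|(bp \<delta> P M). f x) + B"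
    unfolding g_def using iB(1) B.prob_space by simp
  moreover have "(LINT d|(measure_pmf P). (LINT x|(?C d). g x)) = (LINT d|(measure_pmf P). (LINT x|(?C d). f x)) + B"
    unfolding CB using iP by simp
  ultimately show ?thesis by simp
qed

lemma symm_bp: "symm (bp \<delta> P M)"
  unfolding symm_def
  by (auto simp: prob_space_bp integral_bp bounded_borel_refl_avg symm_integral[OF symm_conv_pow_bsc, symmetric])

lemma stoploss_bp: "stoploss (bp \<delta> P M) t = (LINT d|(measure_pmf P). stoploss (conv_pow (bsc \<delta> \<boxtimes> M) d) t)"
  unfolding stoploss_def using integral_bp[OF bounded_borel_stoploss[of 1 t]] by simp

end

section \<open>Degradation from the stop-loss order\<close>

text \<open>Tent functions of the grid \<open>j / n\<close>: on the unit interval they are a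
  partition of unity that reproduces the identity and every hinge with its kink at a grid
  point.\<close>

definition hat :: "nat \<Rightarrow> nat \<Rightarrow> real \<Rightarrow> real" where
  "hat n j s = max 0 (1 - \<bar>real n * s - real j\<bar>)"

lemma hat_nonneg: "0 \<le> hat n j s" and hat_le_1: "hat n j s \<le> 1"
  by (simp_all add: hat_def)

lemma hat_measurable [measurable]: "hat n j \<in> borel_measurable borel"
  unfolding hat_def by measurable

definition cell :: "nat \<Rightarrow> real \<Rightarrow> nat" where
  "cell n s = nat \<lfloor>real n * s\<rfloor>"

lemma cell_bounds:
  assumes "0 \<le> s"
  shows "real (cell n s) \<le> real n * s" "real n * s < real (cell n s) + 1"
  using assms by (simp_all add: cell_def)

lemma cell_le: "s \<in> {0..1} \<Longrightarrow> cell n s \<le> n"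
proof -
  assume s: "s \<in> {0..1}"
  then have "real (cell n s) \<le> real n * 1" using cell_bounds(1)[of s n] mult_left_mono[of s 1 "real n"] by auto
  then show ?thesis by simp
qed

lemma sum_hat:
  fixes g :: "nat \<Rightarrow> real" and n :: nat
  assumes s: "s \<in> {0..1}"
  defines "i \<equiv> cell n s" and "r \<equiv> real n * s - real (cell n s)"
  shows "(\<Sum>j\<le>n. g j * hat n j s) = (1 - r) * g i + r * g (Suc i)"
proof -
  have b: "0 \<le> r" "r < 1" "i \<le> n" using cell_bounds[of s n] cell_le[of s n] s by (auto simp: i_def r_def)
  have h: "hat n j s = (if j = i then 1 - r else 0) + (if j = Suc i then r else 0)" for j
  proof -
    have e: "real n * s - real j = r + (real i - real j)" by (simp add: r_def i_def)
    consider "j = i" | "j = Suc i" | "j < i" | "Suc i < j" by linarith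
    then show ?thesis
    proof cases
      case 1
      then show ?thesis using b unfolding hat_def e by simp
    next
      case 2
      then show ?thesis using b unfolding hat_def e by simp
    next
      case 3
      then have "1 \<le> real i - real j" by simp
      then show ?thesis using b 3 unfolding hat_def e by auto
    next
      case 4
      then have "2 \<le> real j - real i" by simp
      then show ?thesis using b 4 unfolding hat_def e by auto
    qed
  qed
  have "(\<Sum>j\<le>n. g j * hat n j s) = (\<Sum>j\<le>n. (if j = i then (1 - r) * g i else 0)) + (\<Sum>j\<le>n. (if j = Suc i then r * g (Suc i) else 0))"
    unfolding h sum.distrib[symmetric] by (intro sum.cong) (auto simp: algebra_simps)
  also have "\<dots> = (1 - r) * g i + (if Suc i \<le> n then r * g (Suc i) else 0)" using b by simp
  \<comment> \<open>If \<open>Suc i\<close> leaves the grid, the remainder \<open>r\<close> is 0, so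
    nothing is lost.\<close>
  also have "(if Suc i \<le> n then r * g (Suc i) else 0) = r * g (Suc i)"
  proof (cases "Suc i \<le> n")
    case False
    then have "i = n" using b by simp
    then have "r \<le> 0" using s mult_left_mono[of s 1 "real n"] by (simp add: r_def i_def)
    then show ?thesis using b by simp
  qed simp
  finally show ?thesis .
qed

lemma sum_hat_1: "s \<in> {0..1} \<Longrightarrow> (\<Sum>j\<le>n. hat n j s) = 1"
  using sum_hat[of s "\<lambda>_. 1" n] by simp

lemma sum_hat_id: "s \<in> {0..1} \<Longrightarrow> (\<Sum>j\<le>n. real j * hat n j s) = real n * s"
  by (subst sum_hat) (auto simp: algebra_simps)

lemma sum_hat_call: "s \<in> {0..1} \<Longrightarrow> (\<Sum>j\<le>n. real (j - k) * hat n j s) = max 0 (real n * s - real k)"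
proof -
  assume s: "s \<in> {0..1}"
  show ?thesis
  proof (cases "cell n s < k")
    case True
    then have "real n * s < real k" using cell_bounds(2)[of s n] s by simp
    then show ?thesis using True by (subst sum_hat[OF s]) auto
  next
    case False
    then have "real k \<le> real n * s" using cell_bounds(1)[of s n] s by simp
    then show ?thesis using False by (subst sum_hat[OF s]) (auto simp: of_nat_diff Suc_diff_le algebra_simps)
  qed
qed

lemma cell_measurable [measurable]: "cell n \<in> borel \<rightarrow>\<^sub>M count_space UNIV"
  unfolding cell_def by measurable

lemma exists_transport_pmf:
  assumes T: "transport n b T" and i: "i \<le> n"
  shows "\<exists>p. set_pmf p \<subseteq> {..n} \<and> (\<forall>j. b i * pmf p j = T (i, j))"
proof (cases "b i = 0")
  case True
  have T0: "0 \<le> T x" for x using T unfolding transport_def by blast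
  have "(\<Sum>j\<le>n. T (i, j)) = 0" using T i True by (simp add: transport_def)
  then have "T (i, j) = 0" if "j \<le> n" for j using that T0 by (subst (asm) sum_nonneg_eq_0_iff) auto
  moreover have "T (i, j) = 0" if "n < j" for j using T that unfolding transport_def by blast
  ultimately have "T (i, j) = 0" for j by (cases "j \<le> n") auto
  \<comment> \<open>A row without mass constrains nothing; any law on the grid serves.\<close>
  then show ?thesis using True by (intro exI[of _ "return_pmf 0"]) auto
next
  case False
  have T0: "0 \<le> T x" for x using T unfolding transport_def by blast
  have row: "(\<Sum>j\<le>n. T (i, j)) = b i" using T i by (simp add: transport_def)
  then have "0 \<le> b i" using T0 by (metis sum_nonneg)
  then have b: "0 < b i" using False by simp
  have out: "T (i, j) = 0" if "n < j" for j using T that unfolding transport_def by blast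
  let ?f = "\<lambda>j. T (i, j) / b i"
  have f0: "0 \<le> ?f j" for j using T0 b by simp
  have "(\<integral>\<^sup>+j. ennreal (?f j) \<partial>count_space UNIV) = (\<Sum>j\<le>n. ennreal (?f j))"
    by (rule nn_integral_count_space') (auto simp: out not_le)
  also have "\<dots> = ennreal (\<Sum>j\<le>n. ?f j)" using f0 by (intro sum_ennreal) auto
  also have "(\<Sum>j\<le>n. ?f j) = 1" using row b by (simp add: sum_divide_distrib[symmetric])
  finally have s: "(\<integral>\<^sup>+j. ennreal (?f j) \<partial>count_space UNIV) = 1" by simp
  have "pmf (embed_pmf ?f) j = ?f j" for j by (rule pmf_embed_pmf[OF f0 s])
  moreover from this have "set_pmf (embed_pmf ?f) \<subseteq> {..n}"
    using out by (auto simp: set_pmf_iff intro!: leI)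
  ultimately show ?thesis using b by (intro exI[of _ "embed_pmf ?f"]) auto
qed

section \<open>The garbling kernel\<close>

lemma uminus_image_borel: "E \<in> sets borel \<Longrightarrow> uminus ` E \<in> sets (borel :: ereal measure)"
proof -
  assume [measurable]: "E \<in> sets borel"
  have "{x :: ereal. - x \<in> E} \<in> sets borel" by measurable
  moreover have "uminus ` E = {x. - x \<in> E}" by (auto intro!: image_eqI[of _ uminus "- _"])
  ultimately show ?thesis by simp
qed

lemma uminus_image_iff: "x \<in> uminus ` E \<longleftrightarrow> - x \<in> E" for x :: ereal
  by (auto intro!: image_eqI[of _ uminus "- x"])

lemma uminus_image_uminus: "uminus ` uminus ` E = E" for E :: "ereal set"
  by (auto simp: image_image)

lemma bounded_borel_indicator: "E \<in> sets borel \<Longrightarrow> bounded_borel (indicator E)"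
  by (rule bounded_borelI[of _ 1]) (auto simp: indicator_def)

text \<open>
  Here \<open>i\<close> is the grid cell of the magnitude and \<open>s\<close> the sign of the input.  The transport plan only
  guarantees that the mean bias transported to \<open>j\<close> is at least that of \<open>j\<close>; the sign noise with bias
  \<open>\<kappa> j\<close> burns the surplus.
\<close>

definition sign_kernel :: "(nat \<Rightarrow> nat pmf) \<Rightarrow> (nat \<Rightarrow> real) \<Rightarrow> (nat \<Rightarrow> ereal measure) \<Rightarrow> nat \<Rightarrow> int \<Rightarrow> ereal measure" where
  "sign_kernel p \<kappa> N i s =
    measure_pmf (bind_pmf (p i) (\<lambda>j. map_pmf (Pair j) (bernoulli_pmf ((1 - \<kappa> j * real_of_int s) / 2))))
      \<bind> (\<lambda>(j, flip). if flip then distr (N j) borel uminus else N j)"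

context
  fixes p :: "nat \<Rightarrow> nat pmf" and \<kappa> :: "nat \<Rightarrow> real" and N :: "nat \<Rightarrow> ereal measure"
  assumes N: "\<And>j. prob_space (N j)" "\<And>j. sets (N j) = sets borel" and \<kappa>: "\<And>j. \<bar>\<kappa> j\<bar> \<le> 1"
begin

lemma branch_in_space: "(case q of (j, flip) \<Rightarrow> if flip then distr (N j) borel uminus else N j) \<in> space (prob_algebra borel)"
proof -
  obtain j flip where q: "q = (j, flip)" by force
  have "uminus \<in> N j \<rightarrow>\<^sub>M borel" using N(2)[of j] by (simp cong: measurable_cong_sets)
  then have "prob_space (distr (N j) borel uminus)" by (intro prob_space.prob_space_distr N)
  then show ?thesis using N by (simp add: q space_prob_algebra)
qed

lemma branch_measurable:
  "(\<lambda>(j, flip). if flip then distr (N j) borel uminus else N j) \<in> measure_pmf q \<rightarrow>\<^sub>M prob_algebra borel"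
  using branch_in_space by (auto simp: measurable_def sets_measure_pmf)

lemma sign_kernel_in_space: "sign_kernel p \<kappa> N i s \<in> space (prob_algebra borel)"
proof -
  let ?q = "bind_pmf (p i) (\<lambda>j. map_pmf (Pair j) (bernoulli_pmf ((1 - \<kappa> j * real_of_int s) / 2)))"
  have "measure_pmf ?q \<in> space (prob_algebra (count_space UNIV))"
    by (simp add: space_prob_algebra measure_pmf.prob_space_axioms)
  then have "measure_pmf ?q \<bind> (\<lambda>(j, flip). if flip then distr (N j) borel uminus else N j) \<in> space (prob_algebra borel)"
    using branch_in_space
    by (intro measurable_space[OF measurable_bind_prob_space[of "\<lambda>_. measure_pmf ?q" "count_space UNIV :: unit measure" "count_space UNIV"], of _ _ "()"])
       (auto simp: measurable_def)
  then show ?thesis by (simp add: sign_kernel_def)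
qed

lemma measure_sign_kernel:
  assumes E: "E \<in> sets borel" and s: "\<bar>s\<bar> \<le> 1" and fin: "set_pmf (p i) \<subseteq> {..n}"
  shows "measure (sign_kernel p \<kappa> N i s) E = (\<Sum>j\<le>n. pmf (p i) j *
    ((1 + \<kappa> j * real_of_int s) / 2 * measure (N j) E + (1 - \<kappa> j * real_of_int s) / 2 * measure (N j) (uminus ` E)))"
proof -
  let ?B = "\<lambda>j. bernoulli_pmf ((1 - \<kappa> j * real_of_int s) / 2)"
  let ?q = "bind_pmf (p i) (\<lambda>j. map_pmf (Pair j) (?B j))"
  let ?br = "\<lambda>(j, flip). if flip then distr (N j) borel uminus else N j"
  have ks: "\<bar>\<kappa> j * real_of_int s\<bar> \<le> 1" for j
  proof -
    have "\<bar>real_of_int s\<bar> \<le> 1" using s by linarith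
    then show ?thesis unfolding abs_mult using \<kappa> by (intro mult_le_one) auto
  qed
  have pr: "0 \<le> (1 - \<kappa> j * real_of_int s) / 2" "(1 - \<kappa> j * real_of_int s) / 2 \<le> 1" for j
    using ks[of j] by (auto simp: abs_le_iff)
  have N': "measure (distr (N j) borel uminus) E = measure (N j) (uminus ` E)" for j
  proof -
    have "uminus \<in> N j \<rightarrow>\<^sub>M borel" using N(2)[of j] by (simp cong: measurable_cong_sets)
    moreover have "uminus -` E \<inter> space (N j) = uminus ` E"
      using sets_eq_imp_space_eq[OF N(2)[of j]] by (auto simp: uminus_image_iff)
    ultimately show ?thesis using E by (simp add: measure_distr)
  qed
  have le1: "\<bar>measure (?br x) E\<bar> \<le> 1" for x
    using branch_in_space[of x] by (auto simp: space_prob_algebra intro: prob_space.prob_le_1)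
  have "measure (sign_kernel p \<kappa> N i s) E = (LINT x|(measure_pmf ?q). measure (?br x) E)"
    unfolding sign_kernel_def by (rule measure_pmf.measure_bind[OF measurable_prob_algebraD[OF branch_measurable] E])
  also have "\<dots> = (\<Sum>j\<le>n. (LINT flip|(measure_pmf (?B j)). measure (?br (j, flip)) E) * pmf (p i) j)"
    using fin by (subst pmf_expectation_bind[of "{..n}"]) (auto simp: mult.commute)
  also have "\<dots> = (\<Sum>j\<le>n. pmf (p i) j *
    ((1 + \<kappa> j * real_of_int s) / 2 * measure (N j) E + (1 - \<kappa> j * real_of_int s) / 2 * measure (N j) (uminus ` E)))"
  proof (intro sum.cong refl)
    fix j
    have "(LINT flip|(measure_pmf (?B j)). measure (?br (j, flip)) E) =
      (1 + \<kappa> j * real_of_int s) / 2 * measure (N j) E + (1 - \<kappa> j * real_of_int s) / 2 * measure (N j) (uminus ` E)"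
      by (subst integral_bernoulli_pmf[OF pr]) (simp add: N' field_simps)
    then show "(LINT flip|(measure_pmf (?B j)). measure (?br (j, flip)) E) * pmf (p i) j = pmf (p i) j *
      ((1 + \<kappa> j * real_of_int s) / 2 * measure (N j) E + (1 - \<kappa> j * real_of_int s) / 2 * measure (N j) (uminus ` E))"
      by (simp only: mult.commute)
  qed
  finally show ?thesis .
qed

end

text \<open>
  The room \<open>1 / n\<close> pays for rounding biases down to the grid on the right.  On the left a bias is split
  between the two neighbouring grid points, which preserves the stop-loss function at grid points.
\<close>

lemma degraded_if_stoploss_grid:
  assumes L: "symm L" and R: "symm R" and n: "0 < n"
    and le: "\<And>k. k \<le> n \<Longrightarrow> stoploss L (real k / real n) = 0 \<or>
      stoploss L (real k / real n) + 1 / real n \<le> stoploss R (real k / real n)"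
  shows "L \<preceq>\<^sub>d R"
proof -
  interpret L: prob_space L by (rule symmD(1)[OF L])
  interpret R: prob_space R by (rule symmD(1)[OF R])
  note [measurable_cong] = symmD(2)[OF L] symmD(2)[OF R]
  note sp = symmD(3)[OF L] symmD(3)[OF R]
  define idx where "idx z = cell n (mag z)" for z
  \<comment> \<open>The sign 0 at zero bias reflects a constraint: there \<open>z = - z\<close>, so
    the kernel's value must itself be a symmetric law.\<close>
  define sg :: "ereal \<Rightarrow> int" where "sg z = (if 0 < tanh_half z then 1 else if tanh_half z < 0 then -1 else 0)" for z
  have th: "mag z \<in> {0..1}" for z by simp
  have idx_le: "idx z \<le> n" for z unfolding idx_def by (rule cell_le[OF th])
  have [measurable]: "idx \<in> borel \<rightarrow>\<^sub>M count_space UNIV" unfolding idx_def by measurable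
  have [measurable]: "sg \<in> borel \<rightarrow>\<^sub>M count_space UNIV" unfolding sg_def by measurable
  have [simp]: "idx (- z) = idx z" "sg (- z) = - sg z" for z by (auto simp: idx_def sg_def)
  define I :: "nat \<Rightarrow> ereal \<Rightarrow> real" where "I i z = of_bool (idx z = i)" for i z
  have [measurable]: "I i \<in> borel_measurable borel" for i unfolding I_def by measurable
  define b where "b i = (LINT z|R. I i z)" for i
  define a where "a j = (LINT x|L. hat n j (mag x))" for j
  have bI: "bounded_borel (\<lambda>z. c z * I i z)" if cb: "bounded_borel c" for c i
  proof -
    obtain B where "\<And>x. \<bar>c x\<bar> \<le> B" using cb by (auto simp: bounded_borel_def)
    then have "\<bar>c x * I i x\<bar> \<le> B" for x
      by (cases "idx x = i") (auto simp: I_def intro: order_trans[OF abs_ge_zero])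
    then show ?thesis using bounded_borel_measurable[OF cb, measurable] by (intro bounded_borelI[of _ B]) measurable
  qed
  have b1: "bounded_borel (\<lambda>_. c)" for c by (rule bounded_borelI[of _ "\<bar>c\<bar>"]) auto
  have bI1: "bounded_borel (I i)" for i using bI[OF b1[of 1], of i] by simp
  have iI: "integrable R (I i)" for i by (intro bounded_borel_integrable symmD[OF R] bI1)
  have bhat: "bounded_borel (\<lambda>x. hat n j (mag x) * g x)"
    if [measurable]: "g \<in> borel_measurable borel" and g: "\<And>x. \<bar>g x\<bar> \<le> 1" for j g
    using g hat_nonneg[of n j] hat_le_1[of n j]
    by (intro bounded_borelI[of _ 1]) (measurable, auto simp: abs_mult intro!: mult_le_one)
  have ihat: "integrable L (\<lambda>x. hat n j (mag x) * g x)"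
    if "g \<in> borel_measurable borel" "\<And>x. \<bar>g x\<bar> \<le> 1" for j g
    using that by (intro bounded_borel_integrable symmD[OF L] bhat)
  have ihat1: "integrable L (\<lambda>x. hat n j (mag x))" for j using ihat[of "\<lambda>_. 1" j] by simp
  have sumI: "(\<Sum>i\<le>n. g i * I i z) = g (idx z)" for g z
    using idx_le[of z] by (simp add: I_def of_bool_def if_distrib cong: if_cong)

  have a0: "0 \<le> a j" for j unfolding a_def by (rule Bochner_Integration.integral_nonneg) (rule hat_nonneg)
  have b0: "0 \<le> b i" for i unfolding b_def by (rule Bochner_Integration.integral_nonneg) (simp add: I_def)
  have "(\<Sum>j\<le>n. a j) = (LINT x|L. (\<Sum>j\<le>n. hat n j (mag x)))"
    unfolding a_def using ihat1 by (intro Bochner_Integration.integral_sum[symmetric]) auto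
  also have "\<dots> = 1" using L.prob_space by (simp add: sum_hat_1[OF th])
  finally have a1: "(\<Sum>j\<le>n. a j) = 1" .
  have "(\<Sum>i\<le>n. b i) = (LINT z|R. (\<Sum>i\<le>n. I i z))"
    unfolding b_def using iI by (intro Bochner_Integration.integral_sum[symmetric]) auto
  also have "\<dots> = 1" using R.prob_space sumI[of "\<lambda>_. 1"] by simp
  finally have b1': "(\<Sum>i\<le>n. b i) = 1" .
  have scale: "max 0 (real n * s - real k) = real n * max 0 (s - real k / real n)" for s k
  proof -
    have "real n * (s - real k / real n) = real n * s - real k" using n by (simp add: field_simps)
    then show ?thesis using mult_max_zero[of "real n" "s - real k / real n"] by simp
  qed
  have call_a: "call n a k = real n * stoploss L (real k / real n)" for k
  proof -
    have "call n a k = (LINT x|L. (\<Sum>j\<le>n. real (j - k) * hat n j (mag x)))"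
      unfolding call_def a_def using ihat1 by (subst Bochner_Integration.integral_sum) auto
    also have "\<dots> = real n * stoploss L (real k / real n)"
      by (simp only: sum_hat_call[OF th] scale) (simp add: stoploss_def)
    finally show ?thesis .
  qed
  have call_b: "real n * stoploss R (real k / real n) - 1 \<le> call n b k" for k
  proof -
    have "real n * stoploss R (real k / real n) - 1 = (LINT z|R. real n * max 0 (mag z - real k / real n) - 1)"
      unfolding stoploss_def using integrable_stoploss1[OF R] R.prob_space by simp
    also have "\<dots> \<le> (LINT z|R. (\<Sum>i\<le>n. real (i - k) * I i z))"
    proof (rule integral_mono)
      show "integrable R (\<lambda>z. real n * max 0 (mag z - real k / real n) - 1)"
        using integrable_stoploss1[OF R] by simp
      show "integrable R (\<lambda>z. \<Sum>i\<le>n. real (i - k) * I i z)" using iI by simp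
      fix z
      have "real n * mag z < real (idx z) + 1" unfolding idx_def by (rule cell_bounds) simp
      then have "max 0 (real n * mag z - real k) - 1 \<le> real (idx z - k)" by (simp add: max_def)
      then show "real n * max 0 (mag z - real k / real n) - 1 \<le> (\<Sum>i\<le>n. real (i - k) * I i z)"
        by (simp only: sumI scale)
    qed
    also have "\<dots> = call n b k"
      unfolding call_def b_def using iI by (subst Bochner_Integration.integral_sum) auto
    finally show ?thesis .
  qed
  have call_b0: "0 \<le> call n b k" for k unfolding call_def using b0 by (intro sum_nonneg) auto
  have "call n a k \<le> call n b k" for k
  proof (cases "k \<le> n")
    case True
    from le[OF True] show ?thesis
    proof
      assume "stoploss L (real k / real n) = 0"
      then show ?thesis using call_a[of k] call_b0[of k] by simp
    next
      assume "stoploss L (real k / real n) + 1 / real n \<le> stoploss R (real k / real n)"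
      then have "real n * (stoploss L (real k / real n) + 1 / real n) \<le> real n * stoploss R (real k / real n)"
        by (rule mult_left_mono) simp
      then show ?thesis using call_a[of k] call_b[of k] n by (simp add: distrib_left)
    qed
  qed (simp add: call_ge)
  then obtain T where T: "transport n b T" and Ta: "\<And>j. j \<le> n \<Longrightarrow> target n T j = a j"
    using finite_strassen[of n a b] a0 b0 a1 b1' by metis
  obtain p where p: "\<And>i. i \<le> n \<Longrightarrow> set_pmf (p i) \<subseteq> {..n}" "\<And>i j. i \<le> n \<Longrightarrow> b i * pmf (p i) j = T (i, j)"
    using exists_transport_pmf[OF T] by metis

  \<comment> \<open>The bias held by cell \<open>i\<close>, without rounding. By symmetry it is also
    the mean of the sign there (\<open>e_sg\<close>), that is, the sign information on which the
    kernel can draw.\<close>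
  define e where "e i = (LINT z|R. mag z * I i z)" for i
  have bth: "bounded_borel (\<lambda>z. mag z)" by (rule bounded_borelI[of _ 1]) auto
  have bsg: "bounded_borel (\<lambda>z. real_of_int (sg z))" by (rule bounded_borelI[of _ 1]) (measurable, auto simp: sg_def)
  have isg: "integrable R (\<lambda>z. real_of_int (sg z) * I i z)" for i
    by (intro bounded_borel_integrable symmD[OF R] bI bsg)
  have e_sg: "(LINT z|R. real_of_int (sg z) * I i z) = e i" for i
  proof -
    have "(LINT z|R. real_of_int (sg z) * I i z) = (LINT z|R. refl_avg (\<lambda>z. real_of_int (sg z) * I i z) z)"
      by (rule symm_integral[OF R bI[OF bsg]])
    also have "\<dots> = e i"
      unfolding e_def by (intro Bochner_Integration.integral_cong refl) (auto simp: refl_avg_def I_def sg_def field_simps)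
    finally show ?thesis .
  qed
  have e_ge: "real i * b i \<le> real n * e i" for i
  proof -
    have "real i * b i = (LINT z|R. real i * I i z)" unfolding b_def by simp
    also have "\<dots> \<le> (LINT z|R. real n * (mag z * I i z))"
    proof (rule integral_mono)
      show "integrable R (\<lambda>z. real i * I i z)" using iI by simp
      show "integrable R (\<lambda>z. real n * (mag z * I i z))"
        by (intro integrable_mult_right bounded_borel_integrable symmD[OF R] bI bth)
      show "real i * I i z \<le> real n * (mag z * I i z)" for z
        using cell_bounds(1)[of "mag z" n] by (auto simp: I_def idx_def)
    qed
    also have "\<dots> = real n * e i" unfolding e_def by simp
    finally show ?thesis .
  qed
  have e0: "0 \<le> e i" for i unfolding e_def by (rule Bochner_Integration.integral_nonneg) (simp add: I_def)
  define H where "H j = (\<Sum>i\<le>n. pmf (p i) j * e i)" for j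
  have H0: "0 \<le> H j" for j unfolding H_def using e0 by (intro sum_nonneg) auto
  have H_ge: "real j * a j / real n \<le> H j" if j: "j \<le> n" for j
  proof -
    have "0 \<le> (\<Sum>i\<le>n. (real i - real j) * T (i, j))" using T j by (simp add: transport_def)
    also have "\<dots> = (\<Sum>i\<le>n. real i * T (i, j)) - real j * a j"
      unfolding Ta[OF j, symmetric] target_def by (simp add: left_diff_distrib sum_subtractf sum_distrib_left)
    finally have "real j * a j \<le> (\<Sum>i\<le>n. real i * T (i, j))" by simp
    also have "\<dots> = (\<Sum>i\<le>n. pmf (p i) j * (real i * b i))"
      by (intro sum.cong refl) (simp add: p(2)[symmetric])
    also have "\<dots> \<le> (\<Sum>i\<le>n. pmf (p i) j * (real n * e i))"
      using e_ge by (intro sum_mono mult_left_mono) auto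
    also have "\<dots> = real n * H j" unfolding H_def by (simp add: sum_distrib_left mult_ac)
    finally show ?thesis using n by (simp add: divide_le_eq mult.commute)
  qed
  \<comment> \<open>\<open>H j\<close> is the bias that arrives at \<open>j\<close>, and
    \<open>j * a j / n\<close> is the bias wanted there; the barycentre condition, in the form
    \<open>H_ge\<close>, makes the quotient at most 1. If \<open>H j = 0\<close> then nothing is
    wanted either.\<close>
  define \<kappa> where "\<kappa> j = (if j \<le> n \<and> H j \<noteq> 0 then real j * a j / real n / H j else 0)" for j
  have \<kappa>1: "\<bar>\<kappa> j\<bar> \<le> 1" for j
  proof (cases "j \<le> n \<and> H j \<noteq> 0")
    case True
    then have "0 < H j" using H0[of j] by (simp add: less_le)
    moreover have "0 \<le> real j * a j / real n" using a0 by simp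
    moreover have "real j * a j / real n \<le> H j" using H_ge True by blast
    moreover have "\<bar>u / w\<bar> \<le> 1" if "0 < w" "0 \<le> u" "u \<le> w" for u w :: real using that by simp
    ultimately show ?thesis using True by (simp only: \<kappa>_def if_True simp_thms)
  next
    case False
    then show ?thesis by (auto simp: \<kappa>_def)
  qed
  have \<kappa>H: "\<kappa> j * H j = real j * a j / real n" if j: "j \<le> n" for j
  proof (cases "H j = 0")
    case True
    have "0 \<le> real j * a j / real n" using a0 by simp
    then show ?thesis using H_ge[OF j] True by simp
  qed (use j in \<open>simp add: \<kappa>_def\<close>)

  have abs_m [measurable]: "(\<lambda>x::ereal. \<bar>x\<bar>) \<in> borel_measurable borel" by measurable
  \<comment> \<open>The law of \<open>\<bar>x\<bar>\<close> under \<open>L\<close> given that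
    \<open>x\<close> was assigned to grid point \<open>j\<close>: it restores exact magnitudes after
    the discrete step. A grid point without mass gets an arbitrary law.\<close>
  define N where "N j = (if a j = 0 then return borel 0 else
    distr (density L (\<lambda>x. ennreal (hat n j (mag x) / a j))) borel abs)" for j
  have nn_hat: "(\<integral>\<^sup>+x. ennreal (hat n j (mag x) * g x / a j) \<partial>L) = ennreal ((LINT x|L. hat n j (mag x) * g x) / a j)"
    if g: "g \<in> borel_measurable borel" "\<And>x. 0 \<le> g x" "\<And>x. g x \<le> 1" for j and g :: "ereal \<Rightarrow> real"
  proof -
    have "integrable L (\<lambda>x. hat n j (mag x) * g x / a j)" using ihat[of g j] g by simp
    then have "(\<integral>\<^sup>+x. ennreal (hat n j (mag x) * g x / a j) \<partial>L) = ennreal (LINT x|L. hat n j (mag x) * g x / a j)"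
      using a0 g hat_nonneg by (intro nn_integral_eq_integral) auto
    then show ?thesis by simp
  qed
  have N: "prob_space (N j)" "sets (N j) = sets borel" for j
  proof -
    show "prob_space (N j)"
    proof (cases "a j = 0")
      case False
      have "prob_space (density L (\<lambda>x. ennreal (hat n j (mag x) / a j)))"
      proof
        show "emeasure (density L (\<lambda>x. ennreal (hat n j (mag x) / a j))) (space (density L (\<lambda>x. ennreal (hat n j (mag x) / a j)))) = 1"
          using nn_hat[of "\<lambda>_. 1" j] False by (simp add: emeasure_density a_def)
      qed
      then show ?thesis using False unfolding N_def by (simp add: prob_space.prob_space_distr)
    qed (simp add: N_def prob_space_return)
  qed (simp add: N_def)
  have NE: "a j * measure (N j) E = (LINT x|L. hat n j (mag x) * indicator E \<bar>x\<bar>)"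
    if [measurable]: "E \<in> sets borel" for j E
  proof -
    have g: "(\<lambda>x::ereal. indicator E \<bar>x\<bar> :: real) \<in> borel_measurable borel" by measurable
    have nonneg: "0 \<le> (LINT x|L. hat n j (mag x) * indicator E \<bar>x\<bar>)"
      using hat_nonneg by (intro Bochner_Integration.integral_nonneg) auto
    show ?thesis
    proof (cases "a j = 0")
      case True
      have "(LINT x|L. hat n j (mag x) * indicator E \<bar>x\<bar>) \<le> a j"
        unfolding a_def using hat_nonneg[of n j] by (intro integral_mono ihat[OF g] ihat1) (auto simp: indicator_def)
      then show ?thesis using True nonneg by simp
    next
      case False
      have "emeasure (N j) E = (\<integral>\<^sup>+x. ennreal (hat n j (mag x) / a j) * indicator (abs -` E) x \<partial>L)"
      proof -
        have "abs -` E \<inter> space L \<in> sets L" by measurable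
        then have "abs -` E \<in> sets L" by (simp add: sp)
        then show ?thesis using False by (simp add: N_def emeasure_distr emeasure_density sp)
      qed
      also have "\<dots> = (\<integral>\<^sup>+x. ennreal (hat n j (mag x) * indicator E \<bar>x\<bar> / a j) \<partial>L)"
        by (intro nn_integral_cong) (auto simp: indicator_def)
      also have "\<dots> = ennreal ((LINT x|L. hat n j (mag x) * indicator E \<bar>x\<bar>) / a j)"
        by (rule nn_hat[OF g]) (auto simp: indicator_def)
      finally have "measure (N j) E = (LINT x|L. hat n j (mag x) * indicator E \<bar>x\<bar>) / a j"
        using nonneg a0[of j] by (simp add: measure_def)
      then show ?thesis using False by simp
    qed
  qed

  define K where "K z = sign_kernel p \<kappa> N (idx z) (sg z)" for z
  note sk = measure_sign_kernel[where N = N and \<kappa> = \<kappa>, OF N \<kappa>1]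
  have Ksp: "K z \<in> space (prob_algebra borel)" for z
    unfolding K_def by (rule sign_kernel_in_space[where N = N and \<kappa> = \<kappa>, OF N \<kappa>1])
  have Km: "K \<in> borel \<rightarrow>\<^sub>M prob_algebra borel"
    unfolding K_def
  proof (rule measurable_compose_countable[of "\<lambda>i z. sign_kernel p \<kappa> N i (sg z)"])
    show "(\<lambda>z. sign_kernel p \<kappa> N i (sg z)) \<in> borel \<rightarrow>\<^sub>M prob_algebra borel" for i
      by (rule measurable_compose_countable[of "\<lambda>s z. sign_kernel p \<kappa> N i s"])
        (auto intro: measurable_const sign_kernel_in_space[where N = N and \<kappa> = \<kappa>, OF N \<kappa>1])
  qed measurable
  have sg1: "\<bar>sg z\<bar> \<le> 1" for z by (simp add: sg_def)
  have measK: "measure (K z) E = (\<Sum>j\<le>n. pmf (p (idx z)) j *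
    ((1 + \<kappa> j * real_of_int (sg z)) / 2 * measure (N j) E + (1 - \<kappa> j * real_of_int (sg z)) / 2 * measure (N j) (uminus ` E)))"
    if "E \<in> sets borel" for z E
    unfolding K_def by (rule sk[where p = p and i = "idx z", OF that sg1 p(1)[OF idx_le]])
  have probK: "prob_space (K z)" for z using Ksp[of z] by (simp add: space_prob_algebra)
  have sym: "emeasure (K (- z)) (uminus ` E) = emeasure (K z) E" if E: "E \<in> sets borel" for z E
  proof -
    interpret K1: prob_space "K z" by (rule probK)
    interpret K2: prob_space "K (- z)" by (rule probK)
    have "measure (K (- z)) (uminus ` E) = measure (K z) E"
      unfolding measK[OF E] measK[OF uminus_image_borel[OF E]]
      by (intro sum.cong refl) (simp add: uminus_image_uminus algebra_simps)
    then show ?thesis by (simp add: K1.emeasure_eq_measure K2.emeasure_eq_measure)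
  qed
  have "L = R \<bind> K"
  proof (rule measure_eqI)
    have KR: "K \<in> R \<rightarrow>\<^sub>M prob_algebra borel" using Km by simp
    have KS: "K \<in> R \<rightarrow>\<^sub>M subprob_algebra borel" by (rule measurable_prob_algebraD[OF KR])
    show st: "sets L = sets (R \<bind> K)"
      using sets_bind[of R K borel] Ksp sp by (simp add: space_prob_algebra symmD(2)[OF L])
    fix E assume "E \<in> sets L"
    then have E[measurable]: "E \<in> sets borel" using symmD(2)[OF L] by simp
    have E'[measurable]: "uminus ` E \<in> sets borel" by (rule uminus_image_borel[OF E])
    \<comment> \<open>The parts of \<open>N j\<close> that are even and odd under reflection. The
      transported mass governs the even part, the surviving sign bias the odd one.\<close>
    define u where "u j = (measure (N j) E + measure (N j) (uminus ` E)) / 2" for j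
    define v where "v j = (measure (N j) E - measure (N j) (uminus ` E)) / 2" for j
    have "measure (R \<bind> K) E = (LINT z|R. measure (K z) E)"
      by (rule R.measure_bind[OF KS E])
    also have "\<dots> = (LINT z|R. (\<Sum>i\<le>n. \<Sum>j\<le>n. (pmf (p i) j * u j) * I i z + (pmf (p i) j * \<kappa> j * v j) * (real_of_int (sg z) * I i z)))"
    proof (intro Bochner_Integration.integral_cong refl)
      fix z
      have "measure (K z) E = (\<Sum>j\<le>n. pmf (p (idx z)) j * (u j + \<kappa> j * real_of_int (sg z) * v j))"
        unfolding measK[OF E] u_def v_def by (intro sum.cong refl) (simp add: field_simps)
      also have "\<dots> = (\<Sum>i\<le>n. (\<Sum>j\<le>n. pmf (p i) j * (u j + \<kappa> j * real_of_int (sg z) * v j)) * I i z)"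
        by (simp only: sumI)
      also have "\<dots> = (\<Sum>i\<le>n. \<Sum>j\<le>n. (pmf (p i) j * u j) * I i z + (pmf (p i) j * \<kappa> j * v j) * (real_of_int (sg z) * I i z))"
        unfolding sum_distrib_right by (intro sum.cong refl) (simp add: algebra_simps)
      finally show "measure (K z) E = (\<Sum>i\<le>n. \<Sum>j\<le>n. (pmf (p i) j * u j) * I i z + (pmf (p i) j * \<kappa> j * v j) * (real_of_int (sg z) * I i z))" .
    qed
    also have "\<dots> = (\<Sum>i\<le>n. \<Sum>j\<le>n. (pmf (p i) j * u j) * b i + (pmf (p i) j * \<kappa> j * v j) * e i)"
      using iI isg by (simp add: b_def e_sg)
    also have "\<dots> = (\<Sum>j\<le>n. \<Sum>i\<le>n. (pmf (p i) j * u j) * b i + (pmf (p i) j * \<kappa> j * v j) * e i)"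
      by (rule sum.swap)
    also have "\<dots> = (\<Sum>j\<le>n. u j * a j + v j * (real j * a j / real n))"
    proof (intro sum.cong refl)
      fix j assume "j \<in> {..n}"
      then have j: "j \<le> n" by simp
      have "(\<Sum>i\<le>n. (pmf (p i) j * u j) * b i + (pmf (p i) j * \<kappa> j * v j) * e i) =
        u j * (\<Sum>i\<le>n. b i * pmf (p i) j) + v j * (\<kappa> j * H j)"
        unfolding H_def by (simp add: sum.distrib sum_distrib_left mult_ac)
      also have "(\<Sum>i\<le>n. b i * pmf (p i) j) = a j"
        using Ta[OF j] by (simp add: p(2) target_def)
      finally show "(\<Sum>i\<le>n. (pmf (p i) j * u j) * b i + (pmf (p i) j * \<kappa> j * v j) * e i) = u j * a j + v j * (real j * a j / real n)"
        by (simp only: \<kappa>H[OF j])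
    qed
    also have "\<dots> = (\<Sum>j\<le>n. (1 + real j / real n) / 2 * (a j * measure (N j) E) + (1 - real j / real n) / 2 * (a j * measure (N j) (uminus ` E)))"
    proof (intro sum.cong refl)
      fix j
      have "(x + y) / 2 * A + (x - y) / 2 * (r * A) = (1 + r) / 2 * (A * x) + (1 - r) / 2 * (A * y)" for x y A r :: real
        by (simp add: field_simps)
      from this[of "measure (N j) E" "measure (N j) (uminus ` E)" "a j" "real j / real n"]
      show "u j * a j + v j * (real j * a j / real n) =
        (1 + real j / real n) / 2 * (a j * measure (N j) E) + (1 - real j / real n) / 2 * (a j * measure (N j) (uminus ` E))"
        by (simp add: u_def v_def)
    qed
    also have "\<dots> = (LINT x|L. (\<Sum>j\<le>n. (1 + real j / real n) / 2 * (hat n j (mag x) * indicator E \<bar>x\<bar>)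
        + (1 - real j / real n) / 2 * (hat n j (mag x) * indicator (uminus ` E) \<bar>x\<bar>)))"
    proof -
      have "integrable L (\<lambda>x. hat n j (mag x) * indicator F \<bar>x\<bar>)" if [measurable]: "F \<in> sets borel" for j F
        by (rule ihat) (auto simp: indicator_def)
      then show ?thesis by (simp add: NE E E')
    qed
    \<comment> \<open>\<open>sum_hat_1\<close> reassembles the even part, and
      \<open>sum_hat_id\<close> turns the grid bias \<open>j / n\<close> back into the exact bias of
      \<open>x\<close>.\<close>
    also have "\<dots> = (LINT x|L. refl_avg (indicator E) x)"
    proof (intro Bochner_Integration.integral_cong refl)
      fix x
      let ?s = "mag x" and ?A = "indicator E \<bar>x\<bar> :: real" and ?B = "indicator (uminus ` E) \<bar>x\<bar> :: real"
      have "(\<Sum>j\<le>n. (1 + real j / real n) / 2 * (hat n j ?s * ?A) + (1 - real j / real n) / 2 * (hat n j ?s * ?B))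
        = (\<Sum>j\<le>n. hat n j ?s) * ((?A + ?B) / 2) + (\<Sum>j\<le>n. real j * hat n j ?s) * ((?A - ?B) / (2 * real n))"
        unfolding sum_distrib_right sum.distrib[symmetric] using n by (intro sum.cong refl) (simp add: field_simps)
      also have "\<dots> = (1 + ?s) / 2 * ?A + (1 - ?s) / 2 * ?B"
        unfolding sum_hat_1[OF th] sum_hat_id[OF th] using n by (simp add: field_simps)
      also have "\<dots> = refl_avg (indicator E) x"
      proof -
        have B: "?B = indicator E (- \<bar>x\<bar>)" by (simp add: indicator_def uminus_image_iff)
        show ?thesis
        proof (cases "0 \<le> x")
          case True
          then have "0 \<le> tanh_half x" using tanh_half_neg_iff[of x] by (simp add: not_less[symmetric])
          then show ?thesis unfolding B refl_avg_def using True by simp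
        next
          case False
          then have "tanh_half x < 0" using tanh_half_neg_iff[of x] by simp
          moreover have "\<bar>x\<bar> = - x" using False by simp
          ultimately show ?thesis unfolding B refl_avg_def by simp
        qed
      qed
      finally show "(\<Sum>j\<le>n. (1 + real j / real n) / 2 * (hat n j ?s * ?A) + (1 - real j / real n) / 2 * (hat n j ?s * ?B)) = refl_avg (indicator E) x" .
    qed
    also have "\<dots> = (LINT x|L. indicator E x)"
      by (rule symm_integral[OF L bounded_borel_indicator[OF E], symmetric])
    also have "\<dots> = measure L E" using \<open>E \<in> sets L\<close> by simp
    finally have "measure (R \<bind> K) E = measure L E" .
    moreover have "prob_space (R \<bind> K)"
      by (rule R.prob_space_bind[OF _ KS]) (simp add: probK)
    ultimately show "emeasure L E = emeasure (R \<bind> K) E"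
      by (simp add: L.emeasure_eq_measure finite_measure.emeasure_eq_measure[OF prob_space.finite_measure])
  qed
  then show ?thesis unfolding degraded_def using Km sym by blast
qed

lemma strictly_degraded_if_stoploss_gap:
  assumes L: "symm L" and R: "symm R" and \<epsilon>: "0 < \<epsilon>"
    and gap: "\<And>t. 0 \<le> t \<Longrightarrow> stoploss L t = 0 \<or> stoploss L t + \<epsilon> \<le> stoploss R t"
  shows "L \<prec>\<^sub>d R"
proof -
  \<comment> \<open>The room \<open>\<epsilon>\<close> is halved: noise \<open>\<phi>\<close> lowers
    stop-loss functions by at most \<open>2 * \<phi> \<le> \<epsilon> / 2\<close>, and the grid
    takes \<open>1 / n \<le> \<epsilon> / 2\<close>.\<close>
  define \<phi> where "\<phi> = min (\<epsilon> / 4) (1 / 2)"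
  have \<phi>: "0 < \<phi>" "\<phi> \<le> 1 / 2" "4 * \<phi> \<le> \<epsilon>" using \<epsilon> by (auto simp: \<phi>_def min_def)
  have \<phi>01: "\<phi> \<in> {0..1}" using \<phi> by simp
  interpret R: prob_space R by (rule symmD(1)[OF R])
  have noise: "stoploss R t - 2 * \<phi> \<le> stoploss (bsc \<phi> \<boxtimes> R) t" for t
  proof -
    have "stoploss R t - 2 * \<phi> = (LINT x|R. max 0 (mag x - t) - 2 * \<phi>)"
      unfolding stoploss_def using integrable_stoploss1[OF R] R.prob_space by simp
    also have "\<dots> \<le> (LINT x|R. max 0 (\<bar>(1 - 2 * \<phi>) * tanh_half x\<bar> - t))"
    proof (rule integral_mono)
      show "integrable R (\<lambda>x. max 0 (mag x - t) - 2 * \<phi>)" using integrable_stoploss1[OF R] by simp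
      show "integrable R (\<lambda>x. max 0 (\<bar>(1 - 2 * \<phi>) * tanh_half x\<bar> - t))" by (rule integrable_stoploss[OF R])
      fix x
      have "2 * \<phi> * mag x \<le> 2 * \<phi>" using \<phi> by (intro mult_left_le) auto
      moreover have "\<bar>(1 - 2 * \<phi>) * tanh_half x\<bar> = mag x - 2 * \<phi> * mag x"
      proof -
        have "\<bar>1 - 2 * \<phi>\<bar> = 1 - 2 * \<phi>" using \<phi> by simp
        then show ?thesis unfolding abs_mult[of "1 - 2 * \<phi>"] by (simp add: algebra_simps)
      qed
      moreover have "max 0 (u - t) - w \<le> max 0 (v - t)" if "u \<le> v + w" "0 \<le> w" for u v w :: real
        using that by (auto simp: max_def)
      ultimately show "max 0 (mag x - t) - 2 * \<phi> \<le> max 0 (\<bar>(1 - 2 * \<phi>) * tanh_half x\<bar> - t)"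
        using \<phi> by simp
    qed
    also have "\<dots> = stoploss (bsc \<phi> \<boxtimes> R) t" by (rule stoploss_bsc_box[OF \<phi>01 R, symmetric])
    finally show ?thesis .
  qed
  obtain n where n: "2 / \<epsilon> < real n" using reals_Archimedean2 by blast
  have n0: "0 < n" using n \<epsilon> by (cases n) (auto simp: divide_less_0_iff)
  have n1: "1 / real n \<le> \<epsilon> / 2"
  proof -
    have "2 < \<epsilon> * real n" using n \<epsilon> by (simp add: divide_less_eq mult.commute)
    then show ?thesis using n0 by (simp add: divide_le_eq)
  qed
  have "L \<preceq>\<^sub>d bsc \<phi> \<boxtimes> R"
  proof (rule degraded_if_stoploss_grid[OF L symm_bsc_box[OF \<phi>01 R] n0])
    fix k
    show "stoploss L (real k / real n) = 0 \<or> stoploss L (real k / real n) + 1 / real n \<le> stoploss (bsc \<phi> \<boxtimes> R) (real k / real n)"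
      using gap[of "real k / real n"] noise[of "real k / real n"] n1 \<phi> by auto
  qed
  then show ?thesis unfolding strictly_degraded_def using \<phi> by auto
qed

section \<open>Strict comparison\<close>

text \<open>The difference is continuous on a compact interval, so its minimum is a uniform gap.
  This is why strictness is required at \<open>t1\<close> too, where the left side is already
  0.\<close>

lemma strictly_degraded_if_stoploss_less:
  assumes L: "symm L" and R: "symm R" and t1: "0 \<le> t1" "stoploss L t1 = 0"
    and less: "\<And>t. t \<in> {0..t1} \<Longrightarrow> stoploss L t < stoploss R t"
  shows "L \<prec>\<^sub>d R"
proof -
  have cont: "continuous_on {0..t1} (stoploss M)" if "symm M" for M
  proof (rule lipschitz_on_continuous_on[of 1], rule lipschitz_onI)
    fix s t
    show "dist (stoploss M s) (stoploss M t) \<le> 1 * dist s t"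
      using stoploss_antimono[OF that, of s t] stoploss_antimono[OF that, of t s]
        stoploss_lipschitz[OF that, of s t] stoploss_lipschitz[OF that, of t s]
      by (cases "s \<le> t") (auto simp: dist_real_def)
  qed simp
  have "\<exists>t0\<in>{0..t1}. \<forall>t\<in>{0..t1}. stoploss R t0 - stoploss L t0 \<le> stoploss R t - stoploss L t"
    using t1 by (intro continuous_attains_inf continuous_on_diff cont L R) auto
  then obtain t0 where t0: "t0 \<in> {0..t1}" "\<And>t. t \<in> {0..t1} \<Longrightarrow> stoploss R t0 - stoploss L t0 \<le> stoploss R t - stoploss L t"
    by blast
  show ?thesis
  proof (rule strictly_degraded_if_stoploss_gap[OF L R])
    show "0 < stoploss R t0 - stoploss L t0" using less[OF t0(1)] by simp
    fix t :: real assume "0 \<le> t"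
    show "stoploss L t = 0 \<or> stoploss L t + (stoploss R t0 - stoploss L t0) \<le> stoploss R t"
    proof (cases "t \<le> t1")
      case True
      then show ?thesis using t0(2)[of t] \<open>0 \<le> t\<close> by simp
    next
      case False
      then show ?thesis using stoploss_antimono[OF L, of t1 t] stoploss_nonneg[of L t] t1 by simp
    qed
  qed
qed

text \<open>The degenerate case of vanishing bias on the left, where the gap condition asks nothing
  of the right.\<close>

lemma strictly_degraded_if_stoploss_zero:
  assumes L: "symm L" and R: "symm R" and z: "\<And>t. 0 \<le> t \<Longrightarrow> stoploss L t = 0"
  shows "L \<prec>\<^sub>d R"
  by (rule strictly_degraded_if_stoploss_gap[OF L R, of 1]) (use z in auto)

lemma conv_pow_return_zero: "conv_pow (return borel 0) d = return borel 0"
  by (induction d) (simp_all add: add_conv_return_zero symm_return_zero)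

lemma max_bias_stoploss_conv_pow:
  assumes N: "symm N" "max_bias N m" and t: "0 \<le> t" "tpow m d \<le> t"
  shows "stoploss (conv_pow N d) t = 0"
proof (cases d)
  case 0
  then show ?thesis using t by (simp add: stoploss_return_zero)
next
  case (Suc k)
  show ?thesis
  proof (cases "m = 0")
    case True
    have "stoploss_le N (return borel 0)"
      unfolding stoploss_le_def using max_bias_stoploss_eq_0[OF N] True by (simp add: stoploss_return_zero)
    then have "stoploss_le (conv_pow N d) (return borel 0)"
      using conv_pow_mono[OF N(1) symm_return_zero, of d] by (simp add: conv_pow_return_zero)
    then show ?thesis
      using stoploss_leD[of "conv_pow N d" "return borel 0" t] t stoploss_nonneg[of "conv_pow N d" t]
      by (simp add: stoploss_return_zero)
  next
    case False
    then have "max_bias (conv_pow N d) (tpow m d)"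
      unfolding Suc using N by (intro max_bias_conv_pow) (auto simp: max_bias_def)
    then show ?thesis using max_bias_stoploss_eq_0[OF symm_conv_pow[OF N(1)]] t by blast
  qed
qed

lemma stoploss_le_1:
  assumes "symm M" "0 \<le> t"
  shows "stoploss M t \<le> 1"
proof (cases "t \<le> 1")
  case True
  then show ?thesis using stoploss_lipschitz[OF assms(1), of t 1] assms by (simp add: stoploss_ge_1)
qed (simp add: stoploss_ge_1)

section \<open>Monotonicity and mixtures over the degree\<close>

lemma stoploss_le_bsc_mono:
  assumes \<delta>: "\<delta> \<in> {0..1}" and M: "symm M" "symm M'" and le: "stoploss_le M M'"
  shows "stoploss_le (bsc \<delta> \<boxtimes> M) (bsc \<delta> \<boxtimes> M')"
proof (cases "\<delta> = 1 / 2")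
  case True
  then have z: "1 - 2 * \<delta> = 0" by simp
  show ?thesis unfolding stoploss_le_def stoploss_bsc_box[OF \<delta> M(1)] stoploss_bsc_box[OF \<delta> M(2)] z by simp
next
  case False
  then show ?thesis
    using le by (simp add: stoploss_le_def stoploss_bsc_box_scale[OF \<delta> False] M mult_left_mono)
qed

lemma pmf_integral_mono:
  fixes f g :: "nat \<Rightarrow> real"
  assumes "\<And>d. \<bar>f d\<bar> \<le> 1" "\<And>d. \<bar>g d\<bar> \<le> 1" "\<And>d. f d \<le> g d"
  shows "(LINT d|(measure_pmf P). f d) \<le> (LINT d|(measure_pmf P). g d)"
  using assms by (intro integral_mono measure_pmf.integrable_const_bound[of _ 1]) auto

lemma pmf_integral_strict_mono:
  fixes f g :: "nat \<Rightarrow> real"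
  assumes "\<And>d. \<bar>f d\<bar> \<le> 1" "\<And>d. \<bar>g d\<bar> \<le> 1" "\<And>d. f d \<le> g d" and d: "d \<in> set_pmf P" "f d < g d"
  shows "(LINT d|(measure_pmf P). f d) < (LINT d|(measure_pmf P). g d)"
proof -
  have i: "integrable (measure_pmf P) f" "integrable (measure_pmf P) g"
    using assms by (intro measure_pmf.integrable_const_bound[of _ 1]; auto)+
  have "(LINT d|(measure_pmf P). f d) \<noteq> (LINT d|(measure_pmf P). g d)"
  proof
    assume "(LINT d|(measure_pmf P). f d) = (LINT d|(measure_pmf P). g d)"
    then have "(LINT d|(measure_pmf P). g d - f d) = 0" using i by simp
    then have "AE d in measure_pmf P. g d - f d = 0"
      using i assms(3) by (subst (asm) integral_nonneg_eq_0_iff_AE) auto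
    then show False using d by (auto simp: AE_measure_pmf_iff)
  qed
  then show ?thesis using pmf_integral_mono[of f g P] assms by simp
qed

context
  fixes \<delta> \<phi> c :: real and P :: "nat pmf"
  assumes \<delta>: "\<delta> \<in> {0..1}" and \<phi>: "\<phi> \<in> {0<..<1/2}" and c: "c = 1 - 2 * \<phi>"
begin

lemmas noise_c_bounds' = noise_c_bounds[OF \<phi> c] and noise_\<phi> = \<phi>01[OF \<phi> c] and symm_bsc' = symm_bsc[OF \<phi> c]
  and stoploss_bsc' = stoploss_bsc[OF \<phi> c]

text \<open>Only stop-loss functions are compared, so commuting the two noises at that level stands
  in for associativity and commutativity of \<open>\<boxtimes>\<close>.\<close>

lemma stoploss_bsc_swap:
  assumes M: "symm M"
  shows "stoploss (bsc \<delta> \<boxtimes> bsc \<phi> \<boxtimes> M) t = stoploss (bsc \<phi> \<boxtimes> bsc \<delta> \<boxtimes> M) t"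
proof -
  let ?h = "\<lambda>b. max 0 (\<bar>(1 - 2 * \<delta>) * b\<bar> - t)"
  have "stoploss (bsc \<delta> \<boxtimes> bsc \<phi> \<boxtimes> M) t = (LINT x|(bsc \<phi> \<boxtimes> M). ?h (tanh_half x))"
    by (rule stoploss_bsc_box[OF \<delta> symm_bsc'[OF M]])
  also have "\<dots> = (LINT x|M. ?h (c * tanh_half x))"
  proof -
    obtain B where B: "\<And>x. \<bar>?h (tanh_half x)\<bar> \<le> B"
      using bounded_borel_stoploss[of "1 - 2 * \<delta>" t] by (auto simp: bounded_borel_def)
    have "?h \<in> borel_measurable borel" by measurable
    moreover have "?h (- b) = ?h b" for b by simp
    ultimately show ?thesis using B by (intro integral_bsc_even[OF \<phi> c M, where h = ?h])
  qed
  also have "\<dots> = (LINT x|M. c * max 0 (\<bar>(1 - 2 * \<delta>) * tanh_half x\<bar> - t / c))"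
  proof (intro Bochner_Integration.integral_cong refl)
    fix x
    have "c * (\<bar>(1 - 2 * \<delta>) * tanh_half x\<bar> - t / c) = \<bar>(1 - 2 * \<delta>) * (c * tanh_half x)\<bar> - t"
      using noise_c_bounds' by (simp add: abs_mult right_diff_distrib)
    then show "?h (c * tanh_half x) = c * max 0 (\<bar>(1 - 2 * \<delta>) * tanh_half x\<bar> - t / c)"
      using noise_c_bounds' mult_max_zero[of c] by simp
  qed
  also have "\<dots> = stoploss (bsc \<phi> \<boxtimes> bsc \<delta> \<boxtimes> M) t"
    unfolding stoploss_bsc'[OF symm_bsc_box[OF \<delta> M]] stoploss_bsc_box[OF \<delta> M] by simp
  finally show ?thesis .
qed

lemma stoploss_bsc_bp:
  assumes M: "symm M"
  shows "stoploss (bsc \<phi> \<boxtimes> bp \<delta> P M) t = (LINT d|(measure_pmf P). stoploss (bsc \<phi> \<boxtimes> conv_pow (bsc \<delta> \<boxtimes> M) d) t)"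
  unfolding stoploss_bsc'[OF symm_bp[OF \<delta> M]] stoploss_bp[OF \<delta> M] stoploss_bsc'[OF symm_conv_pow_bsc[OF \<delta> M]] by simp

text \<open>\<open>M'\<close> need only dominate \<open>bsc \<phi> \<boxtimes> M\<close>, so that a
  second iteration can take the outputs of the first as its inputs.\<close>

context
  fixes M M' :: "ereal measure"
  assumes M: "symm M" "symm M'" and le: "stoploss_le (bsc \<phi> \<boxtimes> M) M'"
begin

lemma symm_inputs: "symm (bsc \<delta> \<boxtimes> M)" "symm (bsc \<delta> \<boxtimes> M')"
  using M by (auto intro: symm_bsc_box[OF \<delta>])

lemma input_le: "stoploss_le (bsc \<phi> \<boxtimes> bsc \<delta> \<boxtimes> M) (bsc \<delta> \<boxtimes> M')"
  using stoploss_le_bsc_mono[OF \<delta> symm_bsc'[OF M(1)] M(2) le] stoploss_bsc_swap[OF M(1)]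
  by (simp add: stoploss_le_def)

lemma conv_pow_input_le: "stoploss_le (conv_pow (bsc \<phi> \<boxtimes> bsc \<delta> \<boxtimes> M) d) (conv_pow (bsc \<delta> \<boxtimes> M') d)"
  by (intro conv_pow_mono symm_bsc' symm_inputs input_le)

lemma bsc_conv_pow_input_le: "stoploss_le (bsc \<phi> \<boxtimes> conv_pow (bsc \<delta> \<boxtimes> M) d) (conv_pow (bsc \<delta> \<boxtimes> M') d)"
  by (rule stoploss_le_trans[OF stoploss_conv_pow_gap[OF \<phi> c symm_inputs(1)] conv_pow_input_le])

lemma abs_stoploss_le_1: "symm X \<Longrightarrow> 0 \<le> t \<Longrightarrow> \<bar>stoploss X t\<bar> \<le> 1"
  using stoploss_le_1[of X t] stoploss_nonneg[of X t] by simp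

lemma bsc_bp_le: "stoploss_le (bsc \<phi> \<boxtimes> bp \<delta> P M) (bp \<delta> P M')"
  unfolding stoploss_le_def stoploss_bsc_bp[OF M(1)] stoploss_bp[OF \<delta> M(2)]
  by (intro allI impI pmf_integral_mono abs_stoploss_le_1 symm_bsc' symm_conv_pow symm_inputs stoploss_leD[OF bsc_conv_pow_input_le])

text \<open>Every degree contributes in the right direction, so one degree of positive probability
  with a strict gap is enough.\<close>

lemma bsc_bp_less:
  assumes "d \<in> set_pmf P" "0 \<le> t" "stoploss (bsc \<phi> \<boxtimes> conv_pow (bsc \<delta> \<boxtimes> M) d) t < stoploss (conv_pow (bsc \<delta> \<boxtimes> M') d) t"
  shows "stoploss (bsc \<phi> \<boxtimes> bp \<delta> P M) t < stoploss (bp \<delta> P M') t"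
  unfolding stoploss_bsc_bp[OF M(1)] stoploss_bp[OF \<delta> M(2)]
  by (intro pmf_integral_strict_mono[of _ _ d] abs_stoploss_le_1 symm_bsc' symm_conv_pow symm_inputs
      stoploss_leD[OF bsc_conv_pow_input_le] assms)

lemma stoploss_bp_eq_0:
  assumes "max_bias (bsc \<delta> \<boxtimes> M) m" "0 \<le> t" "\<And>d. d \<in> set_pmf P \<Longrightarrow> tpow m d \<le> t"
  shows "stoploss (bp \<delta> P M) t = 0"
  unfolding stoploss_bp[OF \<delta> M(1)] using assms
  by (intro integral_eq_zero_AE) (auto simp: AE_measure_pmf_iff intro!: max_bias_stoploss_conv_pow[OF symm_inputs(1)])

lemma bsc_bp_less_2:
  assumes "max_bias (bsc \<delta> \<boxtimes> M) m" "0 < m" "2 \<in> set_pmf P" "0 < t" "t \<le> c * tpow m 2"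
  shows "stoploss (bsc \<phi> \<boxtimes> bp \<delta> P M) t < stoploss (bp \<delta> P M') t"
proof (rule bsc_bp_less[OF assms(3)])
  have "stoploss (bsc \<phi> \<boxtimes> conv_pow (bsc \<delta> \<boxtimes> M) 2) t < stoploss (conv_pow (bsc \<phi> \<boxtimes> bsc \<delta> \<boxtimes> M) 2) t"
    by (rule stoploss_conv_pow_strict_2[OF \<phi> c symm_inputs(1) assms(1,2,4,5)])
  also have "\<dots> \<le> stoploss (conv_pow (bsc \<delta> \<boxtimes> M') 2) t" using assms by (intro stoploss_leD[OF conv_pow_input_le]) auto
  finally show "stoploss (bsc \<phi> \<boxtimes> conv_pow (bsc \<delta> \<boxtimes> M) 2) t < stoploss (conv_pow (bsc \<delta> \<boxtimes> M') 2) t" .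
qed (use assms in simp)

text \<open>If \<open>t \<le> c * tpow m d\<close> for some degree, this also holds for a degree
  above 2, and three or more summands are strict even at 0. Otherwise the supremum is not attained,
  the degrees are unbounded, and a large one has a positive right side while its left side
  vanishes.\<close>

lemma bsc_bp_less_large:
  assumes m: "max_bias (bsc \<delta> \<boxtimes> M) m" "0 < m" and d0: "d0 \<in> set_pmf P" "2 < d0"
    and t: "0 \<le> t" "t \<le> c * Sup (tpow m ` set_pmf P)"
  shows "stoploss (bsc \<phi> \<boxtimes> bp \<delta> P M) t < stoploss (bp \<delta> P M') t"
proof (cases "\<exists>d\<in>set_pmf P. t \<le> c * tpow m d")
  case True
  have m01: "m \<in> {0..1}" using m by (simp add: max_bias_def)
  from True obtain d where d: "d \<in> set_pmf P" "t \<le> c * tpow m d" by blast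
  define e where "e = (if 2 < d then d else d0)"
  have "tpow m d \<le> tpow m e" using d0 by (intro tpow_mono[OF m01]) (auto simp: e_def)
  then have "c * tpow m d \<le> c * tpow m e" using noise_c_bounds' by (intro mult_left_mono) auto
  then have "t \<le> c * tpow m e" using d(2) by linarith
  moreover have "e \<in> set_pmf P" "2 < e" using d d0 by (auto simp: e_def)
  ultimately have e: "e \<in> set_pmf P" "t \<le> c * tpow m e" "2 < e" by blast+
  obtain k where k: "e = Suc (Suc (Suc k))" using e(3) by (metis less_imp_Suc_add add_2_eq_Suc)
  have "stoploss (bsc \<phi> \<boxtimes> conv_pow (bsc \<delta> \<boxtimes> M) e) t < stoploss (conv_pow (bsc \<phi> \<boxtimes> bsc \<delta> \<boxtimes> M) e) t"
    unfolding k using e(2) t(1) unfolding k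
    by (intro stoploss_conv_pow_strict[OF \<phi> c symm_inputs(1) m]) auto
  also have "\<dots> \<le> stoploss (conv_pow (bsc \<delta> \<boxtimes> M') e) t" by (rule stoploss_leD[OF conv_pow_input_le t(1)])
  finally show ?thesis by (rule bsc_bp_less[OF e(1) t(1)])
next
  case False
  have m01: "m \<in> {0..1}" using m by (simp add: max_bias_def)
  have inf: "infinite (set_pmf P)"
  proof
    assume "finite (set_pmf P)"
    then have "finite (tpow m ` set_pmf P)" "tpow m ` set_pmf P \<noteq> {}" by (auto simp: set_pmf_not_empty)
    then have "Sup (tpow m ` set_pmf P) \<in> tpow m ` set_pmf P" by (simp add: cSup_eq_Max)
    then show False using False t by auto
  qed
  have "Sup (tpow m ` set_pmf P) \<le> 1"
    using tpow_bounds[OF m01] by (intro cSup_least) (auto simp: set_pmf_not_empty)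
  then have "c * Sup (tpow m ` set_pmf P) \<le> c" using noise_c_bounds' by (intro mult_left_le) auto
  then have tc: "t \<le> c" using t by simp
  have cm: "0 < c * m" "c * m \<le> 1" using noise_c_bounds' m m01 by (auto intro: mult_le_one)
  \<comment> \<open>By \<open>one_minus_tpow_le\<close> this gives
    \<open>tpow (c * m) k > c \<ge> t\<close>: sums of that many noisy summands reach beyond
    \<open>t\<close>.\<close>
  obtain k where k: "(1 - c * m) ^ k < 1 - c"
    using real_arch_pow_inv[of "1 - c" "1 - c * m"] cm noise_c_bounds' by auto
  obtain d where d: "d \<in> set_pmf P" "k < d" using inf by (metis infinite_nat_iff_unbounded)
  have cm01: "c * m \<in> {0..1}" using cm by simp
  have "tpow (c * m) k \<le> tpow (c * m) d" using d by (intro tpow_mono[OF cm01]) simp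
  then have "t < tpow (c * m) d" using one_minus_tpow_le[OF cm01, of k] k tc by linarith
  moreover obtain j where j: "d = Suc j" using d by (cases d) auto
  moreover have "max_bias (conv_pow (bsc \<phi> \<boxtimes> bsc \<delta> \<boxtimes> M) (Suc j)) (tpow (c * m) (Suc j))"
    by (rule max_bias_conv_pow[OF symm_bsc'[OF symm_inputs(1)] max_bias_bsc[OF \<phi> c symm_inputs(1) m(1)] cm(1)])
  ultimately have "0 < stoploss (conv_pow (bsc \<phi> \<boxtimes> bsc \<delta> \<boxtimes> M) d) t"
    using t(1) unfolding max_bias_def by auto
  also have "\<dots> \<le> stoploss (conv_pow (bsc \<delta> \<boxtimes> M') d) t" by (rule stoploss_leD[OF conv_pow_input_le t(1)])
  finally have pos: "0 < stoploss (conv_pow (bsc \<delta> \<boxtimes> M') d) t" .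
  have "c * tpow m d < t" using False d by (auto simp: not_le)
  then have "tpow m d \<le> t / c" using noise_c_bounds' by (simp add: field_simps)
  then have "stoploss (conv_pow (bsc \<delta> \<boxtimes> M) d) (t / c) = 0"
    using t noise_c_bounds' by (intro max_bias_stoploss_conv_pow[OF symm_inputs(1) m(1)]) auto
  then have "stoploss (bsc \<phi> \<boxtimes> conv_pow (bsc \<delta> \<boxtimes> M) d) t < stoploss (conv_pow (bsc \<delta> \<boxtimes> M') d) t"
    using pos by (simp add: stoploss_bsc' symm_conv_pow symm_inputs)
  then show ?thesis by (rule bsc_bp_less[OF d(1) t(1)])
qed

end

lemma one_step:
  assumes M: "symm M" and d0: "d0 \<in> set_pmf P" "2 < d0"
  shows "bsc \<phi> \<boxtimes> bp \<delta> P M \<prec>\<^sub>d bp \<delta> P (bsc \<phi> \<boxtimes> M)"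
proof -
  let ?N = "bsc \<delta> \<boxtimes> M" and ?R = "bp \<delta> P (bsc \<phi> \<boxtimes> M)"
  have N: "symm ?N" by (rule symm_bsc_box[OF \<delta> M])
  have L: "symm (bsc \<phi> \<boxtimes> bp \<delta> P M)" by (intro symm_bsc' symm_bp \<delta> M)
  have R: "symm ?R" by (intro symm_bp \<delta> symm_bsc' M)
  obtain m where m: "max_bias ?N m" by (rule max_bias_exists[OF N])
  then have m01: "m \<in> {0..1}" by (simp add: max_bias_def)
  define A where "A = Sup (tpow m ` set_pmf P)"
  have le_A: "tpow m d \<le> A" if "d \<in> set_pmf P" for d
    unfolding A_def using that tpow_bounds[OF m01] by (intro cSup_upper bdd_aboveI[of _ 1]) auto
  have A0: "0 \<le> A" using le_A[OF d0(1)] tpow_bounds[OF m01, of d0] by auto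
  have z: "stoploss (bp \<delta> P M) A = 0"
    by (rule stoploss_bp_eq_0[OF M symm_bsc'[OF M] stoploss_le_refl m A0 le_A])
  show ?thesis
  proof (cases "m = 0")
    case True
    have "tpow m d = 0" for d using True by (induction d) (simp_all add: tadd_def)
    then have "stoploss (bp \<delta> P M) t = 0" if "0 \<le> t" for t
      using that by (intro stoploss_bp_eq_0[OF M symm_bsc'[OF M] stoploss_le_refl m]) auto
    then show ?thesis
      using noise_c_bounds' by (intro strictly_degraded_if_stoploss_zero[OF L R]) (simp add: stoploss_bsc'[OF symm_bp[OF \<delta> M]])
  next
    case False
    then have "0 < m" using m01 by simp
    then show ?thesis
      using noise_c_bounds' A0 z unfolding A_def
      by (intro strictly_degraded_if_stoploss_less[OF L R, of "c * Sup (tpow m ` set_pmf P)"]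
          bsc_bp_less_large[OF M symm_bsc'[OF M] stoploss_le_refl m _ d0])
        (auto simp: stoploss_bsc'[OF symm_bp[OF \<delta> M]])
  qed
qed

text \<open>For \<open>t > 0\<close> the outer sum of two terms is strict by itself. At 0 it
  compares the stop-loss functions of its inputs at the bias \<open>b\<close> of one term, and these
  already differ for \<open>0 < b \<le> c * m1\<close> because the first iteration is strict at
  positive points.\<close>

lemma two_step:
  assumes M: "symm M" and d2: "2 \<in> set_pmf P" and le2: "set_pmf P \<subseteq> {..2}"
  shows "bsc \<phi> \<boxtimes> bp \<delta> P (bp \<delta> P M) \<prec>\<^sub>d bp \<delta> P (bp \<delta> P (bsc \<phi> \<boxtimes> M))"
proof -
  let ?M1 = "bp \<delta> P M" and ?M1' = "bp \<delta> P (bsc \<phi> \<boxtimes> M)" and ?e = "\<bar>1 - 2 * \<delta>\<bar>"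
  let ?N = "bsc \<delta> \<boxtimes> M" and ?N1 = "bsc \<delta> \<boxtimes> ?M1" and ?N1' = "bsc \<delta> \<boxtimes> ?M1'"
  have s: "symm ?M1" "symm ?M1'" "symm ?N" "symm ?N1" "symm ?N1'"
    by (intro symm_bp symm_bsc_box[OF \<delta>] symm_bsc' \<delta> M)+
  have L: "symm (bsc \<phi> \<boxtimes> bp \<delta> P ?M1)" and R: "symm (bp \<delta> P ?M1')"
    by (intro symm_bsc' symm_bp \<delta> s)+
  have le: "stoploss_le (bsc \<phi> \<boxtimes> ?M1) ?M1'"
    by (rule bsc_bp_le[OF M symm_bsc'[OF M] stoploss_le_refl])
  obtain m where m: "max_bias ?N m" by (rule max_bias_exists[OF s(3)])
  obtain m1 where m1: "max_bias ?N1 m1" by (rule max_bias_exists[OF s(4)])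
  have m01: "m \<in> {0..1}" "m1 \<in> {0..1}" using m m1 by (simp_all add: max_bias_def)
  have tpow_le: "tpow x d \<le> tpow x 2" if "d \<in> set_pmf P" "x \<in> {0..1}" for x d
    using that le2 by (intro tpow_mono) auto
  have t2: "0 \<le> tpow x 2" if "x \<in> {0..1}" for x using tpow_bounds[OF that, of 2] by simp
  have z1: "stoploss ?M1 t = 0" if "tpow m 2 \<le> t" for t
    using that t2[OF m01(1)] tpow_le[OF _ m01(1)]
    by (intro stoploss_bp_eq_0[OF M symm_bsc'[OF M] stoploss_le_refl m]) force+
  have z2: "stoploss (bp \<delta> P ?M1) t = 0" if "tpow m1 2 \<le> t" for t
    using that t2[OF m01(2)] tpow_le[OF _ m01(2)]
    by (intro stoploss_bp_eq_0[OF s(1,2) le m1]) force+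
  show ?thesis
  proof (cases "m1 = 0")
    case True
    then have "tpow m1 2 = 0" by (simp add: numeral_2_eq_2 tadd_def)
    then show ?thesis
      using noise_c_bounds' z2 by (intro strictly_degraded_if_stoploss_zero[OF L R]) (simp add: stoploss_bsc'[OF symm_bp[OF \<delta> s(1)]])
  next
    case False
    then have m1pos: "0 < m1" using m01 by simp
    have e: "\<delta> \<noteq> 1 / 2"
    proof
      assume "\<delta> = 1 / 2"
      then have "stoploss ?N1 0 = 0" using \<delta> by (simp add: stoploss_bsc_box s(1))
      moreover have "0 < stoploss ?N1 0" using m1 m1pos by (simp add: max_bias_def)
      ultimately show False by simp
    qed
    then have e0: "0 < ?e" by simp
    \<comment> \<open>The inner comparison is strict only up to \<open>c * tpow m 2\<close>; this
      bound keeps every \<open>b \<le> c * m1\<close> in that range after division by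
      \<open>?e\<close>.\<close>
    have m1_le: "m1 \<le> ?e * tpow m 2"
    proof (rule ccontr)
      assume "\<not> m1 \<le> ?e * tpow m 2"
      then have "0 < stoploss ?N1 (?e * tpow m 2)" using m1 t2[OF m01(1)] by (auto simp: max_bias_def)
      moreover have "stoploss ?N1 (?e * tpow m 2) = 0"
        using z1[of "tpow m 2"] e0 by (simp add: stoploss_bsc_box_scale[OF \<delta> e s(1)])
      ultimately show False by simp
    qed
    have mpos: "0 < m"
    proof (rule ccontr)
      assume "\<not> 0 < m"
      then have "m = 0" using m01 by simp
      then have "tpow m 2 = 0" by (simp add: numeral_2_eq_2 tadd_def)
      then show False using m1_le m1pos by simp
    qed
    have \<kappa>: "symm (bsc \<phi> \<boxtimes> ?N1)" by (rule symm_bsc'[OF s(4)])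
    have input_less: "stoploss (bsc \<phi> \<boxtimes> ?N1) b < stoploss ?N1' b" if b: "0 < b" "b \<le> c * m1" for b
    proof -
      have "b \<le> c * (?e * tpow m 2)" using b m1_le noise_c_bounds' mult_left_mono[OF m1_le, of c] by linarith
      then have "b / ?e \<le> c * tpow m 2" using e0 by (simp add: pos_divide_le_eq mult_ac)
      then have "stoploss (bsc \<phi> \<boxtimes> ?M1) (b / ?e) < stoploss ?M1' (b / ?e)"
        using b e0 by (intro bsc_bp_less_2[OF M symm_bsc'[OF M] stoploss_le_refl m mpos d2]) auto
      then have "?e * stoploss (bsc \<phi> \<boxtimes> ?M1) (b / ?e) < ?e * stoploss ?M1' (b / ?e)"
        using e0 by (rule mult_strict_left_mono)
      then show ?thesis
        unfolding stoploss_bsc_swap[OF s(1), symmetric] stoploss_bsc_box_scale[OF \<delta> e symm_bsc'[OF s(1)]]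
          stoploss_bsc_box_scale[OF \<delta> e s(2)] .
    qed
    have nle: "stoploss_le (bsc \<phi> \<boxtimes> ?N1) ?N1'" by (rule input_le[OF s(1,2) le])
    have m\<kappa>: "max_bias (bsc \<phi> \<boxtimes> ?N1) (c * m1)" by (rule max_bias_bsc[OF \<phi> c s(4) m1])
    have at_0: "stoploss (bsc \<phi> \<boxtimes> bp \<delta> P ?M1) 0 < stoploss (bp \<delta> P ?M1') 0"
    proof (rule bsc_bp_less[OF s(1,2) le d2])
      have p2: "conv_pow \<rho> 2 = add_conv \<rho> \<rho>" if "symm \<rho>" for \<rho>
        using conv_pow_1[OF that] by (simp add: numeral_2_eq_2)
      have "stoploss (bsc \<phi> \<boxtimes> conv_pow ?N1 2) 0 \<le> stoploss (conv_pow (bsc \<phi> \<boxtimes> ?N1) 2) 0"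
        by (rule stoploss_leD[OF stoploss_conv_pow_gap[OF \<phi> c s(4)]]) simp
      also have "\<dots> = stoploss (add_conv (bsc \<phi> \<boxtimes> ?N1) (bsc \<phi> \<boxtimes> ?N1)) 0" by (simp add: p2[OF \<kappa>])
      \<comment> \<open>At \<open>t = 0\<close> the point
        \<open>\<bar>b - t\<bar> / (1 - b * t)\<close> is \<open>b\<close> itself, so
        \<open>input_less\<close> applies. Replacing one term strictly suffices; the other is
        replaced weakly.\<close>
      also have "\<dots> < stoploss (add_conv ?N1' (bsc \<phi> \<boxtimes> ?N1)) 0"
        by (rule stoploss_add_conv_strict_mono[OF \<kappa> s(5) \<kappa> nle _ m\<kappa>, of 0 0])
          (use noise_c_bounds' m1pos input_less in auto)
      also have "\<dots> \<le> stoploss (add_conv ?N1' ?N1') 0"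
        by (rule stoploss_leD[OF stoploss_add_conv_mono2[OF s(5) s(5) \<kappa> s(5) stoploss_le_refl nle]]) simp
      also have "\<dots> = stoploss (conv_pow ?N1' 2) 0" by (simp add: p2[OF s(5)])
      finally show "stoploss (bsc \<phi> \<boxtimes> conv_pow ?N1 2) 0 < stoploss (conv_pow ?N1' 2) 0" .
    qed simp
    show ?thesis
    proof (rule strictly_degraded_if_stoploss_less[OF L R, of "c * tpow m1 2"])
      show "0 \<le> c * tpow m1 2" using noise_c_bounds' t2[OF m01(2)] by simp
      show "stoploss (bsc \<phi> \<boxtimes> bp \<delta> P ?M1) (c * tpow m1 2) = 0"
        using noise_c_bounds' z2[of "tpow m1 2"] by (simp add: stoploss_bsc'[OF symm_bp[OF \<delta> s(1)]])
      fix t assume "t \<in> {0..c * tpow m1 2}"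
      then show "stoploss (bsc \<phi> \<boxtimes> bp \<delta> P ?M1) t < stoploss (bp \<delta> P ?M1') t"
        using at_0 bsc_bp_less_2[OF s(1,2) le m1 m1pos d2, of t] by (cases "t = 0") auto
    qed
  qed
qed

end

theorem theorem11:
  fixes \<delta> \<phi> :: real and P :: "nat pmf" and \<mu> :: "ereal measure"
  assumes "\<delta> \<in> {0..1}"
    and "measure_pmf.prob P {d. d \<le> 1} < 1"
    and "\<phi> \<in> {0<..<1/2}"
    and "symmetric_dist \<mu>"
  shows "if measure_pmf.prob P {d. d > 2} = 0
         then bsc \<phi> \<boxtimes> (bp \<delta> P ^^ 2) \<mu> \<prec>\<^sub>d (bp \<delta> P ^^ 2) (bsc \<phi> \<boxtimes> \<mu>)
         else bsc \<phi> \<boxtimes> bp \<delta> P \<mu> \<prec>\<^sub>d bp \<delta> P (bsc \<phi> \<boxtimes> \<mu>)"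
proof -
  have \<mu>: "symm \<mu>" by (rule symmetric_dist_symm[OF assms(4)])
  have zero: "measure_pmf.prob P {d. 2 < d} = 0 \<longleftrightarrow> set_pmf P \<subseteq> {..2}"
    by (subst measure_pmf_zero_iff) (auto simp: not_less[symmetric])
  show ?thesis
  proof (cases "measure_pmf.prob P {d. 2 < d} = 0")
    case True
    then have le2: "set_pmf P \<subseteq> {..2}" using zero by simp
    \<comment> \<open>Degrees at most 1 are not almost sure, so with none above 2 the degree 2 must
      occur.\<close>
    have "2 \<in> set_pmf P"
    proof (rule ccontr)
      assume n2: "2 \<notin> set_pmf P"
      have "d \<le> 1" if "d \<in> set_pmf P" for d
        using that n2 le2 by (cases "d = 2") force+
      then have "measure_pmf.prob P {d. d \<le> 1} = 1"
        by (subst measure_pmf.prob_eq_1) (auto simp: AE_measure_pmf_iff)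
      then show False using assms(2) by simp
    qed
    then show ?thesis
      using two_step[OF assms(1,3) refl \<mu> _ le2] True by (simp add: numeral_2_eq_2)
  next
    case False
    then obtain d0 where "d0 \<in> set_pmf P" "2 < d0" using zero by (auto simp: not_le subset_eq)
    then show ?thesis using one_step[OF assms(1,3) refl \<mu>] False by simp
  qed
qed

end
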